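(* Let $h:\Phi^c\to\Psi^d$ be a random simple tabulation function whose character tables are mutually independent and each $100$-independent (e.g. fully random). Then: (1) If $\Phi=\Psi=[2^{16}]$, $c=2$, $d=20$, the probability that $h$ is not $100$-unique is at most $1.5\times10^{-42}$. (2) If $\Phi=\Psi=[2^{22}]$, $c=3$, $d=24$, the probability that $h$ is not $100$-unique is at most $1.4\times10^{-49}$. (3) If $\Phi=[2^{16}]$, $\Psi=[2^{32}]$, $c=4$, $d=14$, the probability that $h$ is not $100$-unique is at most $9.0\times10^{-36}$.
   Context: $\Psi=[2^m]$ is identified with $m$-bit strings and $\oplus$ is bitwise exclusive-or applied coordinatewise on $\Psi^d$. A simple tabulation function $h:\Phi^c\to\Psi^d$ is given by character tables $h_0,\dots,h_{c-1}:\Phi\to\Psi^d$ with $h(x)=h_0(x_0)\oplus\cdots\oplus h_{c-1}(x_{c-1})$. A table is $k$-independent if its values on any $k$ distinct arguments are independent and uniform in $\Psi^d$. For $y\in\Psi^d$, $y_j$ is its $j$-th coordinate. $h$ is $k$-unique if every nonempty $X\subseteq\Phi^c$ with $|X|\le k$ has a unique output position character, i.e. some $(j,a)\in[d]\times\Psi$ such that exactly one $x\in X$ has $h(x)_j=a$. *)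

theory Defs
  imports "HOL-Probability.Probability"
begin

text \<open>
  Conventions. Phi = [phi] = {0..<phi}, Psi = [psi] = {0..<psi} with psi = 2^m, values
  as natural numbers (m-bit strings), xor = bitwise exclusive or on nat.
  A random outcome w :: nat => nat => nat => nat encodes the c character tables:
  w i x j is coordinate j of h_i(x). Only the part x < phi, j < d is meaningful.
\<close>

definition tab :: "nat \<Rightarrow> nat \<Rightarrow> (nat \<Rightarrow> nat \<Rightarrow> nat \<Rightarrow> nat) \<Rightarrow> nat \<Rightarrow> nat \<Rightarrow> nat \<Rightarrow> nat" where
  "tab phi d w i = (\<lambda>x j. if x < phi \<and> j < d then w i x j else 0)"

definition keys :: "nat \<Rightarrow> nat \<Rightarrow> (nat \<Rightarrow> nat) set" where
  "keys phi c = {..<c} \<rightarrow>\<^sub>E {..<phi}"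

definition simple_tab :: "(nat \<Rightarrow> nat \<Rightarrow> nat \<Rightarrow> nat) \<Rightarrow> nat \<Rightarrow> (nat \<Rightarrow> nat) \<Rightarrow> nat \<Rightarrow> nat" where
  "simple_tab w c x j = foldr (\<lambda>i acc. xor (w i (x i) j) acc) [0..<c] 0"

definition k_unique :: "nat \<Rightarrow> nat \<Rightarrow> nat \<Rightarrow> nat \<Rightarrow> nat \<Rightarrow> ((nat \<Rightarrow> nat) \<Rightarrow> nat \<Rightarrow> nat) \<Rightarrow> bool" where
  "k_unique phi psi c d k h \<longleftrightarrow>
     (\<forall>X. X \<subseteq> keys phi c \<and> X \<noteq> {} \<and> card X \<le> k \<longrightarrow>
        (\<exists>j<d. \<exists>a<psi. card {x\<in>X. h x j = a} = 1))"

definition k_indep_table :: "'w pmf \<Rightarrow> ('w \<Rightarrow> nat \<Rightarrow> nat \<Rightarrow> nat) \<Rightarrow> nat \<Rightarrow> nat \<Rightarrow> nat \<Rightarrow> nat \<Rightarrow> bool" where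
  "k_indep_table p t phi psi d k \<longleftrightarrow>
     (\<forall>X v. X \<subseteq> {..<phi} \<and> card X \<le> k \<and> (\<forall>x\<in>X. \<forall>j<d. v x j < psi) \<longrightarrow>
        measure_pmf.prob p {w. \<forall>x\<in>X. \<forall>j<d. t w x j = v x j}
          = (1 / real psi) ^ (d * card X))"

definition random_simple_tabulation :: "(nat \<Rightarrow> nat \<Rightarrow> nat \<Rightarrow> nat) pmf \<Rightarrow> nat \<Rightarrow> nat \<Rightarrow> nat \<Rightarrow> nat \<Rightarrow> nat \<Rightarrow> bool" where
  "random_simple_tabulation p phi psi c d k \<longleftrightarrow>
     prob_space.indep_vars (measure_pmf p) (\<lambda>_. count_space UNIV) (\<lambda>i w. tab phi d w i) {..<c}
     \<and> (\<forall>i<c. k_indep_table p (\<lambda>w. tab phi d w i) phi psi d k)"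

definition prob_not_unique :: "(nat \<Rightarrow> nat \<Rightarrow> nat \<Rightarrow> nat) pmf \<Rightarrow> nat \<Rightarrow> nat \<Rightarrow> nat \<Rightarrow> nat \<Rightarrow> nat \<Rightarrow> real" where
  "prob_not_unique p phi psi c d k =
     measure_pmf.prob p {w. \<not> k_unique phi psi c d k (simple_tab w c)}"

end

theory Submission
  imports Defs
begin

text \<open>
  Call a pair (position, character) a position character. Two keys collide in output \<open>j\<close> iff the
  \<open>j\<close>-th table entries over the symmetric difference of their position characters xor to 0.
  Suppose a set \<open>X\<close> of at most 100 keys has no unique output position character, and order the
  position characters of \<open>X\<close> by decreasing degree in \<open>X\<close>. In each output \<open>j\<close>, Gaussian elimination
  picks independent relations with distinct leading position characters; as each collision class
  contains at most one key avoiding all leaders, the leaders cover at least half of \<open>X\<close>. Abel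
  summation over the degrees, weighted by prices that sum to \<open>d / 2\<close> over the \<open>c\<close> positions, yields
  a prefix \<open>S\<close> of the order whose relations are many compared with \<open>card S\<close>. The uniform
  price \<open>d / (2 c)\<close> is used unless the first two position characters lie in one position and collide
  in more than \<open>d / c\<close> outputs; then the price of that position is raised.

  A triangular system of \<open>m\<close> relations holds with probability at most \<open>psi ^ (- m)\<close>, and a union bound
  over \<open>S\<close> and the relations finishes the proof. The relations over \<open>S\<close> are counted in two ways:
  as all position-even subsets of \<open>S\<close>, or as differences of at most 100 restrictions of keys to \<open>S\<close>.
  For the numbers, base-2 logarithms are scaled by 1024 and rounded to integers; large \<open>S\<close> are
  handled by a bound that is geometric in \<open>card S\<close>.
\<close>

text \<open>The obstacle is a prefix of two position characters. Such a prefix is one pair that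
  collides in more than \<open>d / c\<close> outputs, and the number of pairs is too large for a
  union bound over pairs to rule this out for every such number of outputs. Raising the price of the
  pair's position to half the number of its collisions lets the pair just break even, so Abel
  summation has to produce a longer prefix. Pairs with still more collisions are rare enough to be
  excluded by themselves.

  Although the relations are chosen as in Gaussian elimination, they are never added to each other:
  distinct leaders already make the system triangular. Each chosen relation therefore remains the
  difference of two keys, which both ways of counting require. Position-even subsets are few only
  for small \<open>S\<close>; fixing 100 restricted keys is expensive but leaves only
  \<open>100 choose 2 = 4950\<close> differences per output. The numerically critical sizes are the
  smallest ones and those at which the two counts cross.\<close>

section \<open>Collisions as vanishing xor sums over position characters\<close>

interpretation XorF: comm_monoid_set "xor :: nat \<Rightarrow> nat \<Rightarrow> nat" 0
  by unfold_locales (simp_all add: ac_simps)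

definition pos_chars :: "nat \<Rightarrow> (nat \<Rightarrow> nat) \<Rightarrow> (nat \<times> nat) set" where
  "pos_chars c x = (\<lambda>i. (i, x i)) ` {..<c}"

definition xor_sum :: "(nat \<Rightarrow> nat \<Rightarrow> nat \<Rightarrow> nat) \<Rightarrow> nat \<Rightarrow> (nat \<times> nat) set \<Rightarrow> nat" where
  "xor_sum w j v = XorF.F (\<lambda>(i, a). w i a j) v"

definition zero_relations :: "(nat \<Rightarrow> nat \<Rightarrow> nat \<Rightarrow> nat) \<Rightarrow> (nat \<times> (nat \<times> nat) set) set \<Rightarrow> bool" where
  "zero_relations w G \<longleftrightarrow> (\<forall>(j, v)\<in>G. xor_sum w j v = 0)"

text \<open>One rank serves all outputs, while pivots have to differ only within an output. Each
  relation fixes its pivot's entry in terms of entries of smaller rank, and no two relations fix the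
  same entry.\<close>

definition triangular :: "(nat \<times> (nat \<times> nat) set) set \<Rightarrow> bool" where
  "triangular G \<longleftrightarrow> (\<exists>(rk :: nat \<times> nat \<Rightarrow> nat) piv.
     (\<forall>(j, v)\<in>G. piv j v \<in> v \<and> (\<forall>\<beta>\<in>v. \<beta> \<noteq> piv j v \<longrightarrow> rk \<beta> < rk (piv j v)))
     \<and> inj_on (\<lambda>(j, v). (j, piv j v)) G)"

definition fiber :: "nat \<Rightarrow> (nat \<times> nat) set \<Rightarrow> nat set" where
  "fiber i S = {a. (i, a) \<in> S}"

lemma finite_fiber: "finite S \<Longrightarrow> finite (fiber i S)"
proof (rule finite_subset)
  show "fiber i S \<subseteq> snd ` S" unfolding fiber_def by (intro subsetI, drule CollectD, force)
qed simp

lemma nat_xor_eq_0_iff: "xor (a :: nat) b = 0 \<longleftrightarrow> a = b"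
  by (auto simp: bit_eq_iff bit_xor_iff)

lemma nat_xor_cancel: "xor (a :: nat) (xor a b) = b"
  by (simp flip: xor.assoc)

lemma nat_xor_less: "(a :: nat) < 2 ^ m \<Longrightarrow> b < 2 ^ m \<Longrightarrow> xor a b < 2 ^ m"
  by (metis take_bit_nat_eq_self_iff take_bit_xor)

lemma simple_tab_eq_xor_sum: "simple_tab w c x j = xor_sum w j (pos_chars c x)"
proof -
  have inj: "inj_on (\<lambda>i. (i, x i)) {..<c}" by (auto simp: inj_on_def)
  have "foldr (\<lambda>i acc. xor (w i (x i) j) acc) [0..<c] b
      = xor (XorF.F (\<lambda>i. w i (x i) j) {..<c}) b" for b
    by (induction c arbitrary: b) (auto simp: lessThan_Suc ac_simps)
  then show ?thesis
    by (simp add: simple_tab_def xor_sum_def pos_chars_def XorF.reindex[OF inj] o_def)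
qed

lemma xor_sum_sym_diff:
  assumes "finite A" "finite B"
  shows "xor_sum w j (sym_diff A B) = xor (xor_sum w j A) (xor_sum w j B)"
proof -
  let ?f = "\<lambda>(i, a). w i a j"
  have A: "XorF.F ?f A = xor (XorF.F ?f (A - B)) (XorF.F ?f (A \<inter> B))"
    using assms by (subst XorF.union_disjoint[symmetric]) (auto intro: arg_cong2[where f = XorF.F])
  have B: "XorF.F ?f B = xor (XorF.F ?f (B - A)) (XorF.F ?f (A \<inter> B))"
    using assms by (subst XorF.union_disjoint[symmetric]) (auto intro: arg_cong2[where f = XorF.F])
  have "XorF.F ?f (sym_diff A B) = xor (XorF.F ?f (A - B)) (XorF.F ?f (B - A))"
    using assms by (subst XorF.union_disjoint) auto
  then show ?thesis
    unfolding xor_sum_def A B by (simp add: ac_simps nat_xor_cancel)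
qed

lemma simple_tab_collision_iff:
  "simple_tab w c x j = simple_tab w c y j
     \<longleftrightarrow> xor_sum w j (sym_diff (pos_chars c x) (pos_chars c y)) = 0"
  by (subst xor_sum_sym_diff) (auto simp: simple_tab_eq_xor_sum pos_chars_def nat_xor_eq_0_iff)

text \<open>Satisfying assignments are determined by their values off the pivots.\<close>

lemma card_solutions_le:
  fixes psi d :: nat and G :: "(nat \<times> (nat \<times> nat) set) set"
  defines "S \<equiv> \<Union> (snd ` G)"
  defines "F \<equiv> (S \<times> {..<d}) \<rightarrow>\<^sub>E {..<psi}"
  assumes "finite G" "finite S" "fst ` G \<subseteq> {..<d}" "triangular G"
  shows "card {g \<in> F. \<forall>(j, v)\<in>G. XorF.F (\<lambda>\<alpha>. g (\<alpha>, j)) v = 0} * psi ^ card G \<le> psi ^ (d * card S)"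
proof -
  obtain rk :: "nat \<times> nat \<Rightarrow> nat" and piv where
    piv: "\<And>j v. (j, v) \<in> G \<Longrightarrow> piv j v \<in> v"
    and rk: "\<And>j v \<beta>. (j, v) \<in> G \<Longrightarrow> \<beta> \<in> v \<Longrightarrow> \<beta> \<noteq> piv j v \<Longrightarrow> rk \<beta> < rk (piv j v)"
    and inj: "inj_on (\<lambda>(j, v). (j, piv j v)) G"
    using assms(6) unfolding triangular_def by fast
  define Sol where "Sol = {g \<in> F. \<forall>(j, v)\<in>G. XorF.F (\<lambda>\<alpha>. g (\<alpha>, j)) v = 0}"
  define Pv where "Pv = (\<lambda>(j, v). (piv j v, j)) ` G"
  have cardP: "card Pv = card G"
    unfolding Pv_def
  proof (rule card_image)
    show "inj_on (\<lambda>(j, v). (piv j v, j)) G" using inj by (auto simp: inj_on_def)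
  qed
  have Psub: "Pv \<subseteq> S \<times> {..<d}"
    using assms(5) piv unfolding Pv_def S_def by force
  define R where "R = S \<times> {..<d} - Pv"
  have finS: "finite (S \<times> {..<d})" using assms(4) by simp
  have cardR: "card R + card G = d * card S"
    using Psub finS card_mono[OF finS Psub] unfolding R_def
    by (subst card_Diff_subset) (auto simp: finite_subset cardP card_cartesian_product)
  have injr: "inj_on (\<lambda>g. restrict g R) Sol"
  proof (rule inj_onI)
    fix g g' assume g: "g \<in> Sol" and g': "g' \<in> Sol" and eq: "restrict g R = restrict g' R"
    have fv: "finite v" if "(j, v) \<in> G" for j v
      using that assms(4) unfolding S_def by (metis Sup_upper finite_subset image_eqI snd_conv)
    \<comment> \<open>Induction on the rank: a pivot entry is the xor of the other entries of its
      relation, all of smaller rank.\<close>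
    have "g (\<alpha>, j) = g' (\<alpha>, j)" if "\<alpha> \<in> S" "j < d" for \<alpha> j
      using that
    proof (induction "rk \<alpha>" arbitrary: \<alpha> rule: less_induct)
      case less
      show ?case
      proof (cases "(\<alpha>, j) \<in> Pv")
        case False
        then have "(\<alpha>, j) \<in> R" using less.prems unfolding R_def by simp
        then show ?thesis using fun_cong[OF eq, of "(\<alpha>, j)"] by simp
      next
        case True
        then obtain v where v: "(j, v) \<in> G" and a: "\<alpha> = piv j v" unfolding Pv_def by auto
        have sol: "XorF.F (\<lambda>\<alpha>. h (\<alpha>, j)) v = 0" if "h \<in> Sol" for h
          using that v unfolding Sol_def by auto
        have dec: "h (\<alpha>, j) = XorF.F (\<lambda>\<alpha>. h (\<alpha>, j)) (v - {\<alpha>})" if "h \<in> Sol" for h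
          using sol[OF that] XorF.remove[OF fv[OF v], of \<alpha> "\<lambda>\<alpha>. h (\<alpha>, j)"] piv[OF v]
          by (simp add: a nat_xor_eq_0_iff)
        have "XorF.F (\<lambda>\<alpha>. g (\<alpha>, j)) (v - {\<alpha>}) = XorF.F (\<lambda>\<alpha>. g' (\<alpha>, j)) (v - {\<alpha>})"
        proof (rule XorF.cong)
          fix \<beta> assume "\<beta> \<in> v - {\<alpha>}"
          then show "g (\<beta>, j) = g' (\<beta>, j)"
            using less.hyps[of \<beta>] rk[OF v, of \<beta>] less.prems(2) v a
            unfolding S_def by force
        qed simp
        then show ?thesis using dec[OF g] dec[OF g'] by simp
      qed
    qed
    then show "g = g'"
      using g g' unfolding Sol_def F_def
      by (intro PiE_ext[of g "S \<times> {..<d}" "\<lambda>_. {..<psi}" g']) auto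
  qed
  have "(\<lambda>g. restrict g R) ` Sol \<subseteq> R \<rightarrow>\<^sub>E {..<psi}"
    unfolding Sol_def F_def R_def by (auto simp: PiE_def)
  moreover have "finite (R \<rightarrow>\<^sub>E {..<psi})"
    using finS by (intro finite_PiE) (auto simp: R_def)
  ultimately have "card Sol \<le> card (R \<rightarrow>\<^sub>E {..<psi})"
    by (metis card_image card_mono injr)
  also have "\<dots> = psi ^ card R"
    using finS by (subst card_PiE) (auto simp: R_def)
  finally have "card Sol * psi ^ card G \<le> psi ^ (card R + card G)"
    by (simp add: power_add)
  then show ?thesis unfolding cardR Sol_def .
qed

section \<open>Probability that a triangular system holds\<close>

locale random_tab =
  fixes p :: "(nat \<Rightarrow> nat \<Rightarrow> nat \<Rightarrow> nat) pmf" and phi psi c d k :: nat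
  assumes rst: "random_simple_tabulation p phi psi c d k"
    and psi: "0 < psi" and c: "0 < c" and k: "0 < k"
begin

definition chars :: "(nat \<times> nat) set" where "chars = {..<c} \<times> {..<phi}"

text \<open>The sets of position characters on which \<open>k\<close>-independence of every table
  gives the joint distribution.\<close>

definition thin :: "(nat \<times> nat) set \<Rightarrow> bool" where
  "thin S \<longleftrightarrow> S \<subseteq> chars \<and> (\<forall>i<c. card (fiber i S) \<le> k)"

lemma finite_chars: "finite chars" by (simp add: chars_def)

lemma thin_finite: "thin S \<Longrightarrow> finite S"
  using finite_chars by (auto simp: thin_def intro: finite_subset)

lemma thin_mono: "thin S \<Longrightarrow> T \<subseteq> S \<Longrightarrow> thin T"
  unfolding thin_def
proof (intro conjI allI impI)
  fix i assume S: "S \<subseteq> chars \<and> (\<forall>i<c. card (fiber i S) \<le> k)" and T: "T \<subseteq> S" and i: "i < c"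
  have "fiber i S \<subseteq> {..<phi}" using S by (auto simp: fiber_def chars_def)
  then have "card (fiber i T) \<le> card (fiber i S)"
    using T by (intro card_mono) (auto simp: fiber_def finite_subset)
  then show "card (fiber i T) \<le> k" using S i by (meson order_trans)
qed auto

lemma card_fibers: 
  assumes "S \<subseteq> chars"
  shows "(\<Sum>i<c. card (fiber i S)) = card S"
proof -
  have eq: "S = Sigma {..<c} (\<lambda>i. fiber i S)"
  proof (rule set_eqI)
    fix z :: "nat \<times> nat"
    show "z \<in> S \<longleftrightarrow> z \<in> Sigma {..<c} (\<lambda>i. fiber i S)"
      using assms by (cases z) (auto simp: fiber_def chars_def)
  qed
  have "finite (fiber i S)" for i
    using finite_fiber finite_subset[OF assms finite_chars] .
  then have "card (Sigma {..<c} (\<lambda>i. fiber i S)) = (\<Sum>i<c. card (fiber i S))"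
    by (intro card_SigmaI) auto
  then show ?thesis using arg_cong[OF eq, of card] by linarith
qed

definition agree :: "(nat \<times> nat) set \<Rightarrow> ((nat \<times> nat) \<times> nat \<Rightarrow> nat) \<Rightarrow> (nat \<Rightarrow> nat \<Rightarrow> nat \<Rightarrow> nat) set" where
  "agree S g = {w. \<forall>(i, a)\<in>S. \<forall>j<d. w i a j = g ((i, a), j)}"

lemma agreeD: "w \<in> agree S g \<Longrightarrow> (i, a) \<in> S \<Longrightarrow> j < d \<Longrightarrow> w i a j = g ((i, a), j)"
  unfolding agree_def by blast

lemma prob_agree:
  assumes S: "thin S" and g: "g \<in> (S \<times> {..<d}) \<rightarrow>\<^sub>E {..<psi}"
  shows "measure_pmf.prob p (agree S g) = (1 / real psi) ^ (d * card S)"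
proof -
  have indep: "prob_space.indep_vars (measure_pmf p) (\<lambda>_. count_space UNIV) (\<lambda>i w. tab phi d w i) {..<c}"
    and kind: "\<And>i. i < c \<Longrightarrow> k_indep_table p (\<lambda>w. tab phi d w i) phi psi d k"
    using rst unfolding random_simple_tabulation_def by auto
  define A where "A i = {t. \<forall>a\<in>fiber i S. \<forall>j<d. t a j = g ((i, a), j)}" for i
  have Ssub: "S \<subseteq> chars" using S by (simp add: thin_def)
  \<comment> \<open>Inside \<open>chars\<close> and below \<open>d\<close> the tables
    \<open>tab\<close> coincide with \<open>w\<close>, so independence of the tables turns the event
    into a product.\<close>
  have "agree S g = (\<Inter>i\<in>{..<c}. (\<lambda>w. tab phi d w i) -` A i \<inter> space (measure_pmf p))"
    using Ssub unfolding agree_def A_def chars_def fiber_def tab_def by fastforce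
  then have "measure_pmf.prob p (agree S g)
      = (\<Prod>i<c. measure_pmf.prob p ((\<lambda>w. tab phi d w i) -` A i \<inter> space (measure_pmf p)))"
    using c prob_space.indep_varsD_finite[OF measure_pmf.prob_space_axioms indep, of A] by auto
  also have "\<dots> = (\<Prod>i<c. (1 / real psi) ^ (d * card (fiber i S)))"
  proof (rule prod.cong)
    fix i assume "i \<in> {..<c}"
    then have i: "i < c" by simp
    have "fiber i S \<subseteq> {..<phi} \<and> card (fiber i S) \<le> k \<and> (\<forall>x\<in>fiber i S. \<forall>j<d. g ((i, x), j) < psi)"
      using S g i unfolding thin_def by (fastforce simp: fiber_def chars_def PiE_def Pi_def)
    then have "measure_pmf.prob p {w. \<forall>x\<in>fiber i S. \<forall>j<d. tab phi d w i x j = g ((i, x), j)}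
       = (1 / real psi) ^ (d * card (fiber i S))"
      using kind[OF i] unfolding k_indep_table_def
      by (elim allE[where x = "fiber i S"] allE[where x = "\<lambda>x j. g ((i, x), j)"]) blast
    then show "measure_pmf.prob p ((\<lambda>w. tab phi d w i) -` A i \<inter> space (measure_pmf p))
       = (1 / real psi) ^ (d * card (fiber i S))"
      by (simp add: A_def vimage_def)
  qed simp
  also have "\<dots> = (1 / real psi) ^ (d * card S)"
    by (simp add: power_sum[symmetric] sum_distrib_left[symmetric] card_fibers[OF Ssub])
  finally show ?thesis .
qed

lemma agree_disjoint:
  assumes "g \<in> (S \<times> {..<d}) \<rightarrow>\<^sub>E {..<psi}" "g' \<in> (S \<times> {..<d}) \<rightarrow>\<^sub>E {..<psi}" "g \<noteq> g'"
  shows "agree S g \<inter> agree S g' = {}"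
proof (rule ccontr)
  assume "agree S g \<inter> agree S g' \<noteq> {}"
  then obtain w where "w \<in> agree S g" "w \<in> agree S g'" by auto
  then have "g z = g' z" if "z \<in> S \<times> {..<d}" for z
    using that agreeD[of w S g] agreeD[of w S g'] by (metis SigmaE lessThan_iff surj_pair)
  then show False using assms by (metis PiE_ext)
qed

text \<open>Independence is assumed only for values below \<open>psi\<close>. The assignments of
  such values to \<open>S\<close> have disjoint events whose probabilities add up to 1, so nothing
  is left for larger values.\<close>

lemma prob_out_of_range:
  assumes S: "thin S"
  shows "measure_pmf.prob p {w. \<exists>(i, a)\<in>S. \<exists>j<d. psi \<le> w i a j} = 0"
proof -
  let ?F = "(S \<times> {..<d}) \<rightarrow>\<^sub>E {..<psi}"
  let ?U = "\<Union>g\<in>?F. agree S g"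
  have finS: "finite S" using S by (rule thin_finite)
  have finF: "finite ?F" using finS by (intro finite_PiE) auto
  have "measure_pmf.prob p ?U = (\<Sum>g\<in>?F. measure_pmf.prob p (agree S g))"
    using finF agree_disjoint by (intro measure_pmf.finite_measure_finite_Union) (auto simp: disjoint_family_on_def)
  also have "\<dots> = real (card ?F) * (1 / real psi) ^ (d * card S)"
    by (simp add: prob_agree[OF S])
  also have "card ?F = psi ^ (d * card S)"
    using finS by (subst card_PiE) (auto simp: card_cartesian_product mult.commute)
  also have "real (psi ^ (d * card S)) * (1 / real psi) ^ (d * card S) = 1"
    using psi by (simp add: power_divide)
  finally have "measure_pmf.prob p ?U = 1" .
  then have "measure_pmf.prob p (UNIV - ?U) = 0"
    using measure_pmf.prob_compl[of ?U p] by simp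
  moreover have "{w. \<exists>(i, a)\<in>S. \<exists>j<d. psi \<le> w i a j} \<subseteq> UNIV - ?U"
  proof (rule subsetI, rule ccontr)
    fix w assume "w \<in> {w. \<exists>(i, a)\<in>S. \<exists>j<d. psi \<le> w i a j}" "w \<notin> UNIV - ?U"
    then obtain i a j g where *: "(i, a) \<in> S" "j < d" "psi \<le> w i a j" "g \<in> ?F" "w \<in> agree S g"
      by blast
    have "w i a j = g ((i, a), j)" using agreeD[OF *(5,1,2)] .
    moreover have "g ((i, a), j) < psi" using *(1,2) PiE_mem[OF *(4), of "((i, a), j)"] by simp
    ultimately show False using *(3) by simp
  qed
  then have "measure_pmf.prob p {w. \<exists>(i, a)\<in>S. \<exists>j<d. psi \<le> w i a j}
      \<le> measure_pmf.prob p (UNIV - ?U)"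
    by (rule measure_pmf.finite_measure_mono) simp
  ultimately show ?thesis
    using measure_nonneg[of p "{w. \<exists>(i, a)\<in>S. \<exists>j<d. psi \<le> w i a j}"] by linarith
qed

text \<open>Up to the null event of out-of-range entries, the event is covered by one
  \<open>agree\<close> event per solution, each of probability
  \<open>(1 / psi) ^ (d * card S)\<close>; \<open>card_solutions_le\<close> bounds the number of
  solutions.\<close>

lemma prob_zero_relations:
  assumes G: "finite G" "fst ` G \<subseteq> {..<d}" "triangular G" and thin: "thin (\<Union> (snd ` G))"
  shows "measure_pmf.prob p {w. zero_relations w G} \<le> (1 / real psi) ^ card G"
proof -
  define S where "S = \<Union> (snd ` G)"
  let ?F = "(S \<times> {..<d}) \<rightarrow>\<^sub>E {..<psi}"
  define Sol where "Sol = {g \<in> ?F. \<forall>(j, v)\<in>G. XorF.F (\<lambda>\<alpha>. g (\<alpha>, j)) v = 0}"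
  let ?N = "{w. \<exists>(i, a)\<in>S. \<exists>j<d. psi \<le> w i a j}"
  have finS: "finite S" using thin_finite[OF thin] by (simp add: S_def)
  have "finite ?F" using finS by (intro finite_PiE) auto
  then have finSol: "finite Sol" by (simp add: Sol_def)
  have "{w. zero_relations w G} \<subseteq> (\<Union>g\<in>Sol. agree S g) \<union> ?N"
  proof
    fix w assume "w \<in> {w. zero_relations w G}"
    then have w: "xor_sum w j v = 0" if "(j, v) \<in> G" for j v
      using that by (auto simp: zero_relations_def)
    define g where "g = restrict (\<lambda>(\<alpha>, j). w (fst \<alpha>) (snd \<alpha>) j) (S \<times> {..<d})"
    show "w \<in> (\<Union>g\<in>Sol. agree S g) \<union> ?N"
    proof (cases "w \<in> ?N")
      case False
      have "w (fst \<alpha>) (snd \<alpha>) j < psi" if "\<alpha> \<in> S" "j < d" for \<alpha> j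
      proof (rule ccontr)
        assume "\<not> w (fst \<alpha>) (snd \<alpha>) j < psi"
        then have "psi \<le> w (fst \<alpha>) (snd \<alpha>) j" by simp
        then have "\<exists>z\<in>S. \<exists>j<d. psi \<le> w (fst z) (snd z) j" using that by blast
        then show False using False by (simp add: case_prod_beta)
      qed
      then have "g \<in> ?F" unfolding g_def restrict_PiE_iff by (simp add: case_prod_beta mem_Times_iff)
      moreover have "XorF.F (\<lambda>\<alpha>. g (\<alpha>, j)) v = 0" if jv: "(j, v) \<in> G" for j v
      proof -
        have j: "j < d" using G(2) jv by (metis fst_conv image_subset_iff lessThan_iff)
        have v: "v \<subseteq> S" using jv unfolding S_def by (metis Sup_upper image_eqI snd_conv)
        have eq: "g (\<alpha>, j) = (\<lambda>(i, a). w i a j) \<alpha>" if "\<alpha> \<in> v" for \<alpha>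
          using subsetD[OF v that] j by (simp add: g_def case_prod_beta)
        have "XorF.F (\<lambda>\<alpha>. g (\<alpha>, j)) v = xor_sum w j v"
          unfolding xor_sum_def by (rule XorF.cong[OF refl]) (rule eq)
        then show ?thesis using w[OF jv] by metis
      qed
      ultimately have "g \<in> Sol" unfolding Sol_def by blast
      moreover have "w \<in> agree S g" unfolding agree_def by (simp add: g_def case_prod_beta)
      ultimately show ?thesis by blast
    qed simp
  qed
  then have "measure_pmf.prob p {w. zero_relations w G}
      \<le> measure_pmf.prob p ((\<Union>g\<in>Sol. agree S g) \<union> ?N)"
    by (rule measure_pmf.finite_measure_mono) simp
  also have "\<dots> \<le> measure_pmf.prob p (\<Union>g\<in>Sol. agree S g) + measure_pmf.prob p ?N"
    by (rule measure_Un_le) simp_all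
  also have "measure_pmf.prob p ?N = 0"
    by (rule prob_out_of_range) (simp add: S_def thin)
  also have "measure_pmf.prob p (\<Union>g\<in>Sol. agree S g) \<le> (\<Sum>g\<in>Sol. measure_pmf.prob p (agree S g))"
    using finSol by (intro measure_pmf.finite_measure_subadditive_finite) simp_all
  also have "\<dots> = real (card Sol) * (1 / real psi) ^ (d * card S)"
    using prob_agree thin by (simp add: Sol_def S_def)
  also have "\<dots> \<le> (1 / real psi) ^ card G"
  proof -
    have "card Sol * psi ^ card G \<le> psi ^ (d * card S)"
      using card_solutions_le[of G d psi] G finS by (simp add: Sol_def S_def)
    then have "real (card Sol * psi ^ card G) \<le> real (psi ^ (d * card S))"
      by (rule of_nat_mono)
    moreover have "x / b \<le> 1 / a" if "x * a \<le> b" "0 < a" "0 < b" for x a b :: real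
      using that by (simp add: divide_simps)
    ultimately show ?thesis using psi by (simp add: power_one_over)
  qed
  finally show ?thesis by simp
qed

text \<open>\<open>chars\<close> itself need not be thin, so the null events of its singletons are
  united; a singleton is thin because \<open>0 < k\<close>.\<close>

lemma prob_range: "measure_pmf.prob p {w. \<exists>(i, a)\<in>chars. \<exists>j<d. psi \<le> w i a j} = 0"
proof -
  have "{w. \<exists>(i, a)\<in>chars. \<exists>j<d. psi \<le> w i a j}
      = (\<Union>z\<in>chars. {w. \<exists>(i, a)\<in>{z}. \<exists>j<d. psi \<le> w i a j})" by blast
  then have "measure_pmf.prob p {w. \<exists>(i, a)\<in>chars. \<exists>j<d. psi \<le> w i a j}
      \<le> (\<Sum>z\<in>chars. measure_pmf.prob p {w. \<exists>(i, a)\<in>{z}. \<exists>j<d. psi \<le> w i a j})"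
    using finite_chars
    by (simp only:) (intro measure_pmf.finite_measure_subadditive_finite; simp)
  also have "\<dots> = (\<Sum>z\<in>chars. 0)"
  proof (rule sum.cong)
    fix z assume z: "z \<in> chars"
    have "card (fiber i {z}) \<le> k" for i
      using k by (cases z) (auto simp: fiber_def card_le_Suc0_iff_eq[THEN iffD2] intro: order_trans[of _ "Suc 0"])
    then have "thin {z}" using z by (simp add: thin_def)
    then show "measure_pmf.prob p {w. \<exists>(i, a)\<in>{z}. \<exists>j<d. psi \<le> w i a j} = 0"
      by (rule prob_out_of_range)
  qed simp
  finally show ?thesis by (simp add: measure_le_0_iff)
qed

lemma prob_exists_relations:
  assumes "finite \<G>"
    and "\<And>G. G \<in> \<G> \<Longrightarrow> finite G \<and> fst ` G \<subseteq> {..<d} \<and> thin (\<Union> (snd ` G)) \<and> card G = m"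
  shows "measure_pmf.prob p {w. \<exists>G\<in>\<G>. triangular G \<and> zero_relations w G}
           \<le> real (card \<G>) * (1 / real psi) ^ m"
proof -
  have "{w. \<exists>G\<in>\<G>. triangular G \<and> zero_relations w G}
      = (\<Union>G\<in>{G\<in>\<G>. triangular G}. {w. zero_relations w G})" by auto
  then have "measure_pmf.prob p {w. \<exists>G\<in>\<G>. triangular G \<and> zero_relations w G}
      \<le> (\<Sum>G\<in>{G\<in>\<G>. triangular G}. measure_pmf.prob p {w. zero_relations w G})"
    using assms(1) by (simp only:) (intro measure_pmf.finite_measure_subadditive_finite; simp)
  also have "\<dots> \<le> (\<Sum>G\<in>{G\<in>\<G>. triangular G}. (1 / real psi) ^ m)"
  proof (rule sum_mono)
    fix G assume "G \<in> {G\<in>\<G>. triangular G}"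
    then show "measure_pmf.prob p {w. zero_relations w G} \<le> (1 / real psi) ^ m"
      using prob_zero_relations[of G] assms(2)[of G] by simp
  qed
  also have "\<dots> \<le> real (card \<G>) * (1 / real psi) ^ m"
    using card_mono[OF assms(1), of "{G\<in>\<G>. triangular G}"]
    by (simp add: mult_right_mono)
  finally show ?thesis .
qed

end

section \<open>Relations forced on a key set without unique output characters\<close>

lemma doubleton_eq_of_mem: "u \<in> {p, q} \<Longrightarrow> v \<in> {p, q} \<Longrightarrow> u \<noteq> v \<Longrightarrow> {u, v} = {p, q}"
  by auto

lemma triangular_subset: "triangular G \<Longrightarrow> G' \<subseteq> G \<Longrightarrow> triangular G'"
  unfolding triangular_def by (meson inj_on_subset subsetD)

lemma zero_relations_subset: "zero_relations w G \<Longrightarrow> G' \<subseteq> G \<Longrightarrow> zero_relations w G'"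
  unfolding zero_relations_def by blast

text \<open>Induction on the prefix: its partial sum is nonpositive, so passing to the next, smaller
  weight can only increase the right-hand side.\<close>

lemma abel_prefix:
  fixes e :: "nat \<Rightarrow> real" and D :: "nat \<Rightarrow> nat"
  assumes mono: "\<And>t. Suc t < r \<Longrightarrow> D (Suc t) \<le> D t"
    and nonpos: "\<And>k. k \<le> r \<Longrightarrow> (\<Sum>t<k. e t) \<le> 0" and r: "0 < r"
  shows "(\<Sum>t<r. real (D t) * e t) \<le> real (D (r - 1)) * (\<Sum>t<r. e t)"
proof -
  have "(\<Sum>t<Suc k. real (D t) * e t) \<le> real (D k) * (\<Sum>t<Suc k. e t)" if "Suc k \<le> r" for k
    using that
  proof (induction k)
    case 0 then show ?case by simp
  next
    case (Suc k)
    have "real (D k) * (\<Sum>t<Suc k. e t) \<le> real (D (Suc k)) * (\<Sum>t<Suc k. e t)"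
      using mono[of k] nonpos[of "Suc k"] Suc.prems by (intro mult_right_mono_neg) auto
    then show ?case using Suc by (simp add: algebra_simps)
  qed
  from this[of "r - 1"] show ?thesis using r by simp
qed

lemma sorted_enumeration:
  fixes f :: "'a \<Rightarrow> nat"
  assumes "finite A"
  obtains ys where "distinct ys" "set ys = A" "\<And>t. Suc t < length ys \<Longrightarrow> f (ys ! Suc t) \<le> f (ys ! t)"
proof -
  obtain xs where xs: "distinct xs" "set xs = A" using finite_distinct_list[OF assms] by blast
  let ?ys = "rev (sort_key f xs)"
  have "sorted (map f (sort_key f xs))" by simp
  then have "f (?ys ! Suc t) \<le> f (?ys ! t)" if "Suc t < length ?ys" for t
    using that sorted_nth_mono[of "map f (sort_key f xs)" "length xs - Suc (Suc t)" "length xs - Suc t"]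
    by (simp add: rev_nth)
  then show thesis using xs by (intro that[of ?ys]) auto
qed

definition char_diff :: "(nat \<times> nat) set \<Rightarrow> (nat \<times> nat) set \<Rightarrow> (nat \<times> nat) set" where
  "char_diff A B = sym_diff A B"

definition key_relations :: "(nat \<times> nat) set set \<Rightarrow> (nat \<times> nat) set set" where
  "key_relations K = {char_diff x y |x y. x \<in> K \<and> y \<in> K \<and> x \<noteq> y}"

text \<open>Two keys agree or differ in a position, so their difference has zero or two characters
  there. The empty set is left out because distinct keys have a nonempty difference.\<close>

definition position_even :: "nat \<Rightarrow> (nat \<times> nat) set \<Rightarrow> (nat \<times> nat) set set" where
  "position_even c S = {v. v \<subseteq> S \<and> v \<noteq> {} \<and> (\<forall>i<c. card (fiber i v) \<in> {0, 2})}"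

text \<open>Every restriction of a key to \<open>S\<close> has this form.\<close>

definition partial_keys :: "nat \<Rightarrow> (nat \<times> nat) set \<Rightarrow> (nat \<times> nat) set set" where
  "partial_keys c S = {v. v \<subseteq> S \<and> (\<forall>i<c. card (fiber i v) \<in> {0, 1})}"

lemma fiber_pos_chars: "i < c \<Longrightarrow> fiber i (pos_chars c x) = {x i}"
  by (auto simp: fiber_def pos_chars_def)

lemma fiber_char_diff: "fiber i (char_diff A B) = sym_diff (fiber i A) (fiber i B)"
  by (auto simp: fiber_def char_diff_def)

lemma card_fiber_relation:
  assumes "i < c"
  shows "fiber i (char_diff (pos_chars c x) (pos_chars c y)) = (if x i = y i then {} else {x i, y i})"
  unfolding fiber_char_diff fiber_pos_chars[OF assms] by auto

text \<open>\<open>partner\<close> expresses the absence of a unique output position character: in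
  every output each key shares its character with another key.\<close>

locale non_unique =
  fixes c d n :: nat and X :: "(nat \<Rightarrow> nat) set" and w :: "nat \<Rightarrow> nat \<Rightarrow> nat \<Rightarrow> nat" and phi :: nat
  assumes c: "2 \<le> c" and d: "0 < d" and keys: "X \<subseteq> keys phi c" and ne: "X \<noteq> {}"
    and fin: "finite X" and n: "card X \<le> n"
    and partner: "\<And>j x. j < d \<Longrightarrow> x \<in> X \<Longrightarrow> \<exists>y\<in>X. y \<noteq> x \<and> simple_tab w c y j = simple_tab w c x j"
begin

abbreviation "P \<equiv> pos_chars c"
definition "A = (\<Union>x\<in>X. P x)"
definition "deg \<alpha> = card {x\<in>X. \<alpha> \<in> P x}"

lemma P_inj: "x \<in> X \<Longrightarrow> y \<in> X \<Longrightarrow> P x = P y \<Longrightarrow> x = y"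
proof -
  assume x: "x \<in> X" and y: "y \<in> X" and eq: "P x = P y"
  have "x i = y i" if "i < c" for i
    using fiber_pos_chars[OF that, of x] fiber_pos_chars[OF that, of y] eq by simp
  then show "x = y"
    using x y keys unfolding keys_def
    by (intro PiE_ext[of x "{..<c}" "\<lambda>_. {..<phi}" y]) auto
qed

lemma finA: "finite A" using fin by (auto simp: A_def pos_chars_def)

lemma A_sub: "A \<subseteq> {..<c} \<times> {..<phi}"
proof
  fix \<alpha> assume "\<alpha> \<in> A"
  then obtain x i where "x \<in> X" "i < c" "\<alpha> = (i, x i)" by (auto simp: A_def pos_chars_def)
  moreover have "x i < phi" using keys \<open>x \<in> X\<close> \<open>i < c\<close> by (auto simp: keys_def PiE_def Pi_def)
  ultimately show "\<alpha> \<in> {..<c} \<times> {..<phi}" by simp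
qed

lemma fiber_A: "i < c \<Longrightarrow> card (fiber i A) \<le> n"
proof -
  assume "i < c"
  then have "fiber i A = (\<lambda>x. x i) ` X" by (auto simp: fiber_def A_def pos_chars_def)
  then show ?thesis using card_image_le[OF fin, of "\<lambda>x. x i"] n by simp
qed

lemma fst_A: "fst ` A = {..<c}"
  using ne by (force simp: A_def pos_chars_def)

text \<open>Double counting: a key has exactly one character in each position, so it contributes
  every price once.\<close>

lemma sum_deg: "(\<Sum>\<alpha>\<in>A. real (deg \<alpha>) * y (fst \<alpha>)) = real (card X) * (\<Sum>i<c. y i)"
proof -
  have "real (deg \<alpha>) * y (fst \<alpha>) = (\<Sum>x\<in>X. if \<alpha> \<in> P x then y (fst \<alpha>) else 0)" for \<alpha>
    using fin by (simp add: deg_def sum.If_cases Int_def)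
  then have "(\<Sum>\<alpha>\<in>A. real (deg \<alpha>) * y (fst \<alpha>)) = (\<Sum>\<alpha>\<in>A. \<Sum>x\<in>X. if \<alpha> \<in> P x then y (fst \<alpha>) else 0)"
    by simp
  also have "\<dots> = (\<Sum>x\<in>X. \<Sum>\<alpha>\<in>A. if \<alpha> \<in> P x then y (fst \<alpha>) else 0)" by (rule sum.swap)
  also have "\<dots> = (\<Sum>x\<in>X. \<Sum>i<c. y i)"
  proof (rule sum.cong)
    fix x assume "x \<in> X"
    then have "A \<inter> {\<alpha>. \<alpha> \<in> P x} = (\<lambda>i. (i, x i)) ` {..<c}" by (auto simp: A_def pos_chars_def)
    moreover have "inj_on (\<lambda>i. (i, x i)) {..<c}" by (auto simp: inj_on_def)
    ultimately show "(\<Sum>\<alpha>\<in>A. if \<alpha> \<in> P x then y (fst \<alpha>) else 0) = (\<Sum>i<c. y i)"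
      using finA by (simp add: sum.If_cases sum.reindex)
  qed simp
  finally show ?thesis by simp
qed

definition rels :: "nat \<Rightarrow> (nat \<times> nat) set set" where
  "rels j = {char_diff (P x) (P y) |x y. x \<in> X \<and> y \<in> X \<and> x \<noteq> y \<and> simple_tab w c x j = simple_tab w c y j}"

lemma rels_sub: "v \<in> rels j \<Longrightarrow> v \<subseteq> A" by (auto simp: rels_def A_def char_diff_def)

lemma rels_zero: "v \<in> rels j \<Longrightarrow> xor_sum w j v = 0"
  unfolding rels_def by (auto simp: simple_tab_collision_iff char_diff_def)

text \<open>Distinct keys differ in some position. That a relation has two characters in one
  position is what later helps to exclude prefixes with fewer than three elements.\<close>

lemma rels_pair:
  assumes "v \<in> rels j"
  obtains i a b where "i < c" "a \<noteq> b" "(i, a) \<in> v" "(i, b) \<in> v"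
proof -
  obtain x y where xy: "x \<in> X" "y \<in> X" "x \<noteq> y" "v = char_diff (P x) (P y)"
    using assms unfolding rels_def by blast
  have "\<exists>i<c. x i \<noteq> y i"
  proof (rule ccontr)
    assume "\<not> (\<exists>i<c. x i \<noteq> y i)"
    then have "P x = P y" unfolding pos_chars_def by (intro image_cong) simp_all
    then show False using P_inj xy by blast
  qed
  then obtain i where i: "i < c" "x i \<noteq> y i" by blast
  then have "x i \<in> fiber i v" "y i \<in> fiber i v"
    using xy(4) i(2) card_fiber_relation[OF i(1), of x y] by simp_all
  then show thesis using that[OF i] by (simp add: fiber_def)
qed

lemma rels_even: "v \<in> rels j \<Longrightarrow> v \<subseteq> S \<Longrightarrow> v \<in> position_even c S"
proof -
  assume v: "v \<in> rels j" "v \<subseteq> S"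
  then have "card (fiber i v) \<in> {0, 2}" if "i < c" for i
  proof -
    obtain x y where "v = char_diff (P x) (P y)" using v(1) unfolding rels_def by blast
    then show ?thesis using card_fiber_relation[OF that, of x y] by simp
  qed
  moreover have "v \<noteq> {}" using v(1) by (metis rels_pair empty_iff)
  ultimately show ?thesis using v by (simp add: position_even_def)
qed

lemma rels_key_relations: "v \<in> rels j \<Longrightarrow> v \<subseteq> S \<Longrightarrow> v \<in> key_relations ((\<lambda>x. P x \<inter> S) ` X)"
proof -
  assume v: "v \<in> rels j" "v \<subseteq> S"
  then obtain x y where xy: "x \<in> X" "y \<in> X" "v = char_diff (P x) (P y)"
    unfolding rels_def by blast
  \<comment> \<open>All characters outside \<open>S\<close> are shared by the two keys, so
    restricting both to \<open>S\<close> leaves the difference unchanged.\<close>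
  have "v = char_diff (P x \<inter> S) (P y \<inter> S)" using xy(3) v(2) unfolding char_diff_def by blast
  moreover have "P x \<inter> S \<noteq> P y \<inter> S"
  proof
    assume "P x \<inter> S = P y \<inter> S"
    then have "v = {}" using calculation by (simp add: char_diff_def)
    then show False using v(1) rels_pair by blast
  qed
  ultimately show ?thesis using xy unfolding key_relations_def by blast
qed

lemma partial_keys_image: "(\<lambda>x. P x \<inter> S) ` X \<subseteq> partial_keys c S"
proof clarify
  fix x
  have "card (fiber i (P x \<inter> S)) \<in> {0, 1}" if "i < c" for i
  proof -
    have "fiber i (P x \<inter> S) = (if (i, x i) \<in> S then {x i} else {})"
      using that by (auto simp: fiber_def pos_chars_def)
    then show ?thesis by simp
  qed
  then show "P x \<inter> S \<in> partial_keys c S" by (simp add: partial_keys_def)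
qed

text \<open>Two colliding keys that avoid all pivots would have a relation without a pivot, so every
  collision class has at most one key avoiding the pivots.\<close>

lemma hit_keys:
  assumes j: "j < d" and Q: "\<And>v. v \<in> rels j \<Longrightarrow> v \<inter> Q \<noteq> {}" and finQ: "finite Q"
  shows "card X \<le> 2 * (\<Sum>\<alpha>\<in>Q. deg \<alpha>)"
proof -
  let ?H = "\<lambda>x. simple_tab w c x j"
  define U where "U = {x\<in>X. P x \<inter> Q = {}}"
  have "inj_on ?H U"
  proof (rule inj_onI, rule ccontr)
    fix x y assume xy: "x \<in> U" "y \<in> U" "?H x = ?H y" "x \<noteq> y"
    then have "char_diff (P x) (P y) \<in> rels j" unfolding rels_def U_def by blast
    then have "char_diff (P x) (P y) \<inter> Q \<noteq> {}" by (rule Q)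
    then show False using xy(1,2) unfolding U_def char_diff_def by blast
  qed
  then have "card U = card (?H ` U)" by (simp add: card_image)
  also have "\<dots> \<le> card (?H ` X)" using fin by (intro card_mono) (auto simp: U_def)
  finally have U: "card U \<le> card (?H ` X)" .
  \<comment> \<open>By \<open>partner\<close> no class is a singleton, so there are at most
    \<open>card X / 2\<close> classes and at most as many keys that avoid \<open>Q\<close>.\<close>
  have "2 \<le> card {x\<in>X. ?H x = z}" if "z \<in> ?H ` X" for z
  proof -
    obtain x where x: "x \<in> X" "z = ?H x" using \<open>z \<in> ?H ` X\<close> by blast
    obtain y where y: "y \<in> X" "y \<noteq> x" "?H y = ?H x" using partner[OF j x(1)] by blast
    have "card {x, y} \<le> card {x\<in>X. ?H x = z}" using x y fin by (intro card_mono) auto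
    then show ?thesis using y(2) by simp
  qed
  then have "(\<Sum>z\<in>?H ` X. 2) \<le> (\<Sum>z\<in>?H ` X. card {x\<in>X. ?H x = z})" by (intro sum_mono)
  also have "\<dots> = card X" using sum.image_gen[OF fin, of "\<lambda>_. 1::nat" ?H] by simp
  finally have H: "2 * card (?H ` X) \<le> card X" by simp
  have "X - U \<subseteq> (\<Union>\<alpha>\<in>Q. {x\<in>X. \<alpha> \<in> P x})" unfolding U_def by blast
  then have "card (X - U) \<le> card (\<Union>\<alpha>\<in>Q. {x\<in>X. \<alpha> \<in> P x})"
    using fin finQ by (intro card_mono) auto
  also have "\<dots> \<le> (\<Sum>\<alpha>\<in>Q. deg \<alpha>)" unfolding deg_def using finQ by (rule card_UN_le)
  finally have "card (X - U) \<le> (\<Sum>\<alpha>\<in>Q. deg \<alpha>)" .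
  moreover have "card (X - U) = card X - card U"
    using fin by (intro card_Diff_subset) (auto simp: U_def intro: finite_subset)
  ultimately show ?thesis using U H by linarith
qed

end

section \<open>Leaders and prefixes in the order by degree\<close>

locale enumerated = non_unique +
  fixes ys :: "(nat \<times> nat) list"
  assumes dist: "distinct ys" and set_ys: "set ys = A"
    and mono: "\<And>t. Suc t < length ys \<Longrightarrow> deg (ys ! Suc t) \<le> deg (ys ! t)"
begin

abbreviation "r \<equiv> length ys"
definition "rk \<alpha> = the_inv_into {..<r} ((!) ys) \<alpha>"
text \<open>The leader is the last character in the order, hence one of smallest degree. A relation
  whose leader has index \<open>t\<close> therefore lies in the prefix of length
  \<open>t + 1\<close>.\<close>

definition "mx v = ys ! Max (rk ` v)"
definition "S k = set (take k ys)"
text \<open>The leaders of all collision relations are taken, not those of a basis; they still meet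
  every relation, since a relation contains its leader.\<close>

definition "Piv k = {(j, t). j < d \<and> t < k \<and> (\<exists>v\<in>rels j. mx v = ys ! t)}"
definition "vv j t = (SOME v. v \<in> rels j \<and> mx v = ys ! t)"
definition "G k = (\<lambda>(j, t). (j, vv j t)) ` Piv k"
definition "T k = card (Piv k)"

lemma inj_nth: "inj_on ((!) ys) {..<r}" using dist by (simp add: inj_on_nth)

lemma rk_nth: "t < r \<Longrightarrow> rk (ys ! t) = t"
  unfolding rk_def by (rule the_inv_into_f_f[OF inj_nth]) simp

lemma rk_A: "\<alpha> \<in> A \<Longrightarrow> rk \<alpha> < r \<and> ys ! rk \<alpha> = \<alpha>"
  using rk_nth by (metis in_set_conv_nth set_ys)

lemma mx:
  assumes "v \<in> rels j"
  shows "mx v \<in> v" "\<And>\<beta>. \<beta> \<in> v \<Longrightarrow> \<beta> \<noteq> mx v \<Longrightarrow> rk \<beta> < rk (mx v)"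
proof -
  have sub: "v \<subseteq> A" using assms by (rule rels_sub)
  have ne: "v \<noteq> {}" using assms by (metis rels_pair empty_iff)
  have fin: "finite v" using sub finA by (rule finite_subset)
  have "Max (rk ` v) \<in> rk ` v" using fin ne by simp
  then obtain \<alpha> where \<alpha>: "\<alpha> \<in> v" "rk \<alpha> = Max (rk ` v)" by (metis imageE)
  have eq: "mx v = \<alpha>" using rk_A[of \<alpha>] sub \<alpha> by (auto simp: mx_def)
  show "mx v \<in> v" using eq \<alpha> by simp
  fix \<beta> assume \<beta>: "\<beta> \<in> v" "\<beta> \<noteq> mx v"
  have "rk \<beta> \<le> rk \<alpha>" using \<beta>(1) fin \<alpha>(2) by simp
  moreover have "rk \<beta> \<noteq> rk \<alpha>" using rk_A[of \<alpha>] rk_A[of \<beta>] sub \<alpha>(1) \<beta> eq by (metis subsetD)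
  ultimately show "rk \<beta> < rk (mx v)" using eq by simp
qed

lemma vv:
  assumes "(j, t) \<in> Piv k"
  shows "vv j t \<in> rels j" "mx (vv j t) = ys ! t"
proof -
  have "\<exists>v. v \<in> rels j \<and> mx v = ys ! t" using assms by (auto simp: Piv_def)
  then have "vv j t \<in> rels j \<and> mx (vv j t) = ys ! t" unfolding vv_def by (rule someI_ex)
  then show "vv j t \<in> rels j" "mx (vv j t) = ys ! t" by auto
qed

lemma finite_Piv: "finite (Piv k)"
  by (rule finite_subset[of _ "{..<d} \<times> {..<k}"]) (auto simp: Piv_def)

lemma vv_sub:
  assumes "(j, t) \<in> Piv k" "k \<le> r"
  shows "vv j t \<subseteq> S (Suc t)"
proof
  fix \<beta> assume \<beta>: "\<beta> \<in> vv j t"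
  have t: "t < r" using assms by (auto simp: Piv_def)
  have "rk \<beta> \<le> t"
    using mx(2)[OF vv(1)[OF assms(1)] \<beta>] vv(2)[OF assms(1)] rk_nth[OF t] by fastforce
  moreover have "\<beta> \<in> A" using rels_sub[OF vv(1)[OF assms(1)]] \<beta> by blast
  then have "\<beta> = ys ! rk \<beta>" "rk \<beta> < r" using rk_A[of \<beta>] by simp_all
  ultimately show "\<beta> \<in> S (Suc t)"
    unfolding S_def set_conv_nth by (auto intro!: exI[of _ "rk \<beta>"])
qed

lemma S_mono: "k \<le> l \<Longrightarrow> S k \<subseteq> S l" unfolding S_def by (rule set_take_subset_set_take)

lemma inj_vv: "k \<le> r \<Longrightarrow> inj_on (\<lambda>(j, t). (j, vv j t)) (Piv k)"
proof (rule inj_onI)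
  fix p q assume k: "k \<le> r" and pq: "p \<in> Piv k" "q \<in> Piv k"
    and eq: "(case p of (j, t) \<Rightarrow> (j, vv j t)) = (case q of (j, t) \<Rightarrow> (j, vv j t))"
  obtain j t j' t' where p: "p = (j, t)" and q: "q = (j', t')" by (cases p, cases q) blast
  have "j' = j" "vv j t' = vv j t" using eq p q by auto
  then have "ys ! t = ys ! t'" using vv(2)[of j t k] vv(2)[of j t' k] pq p q by simp
  moreover have "t < r" "t' < r" using k pq p q by (auto simp: Piv_def)
  ultimately show "p = q" using dist p q \<open>j' = j\<close> by (simp add: nth_eq_iff_index_eq)
qed

lemma card_G: "k \<le> r \<Longrightarrow> card (G k) = T k"
  unfolding G_def T_def by (rule card_image[OF inj_vv])

lemma G_elem: "(j, v) \<in> G k \<Longrightarrow> k \<le> r \<Longrightarrow> j < d \<and> v \<in> rels j \<and> v \<subseteq> S k"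
proof -
  assume "(j, v) \<in> G k" and k: "k \<le> r"
  then obtain t where t: "(j, t) \<in> Piv k" "v = vv j t" by (auto simp: G_def)
  then have "j < d" "Suc t \<le> k" by (auto simp: Piv_def)
  then show ?thesis using vv(1)[OF t(1)] vv_sub[OF t(1) k] S_mono[of "Suc t" k] t(2) by blast
qed

lemma zero_G: "k \<le> r \<Longrightarrow> zero_relations w (G k)"
  unfolding zero_relations_def using G_elem rels_zero by blast

lemma triangular_G: "k \<le> r \<Longrightarrow> triangular (G k)"
  unfolding triangular_def
proof (intro exI[of _ rk] exI[of _ "\<lambda>_. mx"] conjI)
  assume k: "k \<le> r"
  show "\<forall>(j, v)\<in>G k. mx v \<in> v \<and> (\<forall>\<beta>\<in>v. \<beta> \<noteq> mx v \<longrightarrow> rk \<beta> < rk (mx v))"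
    using G_elem[OF _ k] mx by blast
  show "inj_on (\<lambda>(j, v). (j, mx v)) (G k)"
  proof (rule inj_onI)
    fix p q assume pq: "p \<in> G k" "q \<in> G k"
      and eq: "(case p of (j, v) \<Rightarrow> (j, mx v)) = (case q of (j, v) \<Rightarrow> (j, mx v))"
    obtain j t where p: "p = (j, vv j t)" "(j, t) \<in> Piv k" using pq(1) by (auto simp: G_def)
    obtain j' t' where q: "q = (j', vv j' t')" "(j', t') \<in> Piv k" using pq(2) by (auto simp: G_def)
    have "j' = j" "mx (vv j t) = mx (vv j' t')" using eq p q by auto
    then have "ys ! t = ys ! t'" using vv(2) p q by metis
    moreover have "t < r" "t' < r" using p q k by (auto simp: Piv_def)
    ultimately show "p = q" using dist p q \<open>j' = j\<close> by (simp add: nth_eq_iff_index_eq)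
  qed
qed

lemma T_eq_sum: "T k = (\<Sum>t<k. card {j. j < d \<and> (\<exists>v\<in>rels j. mx v = ys ! t)})"
proof -
  have "T k = card (Sigma {..<k} (\<lambda>t. {j. j < d \<and> (\<exists>v\<in>rels j. mx v = ys ! t)}))"
    unfolding T_def Piv_def
    by (rule bij_betw_same_card[of prod.swap]) (auto simp: bij_betw_def inj_on_def image_iff)
  also have "\<dots> = (\<Sum>t<k. card {j. j < d \<and> (\<exists>v\<in>rels j. mx v = ys ! t)})"
    by (rule card_SigmaI) auto
  finally show ?thesis .
qed

text \<open>\<open>hit_keys\<close> is applied to the leaders of each output; the bounds are added
  over the outputs and regrouped by leader.\<close>

lemma pivot_degree_sum:
  "d * card X \<le> 2 * (\<Sum>t<r. deg (ys ! t) * card {j. j < d \<and> (\<exists>v\<in>rels j. mx v = ys ! t)})"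
proof -
  let ?I = "\<lambda>j t. \<exists>v\<in>rels j. mx v = ys ! t"
  have each: "card X \<le> 2 * (\<Sum>t<r. if ?I j t then deg (ys ! t) else 0)" if j: "j < d" for j
  proof -
    let ?Q = "(!) ys ` {t. t < r \<and> ?I j t}"
    have "v \<inter> ?Q \<noteq> {}" if v: "v \<in> rels j" for v
    proof -
      have "mx v \<in> v" using mx(1)[OF v] .
      moreover have "mx v \<in> A" using rels_sub[OF v] calculation by blast
      then have "mx v \<in> ?Q" using rk_A[of "mx v"] v by (intro image_eqI[of _ _ "rk (mx v)"]) auto
      ultimately show ?thesis by blast
    qed
    then have "card X \<le> 2 * (\<Sum>\<alpha>\<in>?Q. deg \<alpha>)" by (intro hit_keys[OF j]) auto
    also have "(\<Sum>\<alpha>\<in>?Q. deg \<alpha>) = (\<Sum>t\<in>{t. t < r \<and> ?I j t}. deg (ys ! t))"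
      by (rule sum.reindex_cong[OF inj_on_subset[OF inj_nth]]) auto
    also have "\<dots> = (\<Sum>t<r. if ?I j t then deg (ys ! t) else 0)"
      by (rule sum.mono_neutral_cong_left) auto
    finally show ?thesis .
  qed
  have "d * card X = (\<Sum>j<d. card X)" by simp
  also have "\<dots> \<le> (\<Sum>j<d. 2 * (\<Sum>t<r. if ?I j t then deg (ys ! t) else 0))"
    using each by (intro sum_mono) simp
  also have "\<dots> = 2 * (\<Sum>t<r. \<Sum>j<d. if ?I j t then deg (ys ! t) else 0)"
    by (subst sum.swap) (simp add: sum_distrib_left)
  also have "\<dots> = 2 * (\<Sum>t<r. deg (ys ! t) * card {j. j < d \<and> ?I j t})"
    by (simp add: sum.If_cases Int_def mult.commute)
  finally show ?thesis .
qed

lemma r_pos: "0 < r"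
proof -
  have "0 \<in> fst ` A" using fst_A c by simp
  then have "set ys \<noteq> {}" unfolding set_ys by auto
  then show ?thesis by simp
qed

text \<open>If no prefix qualified, the sums of \<open>e\<close> (relations minus prices) would be
  nonpositive on all prefixes and negative on the full one. By \<open>abel_prefix\<close> the
  degree-weighted sum would be negative, against \<open>pivot_degree_sum\<close> and
  \<open>sum_deg\<close>. Equality is allowed only for the full prefix, where all positions
  occur.\<close>

lemma exists_prefix:
  fixes y :: "nat \<Rightarrow> real"
  assumes y: "2 * (\<Sum>i<c. y i) \<le> real d"
  obtains k where "1 \<le> k" "k \<le> r" "(\<Sum>t<k. y (fst (ys ! t))) < real (T k)
      \<or> k = r \<and> (\<Sum>t<k. y (fst (ys ! t))) \<le> real (T k)"
proof -
  define \<tau> where "\<tau> t = card {j. j < d \<and> (\<exists>v\<in>rels j. mx v = ys ! t)}" for t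
  define e where "e t = real (\<tau> t) - y (fst (ys ! t))" for t
  have E: "(\<Sum>t<k. e t) = real (T k) - (\<Sum>t<k. y (fst (ys ! t)))" for k
    by (simp add: e_def T_eq_sum \<tau>_def sum_subtractf)
  have "\<exists>k. 1 \<le> k \<and> k \<le> r \<and> (0 < (\<Sum>t<k. e t) \<or> k = r \<and> 0 \<le> (\<Sum>t<k. e t))"
  proof (rule ccontr)
    assume neg: "\<not> ?thesis"
    have "(\<Sum>t<k. e t) \<le> 0" if "k \<le> r" for k
      using neg that by (cases "k = 0") (force simp: not_less)+
    then have "(\<Sum>t<r. real (deg (ys ! t)) * e t) \<le> real (deg (ys ! (r - 1))) * (\<Sum>t<r. e t)"
      by (intro abel_prefix[of r "\<lambda>t. deg (ys ! t)"] mono r_pos) auto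
    also have "\<dots> < 0"
    proof (rule mult_pos_neg)
      show "(\<Sum>t<r. e t) < 0" using neg r_pos by (auto simp: not_le Suc_le_eq)
      have "ys ! (r - 1) \<in> A" using r_pos set_ys by (metis diff_less nth_mem zero_less_one)
      then obtain x where "x \<in> X" "ys ! (r - 1) \<in> P x" by (auto simp: A_def)
      then show "0 < real (deg (ys ! (r - 1)))" using fin by (auto simp: deg_def card_gt_0_iff)
    qed
    finally have "(\<Sum>t<r. real (deg (ys ! t)) * e t) < 0" .
    moreover have "(\<Sum>t<r. real (deg (ys ! t)) * y (fst (ys ! t))) = (\<Sum>\<alpha>\<in>A. real (deg \<alpha>) * y (fst \<alpha>))"
    proof -
      have "A = (!) ys ` {..<r}" using set_ys by (auto simp: set_conv_nth)
      then show ?thesis using inj_nth by (simp add: sum.reindex)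
    qed
    ultimately have "(\<Sum>t<r. real (deg (ys ! t)) * real (\<tau> t)) < real (card X) * (\<Sum>i<c. y i)"
      by (simp add: e_def right_diff_distrib sum_subtractf sum_deg)
    moreover have "real d * real (card X) \<le> 2 * (\<Sum>t<r. real (deg (ys ! t)) * real (\<tau> t))"
      using of_nat_mono[OF pivot_degree_sum, where 'a = real] by (simp add: \<tau>_def)
    moreover have "real (card X) * (2 * (\<Sum>i<c. y i)) \<le> real (card X) * real d"
      using y by (intro mult_left_mono) auto
    ultimately show False by (simp add: algebra_simps)
  qed
  then show thesis using that by (auto simp: E)
qed

text \<open>A relation has two characters in one position, so it does not fit into a prefix of
  length one.\<close>

lemma T_1: "T 1 = 0"
proof -
  have "Piv 1 = {}"
  proof (rule ccontr)
    assume "Piv 1 \<noteq> {}"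
    then obtain j where j: "(j, 0) \<in> Piv 1" by (auto simp: Piv_def)
    obtain i a b where "a \<noteq> b" "(i, a) \<in> vv j 0" "(i, b) \<in> vv j 0"
      using rels_pair[OF vv(1)[OF j]] by metis
    moreover have "vv j 0 \<subseteq> {ys ! 0}"
      using vv_sub[OF j] r_pos by (simp add: S_def take_Suc_conv_app_nth)
    ultimately show False by (metis Pair_inject singletonD subsetD)
  qed
  then show ?thesis by (simp add: T_def)
qed

lemma S_2: "2 \<le> r \<Longrightarrow> S 2 = {ys ! 0, ys ! 1}"
  unfolding S_def by (cases ys; cases "tl ys") (auto simp: numeral_2_eq_2)

text \<open>The only relation supported on two characters is the pair itself, which forces both into
  one position; index 0 is no leader by \<open>T_1\<close>.\<close>

lemma T_2:
  assumes "2 \<le> r" "(j, t) \<in> Piv 2"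
  shows "t = 1" "vv j t = {ys ! 0, ys ! 1}" "fst (ys ! 0) = fst (ys ! 1)"
proof -
  have "t \<noteq> 0"
  proof
    assume "t = 0"
    then have "(j, 0) \<in> Piv 1" using assms by (auto simp: Piv_def)
    then show False using T_1 finite_Piv by (auto simp: T_def)
  qed
  then show t: "t = 1" using assms by (auto simp: Piv_def)
  have sub: "vv j t \<subseteq> {ys ! 0, ys ! 1}"
    using vv_sub[OF assms(2,1)] t S_2[OF assms(1)] by (simp add: numeral_2_eq_2)
  obtain i a b where *: "a \<noteq> b" "(i, a) \<in> vv j t" "(i, b) \<in> vv j t"
    using rels_pair[OF vv(1)[OF assms(2)]] by metis
  have "(i, a) \<in> {ys ! 0, ys ! 1}" "(i, b) \<in> {ys ! 0, ys ! 1}"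
    using subsetD[OF sub *(2)] subsetD[OF sub *(3)] .
  then have **: "{(i, a), (i, b)} = {ys ! 0, ys ! 1}"
    using *(1) doubleton_eq_of_mem[of "(i, a)" "ys ! 0" "ys ! 1" "(i, b)"] by simp
  have "{(i, a), (i, b)} \<subseteq> vv j t" using *(2,3) by simp
  then show "vv j t = {ys ! 0, ys ! 1}" using sub unfolding ** by (rule equalityI[rotated])
  show "fst (ys ! 0) = fst (ys ! 1)" using ** by (metis doubleton_eq_iff fst_conv)
qed

lemma card_S: "k \<le> r \<Longrightarrow> card (S k) = k"
  unfolding S_def using dist by (subst distinct_card) auto

lemma sum_prefix: "k \<le> r \<Longrightarrow> (\<Sum>t<k. y (fst (ys ! t))) = (\<Sum>\<alpha>\<in>S k. y (fst \<alpha>))"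
proof -
  assume k: "k \<le> r"
  have "S k = (!) ys ` {..<k}" using nth_image[OF k] by (simp add: S_def atLeast0LessThan)
  moreover have "inj_on ((!) ys) {..<k}" using inj_on_subset[OF inj_nth] k by auto
  ultimately show ?thesis by (simp add: sum.reindex)
qed

lemma S_sub: "S k \<subseteq> A" unfolding S_def using set_ys set_take_subset by fastforce

text \<open>Holds both descriptions of a relation, as an even subset of \<open>S'\<close> and as a
  difference of restricted keys, so that either count can be applied later.\<close>

definition single_system :: "(nat \<times> nat) set \<Rightarrow> (nat \<times> nat) set set \<Rightarrow> (nat \<times> (nat \<times> nat) set) set \<Rightarrow> bool" where
  "single_system S' K G' \<longleftrightarrow> S' \<subseteq> A \<and> 3 \<le> card S' \<and> K \<subseteq> partial_keys c S' \<and> finite K \<and> card K \<le> n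
     \<and> G' \<subseteq> {..<d} \<times> (position_even c S' \<inter> key_relations K)"

lemma single_system_S:
  assumes "k \<le> r" "3 \<le> k" "G' \<subseteq> G k"
  shows "single_system (S k) ((\<lambda>x. P x \<inter> S k) ` X) G'"
  unfolding single_system_def
proof (intro conjI)
  show "card ((\<lambda>x. P x \<inter> S k) ` X) \<le> n" using card_image_le[OF fin, of "\<lambda>x. P x \<inter> S k"] n by simp
  show "G' \<subseteq> {..<d} \<times> (position_even c (S k) \<inter> key_relations ((\<lambda>x. P x \<inter> S k) ` X))"
  proof
    fix z assume "z \<in> G'"
    then obtain j v where z: "z = (j, v)" "(j, v) \<in> G k" using assms(3) by (cases z) auto
    then show "z \<in> {..<d} \<times> (position_even c (S k) \<inter> key_relations ((\<lambda>x. P x \<inter> S k) ` X))"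
      using G_elem[OF z(2) assms(1)] rels_even[of v j "S k"] rels_key_relations[of v j "S k"] by simp
  qed
qed (use assms S_sub card_S partial_keys_image fin in auto)

text \<open>In the second alternative \<open>\<tau>\<close> is the number of outputs in which the
  first two characters of the order collide. Their relations are kept apart from \<open>G'\<close>
  because the union bound enumerates them separately: one pair and \<open>\<tau>\<close> outputs are
  fewer choices than \<open>\<tau>\<close> arbitrary relations.\<close>

theorem extract_relations:
  assumes pairs: "\<And>i a b. i < c \<Longrightarrow> a \<noteq> b \<Longrightarrow> (i, a) \<in> A \<Longrightarrow> (i, b) \<in> A
      \<Longrightarrow> card {j. j < d \<and> xor_sum w j {(i, a), (i, b)} = 0} \<le> M"
  shows "(\<exists>S' K G'. single_system S' K G' \<and> triangular G' \<and> zero_relations w G'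
        \<and> d * card S' \<le> 2 * c * card G' \<and> (fst ` S' = {..<c} \<or> d * card S' < 2 * c * card G'))
    \<or> (\<exists>\<tau> S' K G' i a b J. single_system S' K G' \<and> d < c * \<tau> \<and> \<tau> \<le> M
        \<and> i < c \<and> a \<noteq> b \<and> (i, a) \<in> S' \<and> (i, b) \<in> S' \<and> J \<subseteq> {..<d} \<and> card J = \<tau>
        \<and> G' \<inter> J \<times> {{(i, a), (i, b)}} = {}
        \<and> triangular (G' \<union> J \<times> {{(i, a), (i, b)}}) \<and> zero_relations w (G' \<union> J \<times> {{(i, a), (i, b)}})
        \<and> (c - 1) * \<tau> * card (fiber i S') + (d - \<tau>) * (card S' - card (fiber i S')) \<le> 2 * (c - 1) * (card G' + \<tau>))"
    (is "?A \<or> ?B")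
proof -
  have all_pos: "2 \<le> card (fst ` S k)" if "k = r" for k
  proof -
    have "S k = A" using that set_ys by (simp add: S_def)
    then show ?thesis using fst_A c by simp
  qed
  have S1: "fst ` S 1 = {fst (ys ! 0)}"
    using r_pos by (simp add: S_def take_Suc_conv_app_nth)
  show ?thesis
  proof (cases "d < c * T 2 \<and> 2 \<le> r")
    case False
    define y where "y = (\<lambda>_ :: nat. real d / (2 * real c))"
    have "2 * (\<Sum>i<c. y i) \<le> real d" using c by (simp add: y_def)
    then obtain k where k: "1 \<le> k" "k \<le> r" and ex: "(\<Sum>t<k. y (fst (ys ! t))) < real (T k)
      \<or> k = r \<and> (\<Sum>t<k. y (fst (ys ! t))) \<le> real (T k)" by (rule exists_prefix)
    have iff: "real k * (real d / (2 * real c)) < real (T k) \<longleftrightarrow> d * k < 2 * c * T k"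
         "real k * (real d / (2 * real c)) \<le> real (T k) \<longleftrightarrow> d * k \<le> 2 * c * T k"
    proof -
      have "real k * (real d / (2 * real c)) < real (T k) \<longleftrightarrow> real (d * k) < real (2 * c * T k)"
        using c by (simp add: divide_simps mult_ac)
      then show "real k * (real d / (2 * real c)) < real (T k) \<longleftrightarrow> d * k < 2 * c * T k" by linarith
      have "real k * (real d / (2 * real c)) \<le> real (T k) \<longleftrightarrow> real (d * k) \<le> real (2 * c * T k)"
        using c by (simp add: divide_simps mult_ac)
      then show "real k * (real d / (2 * real c)) \<le> real (T k) \<longleftrightarrow> d * k \<le> 2 * c * T k" by linarith
    qed
    have ex': "d * k < 2 * c * T k \<or> k = r \<and> d * k \<le> 2 * c * T k"
    proof -
      have "(\<Sum>t<k. y (fst (ys ! t))) = real k * (real d / (2 * real c))" by (simp add: y_def)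
      then show ?thesis using ex unfolding iff[symmetric] by simp
    qed
    have "k \<noteq> 1" using ex' T_1 d by auto
    \<comment> \<open>Since \<open>c * T 2 \<le> d\<close>, two characters qualify only with
      equality and as the full prefix. Equality yields a relation, hence one common position,
      whereas the full prefix meets all \<open>c \<ge> 2\<close> positions.\<close>
    moreover have "k \<noteq> 2"
    proof
      assume k2: "k = 2"
      have T2: "c * T 2 \<le> d" using False k k2 by simp
      then have eq: "r = 2" "d = c * T 2" using ex' k2 by auto
      then have "Piv 2 \<noteq> {}" using d by (auto simp: T_def)
      then obtain j t where "(j, t) \<in> Piv 2" by force
      then have "fst (ys ! 0) = fst (ys ! 1)" using T_2(3) eq by simp
      then have "fst ` S 2 = {fst (ys ! 0)}" using S_2 eq by simp
      then show False using all_pos[of 2] eq by simp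
    qed
    ultimately have k3: "3 \<le> k" using k by simp
    have "fst ` S k = {..<c}" if "k = r" using that set_ys fst_A by (simp add: S_def)
    then have "?A"
      using single_system_S[OF k(2) k3 order_refl] triangular_G[OF k(2)] zero_G[OF k(2)] ex'
        card_G[OF k(2)] card_S[OF k(2)]
      by (intro exI[of _ "S k"] exI[of _ "(\<lambda>x. P x \<inter> S k) ` X"] exI[of _ "G k"]) auto
    then show ?thesis ..
  next
    case True
    then have r2: "2 \<le> r" by simp
    define \<tau> where "\<tau> = T 2"
    define i where "i = fst (ys ! 0)"
    define a where "a = snd (ys ! 0)"
    define b where "b = snd (ys ! 1)"
    define J where "J = {j. (j, 1) \<in> Piv 2}"
    have dt: "d < c * \<tau>" using True by (simp add: \<tau>_def)
    then have "Piv 2 \<noteq> {}" by (auto simp: \<tau>_def T_def)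
    then obtain j0 t0 where "(j0, t0) \<in> Piv 2" by force
    then have same: "fst (ys ! 1) = i" using T_2(3)[OF r2] by (simp add: i_def)
    have ys01: "ys ! 0 = (i, a)" "ys ! 1 = (i, b)" using same by (auto simp: i_def a_def b_def prod_eq_iff)
    have r01: "0 < r" "1 < r" using r2 by linarith+
    have "ys ! 0 \<noteq> ys ! 1" using nth_eq_iff_index_eq[OF dist r01] by simp
    then have ab: "a \<noteq> b" using ys01 by simp
    have A01: "(i, a) \<in> A" "(i, b) \<in> A"
      using ys01 set_ys nth_mem[OF r01(1)] nth_mem[OF r01(2)] by simp_all
    have i: "i < c" using subsetD[OF A_sub A01(1)] by simp
    have Piv2: "Piv 2 = (\<lambda>j. (j, 1)) ` J"
    proof (rule set_eqI)
      fix z :: "nat \<times> nat"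
      obtain j t where z: "z = (j, t)" by (cases z)
      show "z \<in> Piv 2 \<longleftrightarrow> z \<in> (\<lambda>j. (j, 1)) ` J"
        unfolding z J_def image_iff using T_2(1)[OF r2, of j t] by blast
    qed
    have cardJ: "card J = \<tau>" unfolding \<tau>_def T_def Piv2 by (rule card_image[symmetric]) (auto simp: inj_on_def)
    have Jd: "J \<subseteq> {..<d}" by (auto simp: J_def Piv_def)
    have vJ: "vv j 1 = {(i, a), (i, b)}" if "j \<in> J" for j
      using T_2(2)[OF r2, of j 1] that ys01 by (simp add: J_def)
    have "G 2 = (\<lambda>j. (j, vv j 1)) ` J" unfolding G_def Piv2 by (simp add: image_image)
    also have "\<dots> = (\<lambda>j. (j, {(i, a), (i, b)})) ` J" using vJ by (intro image_cong) simp_all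
    also have "\<dots> = J \<times> {{(i, a), (i, b)}}" by blast
    finally have G2: "G 2 = J \<times> {{(i, a), (i, b)}}" .
    have "xor_sum w j {(i, a), (i, b)} = 0" if "j \<in> J" for j
      using zero_G[OF r2] that unfolding G2 zero_relations_def by blast
    then have "J \<subseteq> {j. j < d \<and> xor_sum w j {(i, a), (i, b)} = 0}" using Jd by auto
    then have "\<tau> \<le> card {j. j < d \<and> xor_sum w j {(i, a), (i, b)} = 0}"
      unfolding cardJ[symmetric] by (intro card_mono) auto
    then have \<tau>M: "\<tau> \<le> M" using pairs[OF i ab A01] by simp
    have \<tau>d: "\<tau> \<le> d" using cardJ card_mono[OF _ Jd] by simp
    \<comment> \<open>Each character of position \<open>i\<close> costs \<open>\<tau> / 2\<close>,
      so the colliding pair pays exactly for its \<open>\<tau>\<close> relations; the other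
      positions share the remaining budget \<open>(d - \<tau>) / 2\<close> equally.\<close>
    define y where "y = (\<lambda>l. if l = i then real \<tau> / 2 else real (d - \<tau>) / (2 * real (c - 1)))"
    have "(\<Sum>l<c. y l) = y i + (\<Sum>l\<in>{..<c} - {i}. y l)" using i by (intro sum.remove) auto
    also have "(\<Sum>l\<in>{..<c} - {i}. y l) = (\<Sum>l\<in>{..<c} - {i}. real (d - \<tau>) / (2 * real (c - 1)))"
      by (rule sum.cong) (auto simp: y_def)
    also have "\<dots> = real (c - 1) * (real (d - \<tau>) / (2 * real (c - 1)))" using i by simp
    also have "\<dots> = real (d - \<tau>) / 2" using c by (simp add: divide_simps del: of_nat_diff)
    finally have "(\<Sum>l<c. y l) = y i + real (d - \<tau>) / 2" .
    moreover have "y i = real \<tau> / 2" "real (d - \<tau>) = real d - real \<tau>"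
      using \<tau>d by (simp_all add: y_def)
    ultimately have "2 * (\<Sum>l<c. y l) \<le> real d" by linarith
    then obtain k where k: "1 \<le> k" "k \<le> r" and ex: "(\<Sum>t<k. y (fst (ys ! t))) < real (T k)
      \<or> k = r \<and> (\<Sum>t<k. y (fst (ys ! t))) \<le> real (T k)" by (rule exists_prefix)
    have \<tau>pos: "0 < \<tau>" using dt by (cases \<tau>) auto
    have "k \<noteq> 1"
    proof
      assume "k = 1"
      then show False using ex T_1 \<tau>pos by (simp add: y_def i_def)
    qed
    \<comment> \<open>The pair just breaks even, so it could only qualify as the full prefix, which
      has more than one position.\<close>
    moreover have "k \<noteq> 2"
    proof
      assume k2: "k = 2"
      have "(\<Sum>t<2. y (fst (ys ! t))) = real (T 2)"
        using same by (simp add: numeral_2_eq_2 y_def i_def \<tau>_def)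
      then have "r = 2" using ex k2 by simp
      moreover have "fst ` S 2 = {i}" using S_2[OF r2] ys01 by simp
      ultimately show False using all_pos[of 2] by simp
    qed
    ultimately have k3: "3 \<le> k" using k by simp
    define G' where "G' = G k - G 2"
    have "Piv 2 \<subseteq> Piv k" using k3 by (auto simp: Piv_def)
    then have sub: "G 2 \<subseteq> G k" by (auto simp: G_def)
    have un: "G' \<union> J \<times> {{(i, a), (i, b)}} = G k" using sub unfolding G'_def G2[symmetric] by blast
    have finG: "finite (G k)" using finite_Piv by (simp add: G_def)
    have cardG': "card G' + \<tau> = T k"
      using card_Diff_subset[OF finite_subset[OF sub finG] sub] card_mono[OF finG sub]
        card_G[OF k(2)] card_G[OF r2] by (simp add: G'_def \<tau>_def)
    define f where "f = card (fiber i (S k))"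
    have finS: "finite (S k)" by (simp add: S_def)
    have filt: "card {\<alpha>\<in>S k. fst \<alpha> = i} = f"
      unfolding f_def by (rule bij_betw_same_card[of snd])
        (auto simp: bij_betw_def inj_on_def fiber_def image_iff)
    have "(\<Sum>t<k. y (fst (ys ! t))) = (\<Sum>\<alpha>\<in>S k. y (fst \<alpha>))" by (rule sum_prefix[OF k(2)])
    also have "\<dots> = (\<Sum>\<alpha>\<in>S k. if fst \<alpha> = i then real \<tau> / 2 else real (d - \<tau>) / (2 * real (c - 1)))"
      by (simp only: y_def)
    also have "\<dots> = real f * (real \<tau> / 2) + real (card (S k \<inter> - {\<alpha>. fst \<alpha> = i})) * (real (d - \<tau>) / (2 * real (c - 1)))"
      using filt finS by (simp add: sum.If_cases Int_def)
    also have "S k \<inter> - {\<alpha>. fst \<alpha> = i} = S k - {\<alpha>\<in>S k. fst \<alpha> = i}" by blast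
    also have "card \<dots> = card (S k) - f"
      using card_Diff_subset[of "{\<alpha>\<in>S k. fst \<alpha> = i}" "S k"] finS filt by simp
    finally have sum_y: "(\<Sum>t<k. y (fst (ys ! t)))
      = real f * (real \<tau> / 2) + real (card (S k) - f) * (real (d - \<tau>) / (2 * real (c - 1)))" .
    have "real f * (real \<tau> / 2) + real (card (S k) - f) * (real (d - \<tau>) / (2 * real (c - 1))) \<le> real (T k)"
      using ex unfolding sum_y by (meson less_imp_le)
    then have "2 * real (c - 1) * (real f * (real \<tau> / 2) + real (card (S k) - f) * (real (d - \<tau>) / (2 * real (c - 1))))
      \<le> 2 * real (c - 1) * real (T k)"
      by (rule mult_left_mono) simp
    moreover have "2 * m * (x * (t / 2) + z * (u / (2 * m))) = m * t * x + u * z" if "m \<noteq> 0" for m x t z u :: real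
      using that by (simp add: field_simps)
    moreover have "real (c - 1) \<noteq> 0" using c by simp
    ultimately have "real (c - 1) * real \<tau> * real f + real (d - \<tau>) * real (card (S k) - f) \<le> 2 * real (c - 1) * real (T k)"
      by metis
    then have "real ((c - 1) * \<tau> * f + (d - \<tau>) * (card (S k) - f)) \<le> real (2 * (c - 1) * T k)"
      by (simp only: of_nat_mult of_nat_add of_nat_numeral)
    then have main: "(c - 1) * \<tau> * f + (d - \<tau>) * (card (S k) - f) \<le> 2 * (c - 1) * (card G' + \<tau>)"
      unfolding cardG' by (simp only: of_nat_le_iff)
    have in_S: "(i, a) \<in> S k" "(i, b) \<in> S k"
      using S_2[OF r2] S_mono[of 2 k] k3 ys01 by auto
    have "G' \<inter> J \<times> {{(i, a), (i, b)}} = {}" unfolding G'_def G2[symmetric] by blast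
    moreover have "G' \<subseteq> G k" unfolding G'_def by (rule Diff_subset)
    ultimately have ?B
      using single_system_S[OF k(2) k3, of G'] dt \<tau>M i ab in_S Jd cardJ main
        triangular_G[OF k(2)] zero_G[OF k(2)]
      unfolding f_def
      by (intro exI[of _ \<tau>] exI[of _ "S k"] exI[of _ "(\<lambda>x. P x \<inter> S k) ` X"] exI[of _ G']
          exI[of _ i] exI[of _ a] exI[of _ b] exI[of _ J]) (simp add: un)
    then show ?thesis ..
  qed
qed

end

section \<open>Counting candidate relations\<close>

lemma card_subsets_0_or:
  assumes "finite F" "0 < k"
  shows "card {u. u \<subseteq> F \<and> card u \<in> {0, k}} = 1 + (card F choose k)"
proof -
  have "{u. u \<subseteq> F \<and> card u \<in> {0, k}} = insert {} {u. u \<subseteq> F \<and> card u = k}"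
    using assms(1) by (auto dest: finite_subset)
  moreover have "finite {u. u \<subseteq> F \<and> card u = k}" using assms(1) by simp
  ultimately show ?thesis using n_subsets[OF assms(1), of k] assms(2) by simp
qed

text \<open>A subset of \<open>S\<close> is determined by its fibers, each of which can be chosen on
  its own.\<close>

lemma card_fiberwise_le:
  assumes S: "finite S" "S \<subseteq> {..<c} \<times> UNIV" and k: "0 < k"
  shows "card {v. v \<subseteq> S \<and> (\<forall>i<c. card (fiber i v) \<in> {0, k})} \<le> (\<Prod>i<c. 1 + (card (fiber i S) choose k))"
proof -
  let ?V = "{v. v \<subseteq> S \<and> (\<forall>i<c. card (fiber i v) \<in> {0, k})}"
  let ?f = "\<lambda>v. \<lambda>i\<in>{..<c}. fiber i v"
  let ?W = "PiE {..<c} (\<lambda>i. {u. u \<subseteq> fiber i S \<and> card u \<in> {0, k}})"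
  have inj: "inj_on ?f ?V"
  proof (rule inj_onI, rule set_eqI)
    fix u v :: "(nat \<times> nat) set" and z :: "nat \<times> nat"
    assume u: "u \<in> ?V" and v: "v \<in> ?V" and eq: "?f u = ?f v"
    obtain i a where z: "z = (i, a)" by (cases z)
    show "z \<in> u \<longleftrightarrow> z \<in> v"
    proof (cases "i < c")
      case True
      then have "fiber i u = fiber i v" using fun_cong[OF eq, of i] by simp
      then have "a \<in> fiber i u \<longleftrightarrow> a \<in> fiber i v" by simp
      then show ?thesis by (simp add: z fiber_def)
    next
      case False
      then have "z \<notin> S" using S(2) z by auto
      then show ?thesis using u v by blast
    qed
  qed
  have sub: "?f ` ?V \<subseteq> ?W"
  proof (rule image_subsetI)
    fix v assume v: "v \<in> ?V"
    have "fiber i v \<subseteq> fiber i S" for i using v by (auto simp: fiber_def)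
    then show "?f v \<in> ?W" using v by (simp add: restrict_PiE_iff)
  qed
  have finF: "finite (fiber i S)" for i using S(1) by (rule finite_fiber)
  have finW: "finite ?W" using finF by (intro finite_PiE) simp_all
  have "card ?V = card (?f ` ?V)" using inj by (rule card_image[symmetric])
  also have "\<dots> \<le> card ?W" using finW sub by (rule card_mono)
  also have "\<dots> = (\<Prod>i<c. 1 + (card (fiber i S) choose k))"
    by (simp only: card_PiE finite_lessThan card_subsets_0_or[OF finF k])
  finally show ?thesis .
qed

lemma card_position_even:
  assumes "finite S" "S \<subseteq> {..<c} \<times> UNIV"
  shows "card (position_even c S) \<le> (\<Prod>i<c. 1 + (card (fiber i S) choose 2))"
proof -
  have "finite {v. v \<subseteq> S \<and> (\<forall>i<c. card (fiber i v) \<in> {0, 2})}" using assms(1) by simp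
  then have "card (position_even c S) \<le> card {v. v \<subseteq> S \<and> (\<forall>i<c. card (fiber i v) \<in> {0, 2})}"
    by (rule card_mono) (auto simp: position_even_def)
  then show ?thesis using card_fiberwise_le[OF assms, of 2] by linarith
qed

lemma card_partial_keys:
  assumes "finite S" "S \<subseteq> {..<c} \<times> UNIV"
  shows "card (partial_keys c S) \<le> (\<Prod>i<c. 1 + card (fiber i S))"
  using card_fiberwise_le[OF assms, of 1] by (simp add: partial_keys_def)

lemma card_eq_sum_fibers:
  assumes "finite v" "v \<subseteq> {..<c} \<times> UNIV"
  shows "card v = (\<Sum>i<c. card (fiber i v))"
proof -
  have "v = Sigma {..<c} (\<lambda>i. fiber i v)"
  proof (rule set_eqI)
    fix z :: "nat \<times> nat"
    show "z \<in> v \<longleftrightarrow> z \<in> Sigma {..<c} (\<lambda>i. fiber i v)"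
      using assms(2) by (cases z) (auto simp: fiber_def)
  qed
  moreover have "card (Sigma {..<c} (\<lambda>i. fiber i v)) = (\<Sum>i<c. card (fiber i v))"
    using finite_fiber[OF assms(1)] by (intro card_SigmaI) auto
  ultimately show ?thesis by metis
qed

text \<open>Position-even subsets have an even number of elements, which leaves only the two-element
  subsets.\<close>

lemma card_position_even_3:
  assumes S: "finite S" "S \<subseteq> {..<c} \<times> UNIV" "card S = 3"
  shows "card (position_even c S) \<le> 3"
proof -
  have "position_even c S \<subseteq> {v. v \<subseteq> S \<and> card v = 2}"
  proof (rule subsetI)
    fix v assume "v \<in> position_even c S"
    then have v: "v \<subseteq> S" "v \<noteq> {}" "\<forall>i<c. card (fiber i v) \<in> {0, 2}"
      by (auto simp: position_even_def)
    have fv: "finite v" using v(1) S(1) by (rule finite_subset)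
    have sum: "card v = (\<Sum>i<c. card (fiber i v))"
      using v(1) S(2) by (intro card_eq_sum_fibers[OF fv]) auto
    have "even (card (fiber i v))" if "i \<in> {..<c}" for i
      using bspec[of "{..<c}" "\<lambda>i. card (fiber i v) \<in> {0, 2}" i] v(3) that by auto
    then have "even (card v)" unfolding sum by (rule dvd_sum)
    moreover have "card v \<le> 3" using card_mono[OF S(1) v(1)] S(3) by simp
    moreover have "card v \<noteq> 0" using fv v(2) by simp
    ultimately have "card v = 2" by (elim evenE) auto
    then show "v \<in> {v. v \<subseteq> S \<and> card v = 2}" using v(1) by simp
  qed
  then have "card (position_even c S) \<le> card {v. v \<subseteq> S \<and> card v = 2}"
    using S(1) by (intro card_mono) simp_all
  also have "\<dots> = 3" using n_subsets[OF S(1), of 2] S(3) by (simp add: choose_two)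
  finally show ?thesis .
qed

lemma card_key_relations: 
  assumes "finite K" 
  shows "finite (key_relations K)" "card (key_relations K) \<le> card K choose 2"
proof -
  let ?E = "{e. e \<subseteq> K \<and> card e = 2}"
  \<comment> \<open>The symmetric difference is written as a function of the unordered pair
    \<open>e\<close>, so that \<open>{x, y}\<close> is counted once.\<close>
  have sub: "key_relations K \<subseteq> (\<lambda>e. \<Union> e - \<Inter> e) ` ?E"
  proof (rule subsetI)
    fix v assume "v \<in> key_relations K"
    then obtain x y where "v = char_diff x y" "x \<in> K" "y \<in> K" "x \<noteq> y"
      unfolding key_relations_def by blast
    then have "v = \<Union> {x, y} - \<Inter> {x, y}" "{x, y} \<in> ?E" by (auto simp: char_diff_def)
    then show "v \<in> (\<lambda>e. \<Union> e - \<Inter> e) ` ?E" by (rule image_eqI)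
  qed
  have fin: "finite ?E" using assms by simp
  show "finite (key_relations K)" using sub fin by (meson finite_imageI finite_subset)
  have "card (key_relations K) \<le> card ((\<lambda>e. \<Union> e - \<Inter> e) ` ?E)"
    using fin sub by (intro card_mono finite_imageI)
  also have "\<dots> \<le> card ?E" using fin by (rule card_image_le)
  finally show "card (key_relations K) \<le> card K choose 2" using n_subsets[OF assms, of 2] by simp
qed

lemma key_relations_mono: "K \<subseteq> K' \<Longrightarrow> key_relations K \<subseteq> key_relations K'"
  unfolding key_relations_def by blast

lemma choose_left_mono: "a \<le> b \<Longrightarrow> a choose m \<le> b choose m"
proof (induction rule: dec_induct)
  case (step n)
  have "n choose m \<le> Suc n choose m" by (cases m) simp_all
  then show ?case using step by simp
qed simp

lemma choose_le_pow_div_fact: "real (N choose m) \<le> real N ^ m / fact m"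
proof -
  have "real ((N choose m) * fact m) \<le> real (N ^ m)" using binomial_fact_pow by (rule of_nat_mono)
  then show ?thesis by (simp add: divide_simps)
qed

section \<open>Union bound over systems of relations\<close>

context random_tab
begin

text \<open>Common frame for both counts: each \<open>V\<close> in \<open>\<V> S\<close> is a pool
  of candidate relations, either the single pool of even subsets or one pool of key differences for
  each choice of keys. The block \<open>J \<times> {e}\<close> holds the relations of a pair
  colliding in \<open>t\<close> outputs and is empty for \<open>t = 0\<close>.\<close>

lemma prob_linked_relations:
  fixes \<S> :: "(nat \<times> nat) set set" and \<V> :: "(nat \<times> nat) set \<Rightarrow> (nat \<times> nat) set set set"
    and E :: "(nat \<times> nat) set \<Rightarrow> (nat \<times> nat) set set"
  assumes fin: "finite \<S>" and thin: "\<And>S. S \<in> \<S> \<Longrightarrow> thin S" and Z: "real (card \<S>) \<le> Z"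
    and V: "\<And>S. S \<in> \<S> \<Longrightarrow> finite (\<V> S) \<and> real (card (\<V> S)) \<le> B"
    and VN: "\<And>S V. S \<in> \<S> \<Longrightarrow> V \<in> \<V> S \<Longrightarrow> V \<subseteq> Pow S \<and> finite V \<and> card V \<le> N"
    and E: "\<And>S. S \<in> \<S> \<Longrightarrow> finite (E S) \<and> real (card (E S)) \<le> L \<and> E S \<subseteq> Pow S"
    and nonneg: "0 \<le> B" "0 \<le> L"
  shows "measure_pmf.prob p {w. \<exists>S\<in>\<S>. \<exists>V\<in>\<V> S. \<exists>e\<in>E S. \<exists>J\<in>{J. J \<subseteq> {..<d} \<and> card J = t}.
      \<exists>G\<in>{G. G \<subseteq> {..<d} \<times> V \<and> card G = m}. G \<inter> J \<times> {e} = {} \<and>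
        triangular (G \<union> J \<times> {e}) \<and> zero_relations w (G \<union> J \<times> {e})}
    \<le> Z * (B * (L * (real (d choose t) * (real (d * N choose m) * (1 / real psi) ^ (m + t)))))"
proof -
  define Js where "Js = {J. J \<subseteq> {..<d} \<and> card J = t}"
  define Gs where "Gs V = {G. G \<subseteq> {..<d} \<times> V \<and> card G = m}" for V :: "(nat \<times> nat) set set"
  \<comment> \<open>Systems that meet \<open>J \<times> {e}\<close> are dropped, so every union has
    exactly \<open>m + t\<close> elements.\<close>
  define H where "H V e J = (\<lambda>G. G \<union> J \<times> {e}) ` {G\<in>Gs V. G \<inter> J \<times> {e} = {}}"
    for V and e :: "(nat \<times> nat) set" and J :: "nat set"
  define \<G> where "\<G> = (\<Union>S\<in>\<S>. \<Union>V\<in>\<V> S. \<Union>e\<in>E S. \<Union>J\<in>Js. H V e J)"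
  have finJs: "finite Js" "card Js = d choose t"
    using n_subsets[of "{..<d}" t] by (simp_all add: Js_def)
  have finGs: "finite (Gs V)" if "finite V" for V using that by (simp add: Gs_def)
  have finH: "finite (H V e J)" if "finite V" for V e J using finGs[OF that] by (simp add: H_def)
  have cardGs: "card (Gs V) \<le> d * N choose m" if "finite V" "card V \<le> N" for V
  proof -
    have "card (Gs V) = card ({..<d} \<times> V) choose m"
      unfolding Gs_def using that(1) by (intro n_subsets) simp
    also have "\<dots> = d * card V choose m" by (simp add: card_cartesian_product)
    also have "\<dots> \<le> d * N choose m" using that(2) by (intro choose_left_mono) simp
    finally show ?thesis .
  qed
  have cardH: "card (H V e J) \<le> d * N choose m" if "finite V" "card V \<le> N" for V e J
  proof -
    have "card (H V e J) \<le> card {G\<in>Gs V. G \<inter> J \<times> {e} = {}}"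
      unfolding H_def using finGs[OF that(1)] by (intro card_image_le) simp
    also have "\<dots> \<le> card (Gs V)" using finGs[OF that(1)] by (intro card_mono) auto
    finally show ?thesis using cardGs[OF that] by simp
  qed
  have UN_le: "real (card (\<Union>x\<in>I. F x)) \<le> a * b"
    if "finite I" "real (card I) \<le> a" "\<And>x. x \<in> I \<Longrightarrow> real (card (F x)) \<le> b" "0 \<le> b"
    for I :: "'i set" and F :: "'i \<Rightarrow> 'j set" and a b :: real
  proof -
    have "real (card (\<Union>x\<in>I. F x)) \<le> real (\<Sum>x\<in>I. card (F x))"
      using card_UN_le[OF that(1)] by (rule of_nat_mono)
    also have "\<dots> \<le> real (card I) * b" using sum_mono[of I "\<lambda>x. real (card (F x))" "\<lambda>_. b"] that(3) by simp
    also have "\<dots> \<le> a * b" using that by (intro mult_right_mono)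
    finally show ?thesis .
  qed
  have "real (card \<G>) \<le> Z * (B * (L * (real (d choose t) * real (d * N choose m))))"
    unfolding \<G>_def
  proof (rule UN_le[OF fin Z])
    fix S assume S: "S \<in> \<S>"
    show "real (card (\<Union>V\<in>\<V> S. \<Union>e\<in>E S. \<Union>J\<in>Js. H V e J))
      \<le> B * (L * (real (d choose t) * real (d * N choose m)))"
    proof (rule UN_le)
      fix V assume VS: "V \<in> \<V> S"
      show "real (card (\<Union>e\<in>E S. \<Union>J\<in>Js. H V e J)) \<le> L * (real (d choose t) * real (d * N choose m))"
      proof (rule UN_le)
        fix e show "real (card (\<Union>J\<in>Js. H V e J)) \<le> real (d choose t) * real (d * N choose m)"
          using finJs cardH VN[OF S VS] by (intro UN_le) simp_all
      qed (use E[OF S] in simp_all)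
    qed (use V[OF S] nonneg in simp_all)
  qed (use nonneg in simp)
  then have "real (card \<G>) * (1 / real psi) ^ (m + t)
      \<le> Z * (B * (L * (real (d choose t) * real (d * N choose m)))) * (1 / real psi) ^ (m + t)"
    by (rule mult_right_mono) simp
  moreover have "measure_pmf.prob p {w. \<exists>G\<in>\<G>. triangular G \<and> zero_relations w G}
      \<le> real (card \<G>) * (1 / real psi) ^ (m + t)"
  proof (rule prob_exists_relations)
    show "finite \<G>" unfolding \<G>_def
      using fin V E VN finJs finH by (intro finite_UN_I) simp_all
    fix G' assume "G' \<in> \<G>"
    then obtain S V e J G where *: "S \<in> \<S>" "V \<in> \<V> S" "e \<in> E S" "J \<in> Js" "G \<in> Gs V" "G \<inter> J \<times> {e} = {}"
        "G' = G \<union> J \<times> {e}"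
      unfolding \<G>_def H_def by blast
    have sub: "G' \<subseteq> {..<d} \<times> Pow S"
      unfolding *(7)
    proof (rule Un_least)
      have "G \<subseteq> {..<d} \<times> V" "V \<subseteq> Pow S" using *(5) VN[OF *(1,2)] by (simp_all add: Gs_def)
      then show "G \<subseteq> {..<d} \<times> Pow S" by (meson Sigma_mono order_refl order_trans)
      have "J \<subseteq> {..<d}" "{e} \<subseteq> Pow S" using *(3,4) E[OF *(1)] by (auto simp: Js_def)
      then show "J \<times> {e} \<subseteq> {..<d} \<times> Pow S" by (rule Sigma_mono)
    qed
    have finS: "finite S" using thin[OF *(1)] by (rule thin_finite)
    have finJ: "finite J" using *(4) finite_subset[of J "{..<d}"] by (simp add: Js_def)
    have finG: "finite G" using *(5) VN[OF *(1,2)] finite_subset[of G "{..<d} \<times> V"] by (simp add: Gs_def)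
    have "card (J \<times> {e}) = t" using *(4) by (simp add: Js_def card_cartesian_product)
    then have "card G' = m + t"
      unfolding *(7) using finG finJ *(5,6) by (simp add: card_Un_disjoint Gs_def)
    moreover have "fst z < d \<and> snd z \<subseteq> S" if "z \<in> G'" for z
      using subsetD[OF sub that] by (simp add: mem_Times_iff)
    then have "fst ` G' \<subseteq> {..<d}" "\<Union> (snd ` G') \<subseteq> S"
      by (simp_all add: image_subset_iff UN_subset_iff)
    moreover have "finite G'" using finG finJ *(7) by simp
    ultimately show "finite G' \<and> fst ` G' \<subseteq> {..<d} \<and> thin (\<Union> (snd ` G')) \<and> card G' = m + t"
      using thin_mono[OF thin[OF *(1)]] by simp
  qed
  moreover have "{w. \<exists>S\<in>\<S>. \<exists>V\<in>\<V> S. \<exists>e\<in>E S. \<exists>J\<in>Js. \<exists>G\<in>Gs V. G \<inter> J \<times> {e} = {} \<and>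
        triangular (G \<union> J \<times> {e}) \<and> zero_relations w (G \<union> J \<times> {e})}
      = {w. \<exists>G\<in>\<G>. triangular G \<and> zero_relations w G}"
    unfolding \<G>_def H_def by blast
  ultimately show ?thesis by (simp add: Js_def Gs_def mult_ac)
qed

end

section \<open>Integer bounds on 1024 times the binary logarithm\<close>

text \<open>The floor of the binary logarithm, for positive \<open>n\<close>.\<close>

fun flog :: "nat \<Rightarrow> nat" where
  "flog n = (if n < 2 then 0 else Suc (flog (n div 2)))"

declare flog.simps [simp del]

lemma flog_numeral [simp]:
  "flog (Suc 0) = 0"
  "flog (numeral (Num.Bit0 k)) = Suc (flog (numeral k))"
  "flog (numeral (Num.Bit1 k)) = Suc (flog (numeral k))"
  "flog (numeral Num.One) = 0"
  by (subst flog.simps, simp)+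

text \<open>\<open>(m, e)\<close> stands for \<open>m * 2 ^ e\<close>. The mantissa keeps about 15
  bits: a square below \<open>2 ^ 29\<close> is shifted by 14 bits, a larger one by 15, and adding 1
  after \<open>div\<close> rounds up.\<close>

definition sq_up :: "int \<times> int \<Rightarrow> int \<times> int" where
  "sq_up = (\<lambda>(m, e). if m * m < 2^29 then (m * m div 2^14 + 1, 2 * e + 14) else (m * m div 2^15 + 1, 2 * e + 15))"

definition sq_dn :: "int \<times> int \<Rightarrow> int \<times> int" where
  "sq_dn = (\<lambda>(m, e). if m * m < 2^29 then (m * m div 2^14, 2 * e + 14) else (m * m div 2^15, 2 * e + 15))"

lemma sq_numeral:
  "sq_up (numeral m, e) =
    (if numeral m * numeral m < (536870912 :: int) then (numeral m * numeral m div 16384 + 1, 2 * e + 14)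
     else (numeral m * numeral m div 32768 + 1, 2 * e + 15))"
  "sq_dn (numeral m, e) =
    (if numeral m * numeral m < (536870912 :: int) then (numeral m * numeral m div 16384, 2 * e + 14)
     else (numeral m * numeral m div 32768, 2 * e + 15))"
  by (simp_all add: sq_up_def sq_dn_def)

text \<open>Ten squarings give \<open>n ^ 1024\<close>, so the final binary exponent is
  \<open>1024 * log 2 n\<close> up to rounding. Truncated subtraction makes at least one of the two
  initial shifts trivial, which brings \<open>n\<close> to 15 bits. The last branch rests on
  \<open>m \<le> 2 ^ m\<close> and makes the bound valid without an invariant on the size of
  \<open>m\<close>.\<close>

definition lg_up :: "nat \<Rightarrow> int" where
  "lg_up n = (let (m, e) = (sq_up ^^ 10) (int n * 2^(14 - flog n) div 2^(flog n - 14) + 1, int (flog n) - 14)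
     in if m \<le> 2^14 then e + 14 else if m \<le> 2^15 then e + 15 else e + m)"

text \<open>The default 0 is a valid lower bound for every positive \<open>n\<close> and again
  spares an invariant on the mantissa.\<close>

definition lg_dn :: "nat \<Rightarrow> int" where
  "lg_dn n = (let (m, e) = (sq_dn ^^ 10) (int n * 2^(14 - flog n) div 2^(flog n - 14), int (flog n) - 14)
     in if 2^14 \<le> m then e + 14 else 0)"

lemma funpow10: "(f ^^ 10) x = f (f (f (f (f (f (f (f (f (f x)))))))))"
  by (simp add: eval_nat_numeral)

lemma le_Suc_div_mult: "x \<le> (x div P + 1) * P" if "0 < P" for x P :: int
proof -
  have "x = x div P * P + x mod P" by simp
  moreover have "x mod P < P" using that by (rule pos_mod_bound)
  moreover have "(x div P + 1) * P = x div P * P + P" by (simp add: distrib_right)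
  ultimately show ?thesis by linarith
qed

lemma div_mult_le: "x div P * P \<le> x" if "0 < P" for x P :: int
proof -
  have "x = x div P * P + x mod P" by simp
  moreover have "0 \<le> x mod P" using that by (rule pos_mod_sign)
  ultimately show ?thesis by linarith
qed

lemma sq_up_bound:
  fixes x :: real
  assumes "0 \<le> x" "x \<le> real_of_int (fst s) * 2 powr real_of_int (snd s)"
  shows "x ^ 2 \<le> real_of_int (fst (sq_up s)) * 2 powr real_of_int (snd (sq_up s))"
proof -
  obtain m e where s: "s = (m, e)" by (cases s)
  have key: "real_of_int (m * m) \<le> real_of_int (m * m div 2 ^ k + 1) * 2 ^ k" for k
  proof -
    have "m * m \<le> (m * m div 2 ^ k + 1) * 2 ^ k" by (rule le_Suc_div_mult) simp
    then have "real_of_int (m * m) \<le> real_of_int ((m * m div 2 ^ k + 1) * 2 ^ k)" by (simp only: of_int_le_iff)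
    then show ?thesis by simp
  qed
  have "x ^ 2 \<le> (real_of_int m * 2 powr real_of_int e) ^ 2"
    using assms by (intro power_mono) (simp_all add: s)
  also have "\<dots> = real_of_int (m * m) * 2 powr real_of_int (2 * e)"
    by (simp add: power2_eq_square powr_add[symmetric] mult_ac)
  also have "\<dots> \<le> real_of_int (fst (sq_up s)) * 2 powr real_of_int (snd (sq_up s))"
  proof -
    have "real_of_int (m * m) * 2 powr real_of_int (2 * e)
        \<le> real_of_int (m * m div 2 ^ k + 1) * 2 ^ k * 2 powr real_of_int (2 * e)" for k
      using key by (intro mult_right_mono) simp_all
    also have "real_of_int (m * m div 2 ^ k + 1) * 2 ^ k * 2 powr real_of_int (2 * e)
        = real_of_int (m * m div 2 ^ k + 1) * 2 powr real_of_int (2 * e + int k)" for k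
      by (simp add: powr_add powr_realpow)
    finally have "real_of_int (m * m) * 2 powr real_of_int (2 * e)
        \<le> real_of_int (m * m div 2 ^ k + 1) * 2 powr real_of_int (2 * e + int k)" for k .
    from this[of 14] this[of 15] show ?thesis by (simp add: s sq_up_def)
  qed
  finally show ?thesis .
qed

lemma sq_dn_bound:
  fixes x :: real
  assumes "0 \<le> fst s" "real_of_int (fst s) * 2 powr real_of_int (snd s) \<le> x"
  shows "0 \<le> fst (sq_dn s)" "real_of_int (fst (sq_dn s)) * 2 powr real_of_int (snd (sq_dn s)) \<le> x ^ 2"
proof -
  obtain m e where s: "s = (m, e)" by (cases s)
  show "0 \<le> fst (sq_dn s)" by (simp add: s sq_dn_def pos_imp_zdiv_nonneg_iff)
  have key: "real_of_int (m * m div 2 ^ k) * 2 ^ k \<le> real_of_int (m * m)" for k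
  proof -
    have "(m * m div 2 ^ k) * 2 ^ k \<le> m * m" by (rule div_mult_le) simp
    then have "real_of_int ((m * m div 2 ^ k) * 2 ^ k) \<le> real_of_int (m * m)" by (simp only: of_int_le_iff)
    then show ?thesis by simp
  qed
  have "real_of_int (m * m div 2 ^ k) * 2 powr real_of_int (2 * e + int k) \<le> x ^ 2" for k
  proof -
    have "real_of_int (m * m div 2 ^ k) * 2 powr real_of_int (2 * e + int k)
        = real_of_int (m * m div 2 ^ k) * 2 ^ k * 2 powr real_of_int (2 * e)"
      by (simp add: powr_add powr_realpow)
    also have "\<dots> \<le> real_of_int (m * m) * 2 powr real_of_int (2 * e)"
      using key by (intro mult_right_mono) simp_all
    also have "\<dots> = (real_of_int m * 2 powr real_of_int e) ^ 2"
      by (simp add: power2_eq_square powr_add[symmetric] mult_ac)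
    also have "\<dots> \<le> x ^ 2" using assms by (intro power_mono) (simp_all add: s)
    finally show ?thesis .
  qed
  from this[of 14] this[of 15]
  show "real_of_int (fst (sq_dn s)) * 2 powr real_of_int (snd (sq_dn s)) \<le> x ^ 2"
    by (simp add: s sq_dn_def)
qed

lemma lg_start:
  "real n \<le> real_of_int (int n * 2^(14 - k) div 2^(k - 14) + 1) * 2 powr real_of_int (int k - 14)"
  "real_of_int (int n * 2^(14 - k) div 2^(k - 14)) * 2 powr real_of_int (int k - 14) \<le> real n"
proof -
  define N where "N = int n * 2^(14 - k)"
  have pw: "2 powr real_of_int (int k - 14) * 2 ^ (14 - k) = (2 :: real) ^ (k - 14)"
  proof (cases "k \<le> 14")
    case True
    then have "real_of_int (int k - 14) + real (14 - k) = 0" by simp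
    then have "2 powr real_of_int (int k - 14) * 2 powr real (14 - k) = (2 :: real) powr 0"
      by (simp only: powr_add[symmetric])
    then show ?thesis using True powr_realpow[of 2 "14 - k"] by simp
  next
    case False
    then have "2 powr real_of_int (int k - 14) = (2 :: real) powr real (k - 14)" by (simp add: of_nat_diff)
    then show ?thesis using False powr_realpow[of 2 "k - 14"] by simp
  qed
  have N: "real_of_int N * 2 powr real_of_int (int k - 14) = real n * 2 ^ (k - 14)"
    using pw by (simp add: N_def mult_ac)
  have "N \<le> (N div 2 ^ (k - 14) + 1) * 2 ^ (k - 14)" by (rule le_Suc_div_mult) simp
  then have "real_of_int N \<le> real_of_int ((N div 2 ^ (k - 14) + 1) * 2 ^ (k - 14))" by (simp only: of_int_le_iff)
  then have "real_of_int N * 2 powr real_of_int (int k - 14)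
      \<le> real_of_int (N div 2 ^ (k - 14) + 1) * 2 ^ (k - 14) * 2 powr real_of_int (int k - 14)"
    by (intro mult_right_mono) simp_all
  then show "real n \<le> real_of_int (int n * 2^(14 - k) div 2^(k - 14) + 1) * 2 powr real_of_int (int k - 14)"
    unfolding N by (simp add: N_def mult_ac)
  have "(N div 2 ^ (k - 14)) * 2 ^ (k - 14) \<le> N" by (rule div_mult_le) simp
  then have "real_of_int ((N div 2 ^ (k - 14)) * 2 ^ (k - 14)) \<le> real_of_int N" by (simp only: of_int_le_iff)
  then have "real_of_int (N div 2 ^ (k - 14)) * 2 ^ (k - 14) * 2 powr real_of_int (int k - 14)
      \<le> real_of_int N * 2 powr real_of_int (int k - 14)"
    by (intro mult_right_mono) simp_all
  then show "real_of_int (int n * 2^(14 - k) div 2^(k - 14)) * 2 powr real_of_int (int k - 14) \<le> real n"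
    unfolding N by (simp add: N_def mult_ac)
qed

lemma power_1024_le_powr:
  fixes x y :: real
  assumes "0 \<le> x" "x ^ 1024 \<le> 2 powr y"
  shows "x \<le> 2 powr (y / 1024)"
proof (rule power_le_imp_le_base)
  show "x ^ Suc 1023 \<le> (2 powr (y / 1024)) ^ Suc 1023"
    using assms(2) by (simp add: powr_power)
qed simp

lemma powr_le_power_1024:
  fixes x y :: real
  assumes "0 \<le> x" "2 powr y \<le> x ^ 1024"
  shows "2 powr (y / 1024) \<le> x"
proof (rule power_le_imp_le_base)
  show "(2 powr (y / 1024)) ^ Suc 1023 \<le> x ^ Suc 1023"
    using assms(2) by (simp add: powr_power)
qed (rule assms)

lemma mult_powr_le:
  assumes "real_of_int m \<le> 2 powr real_of_int k"
  shows "real_of_int m * 2 powr real_of_int e \<le> 2 powr real_of_int (e + k)"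
proof -
  have "real_of_int m * 2 powr real_of_int e \<le> 2 powr real_of_int k * 2 powr real_of_int e"
    using assms by (rule mult_right_mono) simp
  then show ?thesis by (simp add: powr_add mult.commute)
qed

lemma lg_up: "real n \<le> 2 powr (real_of_int (lg_up n) / 1024)"
proof (rule power_1024_le_powr)
  define s0 where "s0 = (int n * 2^(14 - flog n) div 2^(flog n - 14) + 1, int (flog n) - 14)"
  define s where "s = (sq_up ^^ 10) s0"
  have "real n ^ (2 ^ i) \<le> real_of_int (fst ((sq_up ^^ i) s0)) * 2 powr real_of_int (snd ((sq_up ^^ i) s0))" for i
  proof (induction i)
    case 0 then show ?case using lg_start(1)[of n "flog n"] by (simp add: s0_def)
  next
    case (Suc i)
    then show ?case using sq_up_bound[OF _ Suc.IH] by (simp add: power_mult[symmetric] mult.commute)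
  qed
  from this[of 10] have "real n ^ 1024 \<le> real_of_int (fst s) * 2 powr real_of_int (snd s)" by (simp add: s_def)
  also have "\<dots> \<le> 2 powr real_of_int (lg_up n)"
  proof -
    obtain m e where me: "s = (m, e)" by (cases s)
    have "real_of_int m \<le> 2 powr real_of_int m"
    proof (cases "m \<le> 0")
      case True
      then have "real_of_int m \<le> 0" by simp
      then show ?thesis using powr_ge_zero[of 2 "real_of_int m"] by linarith
    next
      case False
      then obtain k where k: "m = int k" using zero_le_imp_eq_int[of m] by auto
      have "real k \<le> 2 ^ k" using less_imp_le[OF of_nat_less_two_power] .
      also have "\<dots> = 2 powr real k" by (simp add: powr_realpow)
      finally show ?thesis by (simp add: k)
    qed
    moreover have "real_of_int m \<le> 2 powr real_of_int (int k)" if "m \<le> 2 ^ k" for k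
    proof -
      have "real_of_int m \<le> real_of_int (2 ^ k)" using that by (simp only: of_int_le_iff)
      then show ?thesis by (simp add: powr_realpow)
    qed
    from this[of 14] this[of 15]
    have "m \<le> 2 ^ 14 \<Longrightarrow> real_of_int m \<le> 2 powr real_of_int 14" "m \<le> 2 ^ 15 \<Longrightarrow> real_of_int m \<le> 2 powr real_of_int 15"
      by simp_all
    moreover have "lg_up n = (if m \<le> 2^14 then e + 14 else if m \<le> 2^15 then e + 15 else e + m)"
      by (simp add: lg_up_def s0_def[symmetric] s_def[symmetric] me)
    ultimately show ?thesis unfolding me fst_conv snd_conv
      using mult_powr_le[of m 14 e] mult_powr_le[of m 15 e] mult_powr_le[of m m e] by presburger
  qed
  finally show "real n ^ 1024 \<le> 2 powr real_of_int (lg_up n)" .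
qed simp

lemma lg_dn: "0 < n \<Longrightarrow> 2 powr (real_of_int (lg_dn n) / 1024) \<le> real n"
proof (rule powr_le_power_1024)
  assume n: "0 < n"
  define s0 where "s0 = (int n * 2^(14 - flog n) div 2^(flog n - 14), int (flog n) - 14)"
  define s where "s = (sq_dn ^^ 10) s0"
  have "0 \<le> fst ((sq_dn ^^ i) s0) \<and> real_of_int (fst ((sq_dn ^^ i) s0)) * 2 powr real_of_int (snd ((sq_dn ^^ i) s0)) \<le> real n ^ (2 ^ i)" for i
  proof (induction i)
    case 0 then show ?case using lg_start(2)[of n "flog n"] by (simp add: s0_def pos_imp_zdiv_nonneg_iff)
  next
    case (Suc i)
    then have IH: "0 \<le> fst ((sq_dn ^^ i) s0)" "real_of_int (fst ((sq_dn ^^ i) s0)) * 2 powr real_of_int (snd ((sq_dn ^^ i) s0)) \<le> real n ^ (2 ^ i)"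
      by blast+
    show ?case using sq_dn_bound[OF IH] by (simp add: power_mult[symmetric] mult.commute)
  qed
  from this[of 10] have st: "real_of_int (fst s) * 2 powr real_of_int (snd s) \<le> real n ^ 1024" by (simp add: s_def)
  obtain m e where me: "s = (m, e)" by (cases s)
  have lg: "lg_dn n = (if 2^14 \<le> m then e + 14 else 0)"
    by (simp add: lg_dn_def s0_def[symmetric] s_def[symmetric] me)
  show "2 powr real_of_int (lg_dn n) \<le> real n ^ 1024"
  proof (cases "2^14 \<le> m")
    case True
    then have "real_of_int (2 ^ 14) \<le> real_of_int m" by (simp only: of_int_le_iff)
    then have "16384 * 2 powr real_of_int e \<le> real_of_int m * 2 powr real_of_int e"
      by (intro mult_right_mono) simp_all
    also have "\<dots> \<le> real n ^ 1024" using st by (simp only: me fst_conv snd_conv)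
    finally show ?thesis using True by (simp add: lg powr_add mult.commute)
  next
    case False
    then show ?thesis using n by (simp add: lg one_le_power)
  qed
qed simp

definition lg_fact :: "nat \<Rightarrow> int" where
  "lg_fact n = (\<Sum>i\<in>{1..n}. lg_dn i)"

lemma lg_fact: "2 powr (real_of_int (lg_fact n) / 1024) \<le> fact n"
proof (induction n)
  case (Suc n)
  have "2 powr (real_of_int (lg_fact (Suc n)) / 1024)
      = 2 powr (real_of_int (lg_dn (Suc n)) / 1024) * 2 powr (real_of_int (lg_fact n) / 1024)"
    by (simp add: lg_fact_def powr_add[symmetric] add_divide_distrib add.commute)
  also have "\<dots> \<le> real (Suc n) * fact n" using lg_dn[of "Suc n"] Suc by (intro mult_mono) auto
  finally show ?case by simp
qed (simp add: lg_fact_def)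

section \<open>Products over fibers, largest for balanced sizes\<close>

text \<open>At every integer a concave sequence lies below the line through its values at
  \<open>q\<close> and \<open>q + 1\<close>; summing a line needs only the number and the total of
  the arguments.\<close>

lemma sum_concave_le:
  fixes u :: "nat \<Rightarrow> real"
  assumes conc: "\<And>x. u (Suc (Suc x)) - u (Suc x) \<le> u (Suc x) - u x"
  shows "(\<Sum>i\<in>I. u (s i)) \<le> real (card I) * u q + (real (\<Sum>i\<in>I. s i) - real (card I) * real q) * (u (Suc q) - u q)"
proof -
  have anti: "u (Suc y) - u y \<le> u (Suc x) - u x" if "x \<le> y" for x y
    using that by (induction rule: dec_induct) (use conc order_trans in blast)+
  have up: "u (q + n) \<le> u q + real n * (u (Suc q) - u q)" for n
  proof (induction n)
    case (Suc n)
    then show ?case using anti[of q "q + n"] by (simp add: algebra_simps)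
  qed simp
  have down: "u (q - n) \<le> u q - real n * (u (Suc q) - u q)" if "n \<le> q" for n
    using that
  proof (induction n)
    case (Suc n)
    then have "Suc (q - Suc n) = q - n" by simp
    then show ?case using Suc anti[of "q - Suc n" q] by (simp add: algebra_simps)
  qed simp
  have tangent: "u x \<le> u q + (real x - real q) * (u (Suc q) - u q)" for x
  proof (cases "q \<le> x")
    case True
    then show ?thesis using up[of "x - q"] by (simp add: of_nat_diff)
  next
    case False
    then show ?thesis using down[of "q - x"] by (simp add: of_nat_diff algebra_simps)
  qed
  have "(\<Sum>i\<in>I. u (s i)) \<le> (\<Sum>i\<in>I. u q + (real (s i) - real q) * (u (Suc q) - u q))"
    by (intro sum_mono tangent)
  also have "\<dots> = real (card I) * u q + (\<Sum>i\<in>I. real (s i) - real q) * (u (Suc q) - u q)"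
    by (simp add: sum.distrib sum_distrib_right)
  also have "(\<Sum>i\<in>I. real (s i) - real q) = real (\<Sum>i\<in>I. s i) - real (card I) * real q"
    by (simp add: sum_subtractf)
  finally show ?thesis .
qed

definition even_poly :: "nat \<Rightarrow> nat" where "even_poly x = 1 + x * (x - 1) div 2"

lemma even_poly_choose: "1 + (x choose 2) = even_poly x"
  by (simp add: even_poly_def choose_two)

lemma two_even_poly: "2 * real (even_poly x) = real x * real x - real x + 2"
proof -
  have "2 * (x * (x - 1) div 2) = x * (x - 1)" by (cases x) (auto simp: dvd_mult_div_cancel)
  then have "2 * real (x * (x - 1) div 2) = real (x * (x - 1))" by (metis of_nat_mult of_nat_numeral)
  then show ?thesis by (cases x) (simp_all add: even_poly_def algebra_simps)
qed

lemma even_poly_pos: "0 < even_poly x" by (simp add: even_poly_def)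

text \<open>Logarithm of \<open>1 + (x choose 2)\<close>, made concave by a chord on \<open>{0..4}\<close>.\<close>

definition even_log :: "nat \<Rightarrow> real" where
  "even_log x = (if x < 4 then real x * log 2 7 / 4 else log 2 (even_poly x))"

lemma even_log_bound: "real (even_poly x) \<le> 2 powr even_log x"
proof (cases "x < 4")
  case True
  have pw: "2 powr (real k * log 2 7 / 4) = (7::real) powr (real k / 4)" for k
  proof -
    have "2 powr (real k * log 2 7 / 4) = (2 powr log 2 7) powr (real k / 4)"
      unfolding powr_powr by (simp add: mult.commute)
    then show ?thesis by simp
  qed
  \<comment> \<open>At 2 and 3 the chord has to dominate the values 2 and 4; the second condition
    reads \<open>4 ^ 4 \<le> 7 ^ 3\<close>.\<close>
  have "2 \<le> (7::real) powr (2 / 4)" "4 \<le> (7::real) powr (3 / 4)"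
  proof -
    show "2 \<le> (7::real) powr (2 / 4)" by (simp add: powr_half_sqrt real_le_rsqrt)
    have "4 ^ 4 \<le> ((7::real) powr (3 / 4)) ^ 4" by (simp add: powr_power)
    then show "4 \<le> (7::real) powr (3 / 4)" by (subst (asm) power_mono_iff) simp_all
  qed
  moreover have "x = 0 \<or> x = 1 \<or> x = 2 \<or> x = 3" using True by auto
  ultimately have "real (even_poly x) \<le> 7 powr (real x / 4)"
    by (elim disjE) (simp_all add: even_poly_def ge_one_powr_ge_zero)
  then show ?thesis using True by (simp only: even_log_def pw if_True)
next
  case False
  then show ?thesis using even_poly_pos by (simp add: even_log_def)
qed

lemma log_diff_le:
  assumes "0 < a" "0 < b" "0 < (c::real)" "a * c \<le> b * b"
  shows "log 2 c - log 2 b \<le> log 2 b - log 2 a"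
proof -
  have "log 2 (a * c) \<le> log 2 (b * b)" using assms by simp
  then show ?thesis using assms by (simp add: log_mult)
qed

lemma even_log_concave: "even_log (Suc (Suc x)) - even_log (Suc x) \<le> even_log (Suc x) - even_log x"
proof -
  consider "x < 2" | "x = 2" | "x = 3" | "4 \<le> x" by linarith
  then show ?thesis
  proof cases
    case 1
    then have "x = 0 \<or> x = 1" by auto
    then show ?thesis by (elim disjE) (simp_all add: even_log_def)
  next
    case 2
    then show ?thesis by (simp add: even_log_def even_poly_def)
  next
    case 3
    \<comment> \<open>The step from 7 to 11 that follows the chord must not be steeper than the
      chord: \<open>log 2 (11 / 7) \<le> log 2 7 / 4\<close>.\<close>
    have "log 2 ((11::real) ^ 4) \<le> log 2 (7 ^ 5)" by (simp del: log_pow_cancel)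
    then have "4 * log 2 (11::real) \<le> 5 * log 2 7" by (simp only: log_nat_power)
    then show ?thesis using 3 by (simp add: even_log_def even_poly_def)
  next
    case 4
    let ?r = "real x"
    have e: "2 * real (even_poly x) = ?r * ?r - ?r + 2"
      "2 * real (even_poly (Suc x)) = ?r * ?r + ?r + 2"
      "2 * real (even_poly (Suc (Suc x))) = ?r * ?r + 3 * ?r + 4"
      using two_even_poly[of x] two_even_poly[of "Suc x"] two_even_poly[of "Suc (Suc x)"]
      by (simp_all add: algebra_simps)
    have "(2 * real (even_poly x)) * (2 * real (even_poly (Suc (Suc x))))
        \<le> (2 * real (even_poly (Suc x))) * (2 * real (even_poly (Suc x)))"
    proof -
      have "4 \<le> ?r * 2" using 4 by simp
      then have "4 \<le> ?r * 2 + ?r * (?r * 2)" by (simp add: add_increasing2)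
      then show ?thesis unfolding e by (simp add: algebra_simps)
    qed
    then have "real (even_poly x) * real (even_poly (Suc (Suc x)))
        \<le> real (even_poly (Suc x)) * real (even_poly (Suc x))" by simp
    then show ?thesis using 4 even_poly_pos log_diff_le[of "even_poly x" "even_poly (Suc x)" "even_poly (Suc (Suc x))"]
      by (simp add: even_log_def)
  qed
qed

text \<open>The increment 3 makes the division by 4 round up.\<close>

definition even_up :: "nat \<Rightarrow> int" where
  "even_up x = (if x < 4 then (int x * lg_up 7 + 3) div 4 else lg_up (even_poly x))"

lemma log_le_lg_up: "0 < n \<Longrightarrow> 1024 * log 2 (real n) \<le> real_of_int (lg_up n)"
proof -
  assume "0 < n"
  then have "log 2 (real n) \<le> log 2 (2 powr (real_of_int (lg_up n) / 1024))"
    using lg_up[of n] by (subst log_le_cancel_iff) simp_all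
  then show ?thesis by simp
qed

lemma lg_dn_le_log: "0 < n \<Longrightarrow> real_of_int (lg_dn n) \<le> 1024 * log 2 (real n)"
proof -
  assume "0 < n"
  then have "log 2 (2 powr (real_of_int (lg_dn n) / 1024)) \<le> log 2 (real n)"
    using lg_dn[of n] by (subst log_le_cancel_iff) simp_all
  then show ?thesis by simp
qed

lemma even_up: "1024 * even_log x \<le> real_of_int (even_up x)"
proof (cases "x < 4")
  case True
  have "int x * lg_up 7 \<le> (int x * lg_up 7 + 3) div 4 * 4" by linarith
  then have "real_of_int (int x * lg_up 7) \<le> real_of_int ((int x * lg_up 7 + 3) div 4 * 4)"
    by (simp only: of_int_le_iff)
  moreover have "real x * (1024 * log 2 7) \<le> real x * real_of_int (lg_up 7)"
    using log_le_lg_up[of 7] by (intro mult_left_mono) simp_all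
  ultimately show ?thesis using True by (simp add: even_log_def even_up_def)
next
  case False
  then show ?thesis using log_le_lg_up[OF even_poly_pos, of x] by (simp add: even_log_def even_up_def)
qed

text \<open>The value at the balanced split of \<open>s\<close> into \<open>C\<close> fibers, of
  which \<open>s mod C\<close> have one element more than the others. By concavity no other split
  gives more. \<open>key_bound\<close> has the same form.\<close>

definition even_bound :: "nat \<Rightarrow> nat \<Rightarrow> int" where
  "even_bound C s = (int C - int (s mod C)) * even_up (s div C) + int (s mod C) * even_up (Suc (s div C))"

definition key_bound :: "nat \<Rightarrow> nat \<Rightarrow> int" where
  "key_bound C s = (int C - int (s mod C)) * lg_up (Suc (s div C)) + int (s mod C) * lg_up (Suc (Suc (s div C)))"

lemma balanced_bound:
  fixes u :: "nat \<Rightarrow> real" and U :: "nat \<Rightarrow> int"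
  assumes conc: "\<And>x. u (Suc (Suc x)) - u (Suc x) \<le> u (Suc x) - u x"
    and U: "\<And>x. 1024 * u x \<le> real_of_int (U x)"
    and C: "card I = C" "0 < C" and s: "(\<Sum>i\<in>I. s i) = n"
  shows "(\<Sum>i\<in>I. u (s i)) \<le> real_of_int ((int C - int (n mod C)) * U (n div C) + int (n mod C) * U (Suc (n div C))) / 1024"
proof -
  let ?q = "n div C" and ?r = "n mod C"
  have n: "real n = real C * real ?q + real ?r"
    by (metis div_mult_mod_eq mult.commute of_nat_add of_nat_mult)
  have r: "real ?r \<le> real C" using C(2) by (simp add: less_imp_le)
  have "(\<Sum>i\<in>I. u (s i)) \<le> real C * u ?q + (real n - real C * real ?q) * (u (Suc ?q) - u ?q)"
    using sum_concave_le[where u = u and I = I and s = s and q = ?q, OF conc] C(1) s by simp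
  also have "\<dots> = (real C - real ?r) * u ?q + real ?r * u (Suc ?q)"
    unfolding n by (simp add: algebra_simps)
  also have "\<dots> \<le> (real C - real ?r) * (real_of_int (U ?q) / 1024) + real ?r * (real_of_int (U (Suc ?q)) / 1024)"
    using U[of ?q] U[of "Suc ?q"] r by (intro add_mono mult_left_mono) simp_all
  also have "\<dots> = real_of_int ((int C - int ?r) * U ?q + int ?r * U (Suc ?q)) / 1024"
    by (simp add: add_divide_distrib)
  finally show ?thesis .
qed

lemma prod_even_poly_le:
  assumes "finite I" "card I = C" "0 < C" "(\<Sum>i\<in>I. s i) = n"
  shows "real (\<Prod>i\<in>I. even_poly (s i)) \<le> 2 powr (real_of_int (even_bound C n) / 1024)"
proof -
  have "real (\<Prod>i\<in>I. even_poly (s i)) \<le> (\<Prod>i\<in>I. 2 powr even_log (s i))"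
    unfolding of_nat_prod using even_log_bound by (intro prod_mono) simp
  also have "\<dots> = 2 powr (\<Sum>i\<in>I. even_log (s i))" using assms(1) by (simp add: powr_sum)
  also have "\<dots> \<le> 2 powr (real_of_int (even_bound C n) / 1024)"
    unfolding even_bound_def using balanced_bound[where u = even_log and U = even_up, OF even_log_concave even_up assms(2,3,4)] by simp
  finally show ?thesis .
qed

lemma key_log_concave:
  "log 2 (real (Suc (Suc (Suc x)))) - log 2 (real (Suc (Suc x))) \<le> log 2 (real (Suc (Suc x))) - log 2 (real (Suc x))"
  by (rule log_diff_le) (simp_all add: algebra_simps)

lemma prod_keys_le:
  assumes "finite I" "card I = C" "0 < C" "(\<Sum>i\<in>I. s i) = n"
  shows "real (\<Prod>i\<in>I. 1 + s i) \<le> 2 powr (real_of_int (key_bound C n) / 1024)"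
proof -
  have "real (\<Prod>i\<in>I. 1 + s i) = (\<Prod>i\<in>I. 2 powr log 2 (real (Suc (s i))))"
    unfolding of_nat_prod by (intro prod.cong) simp_all
  also have "\<dots> = 2 powr (\<Sum>i\<in>I. log 2 (real (Suc (s i))))" using assms(1) by (simp add: powr_sum)
  also have "\<dots> \<le> 2 powr (real_of_int (key_bound C n) / 1024)"
    unfolding key_bound_def
    using balanced_bound[where u = "\<lambda>x. log 2 (real (Suc x))" and U = "\<lambda>x. lg_up (Suc x)", OF key_log_concave log_le_lg_up[OF zero_less_Suc] assms(2,3,4)] by simp
  finally show ?thesis .
qed

text \<open>The tangent stays at a fixed \<open>q\<close>, so the exponent is linear in
  \<open>n\<close>; this is what makes the bound for large sets geometric.
  \<open>C * q \<le> n\<close> keeps the factor of the rounded slope nonnegative.\<close>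

lemma prod_keys_tangent:
  assumes "finite I" "card I = C" "(\<Sum>i\<in>I. s i) = n" "C * q \<le> n"
  shows "real (\<Prod>i\<in>I. 1 + s i)
    \<le> 2 powr (real_of_int (int C * lg_up (Suc q) + (int n - int (C * q)) * (lg_up (Suc (Suc q)) - lg_dn (Suc q))) / 1024)"
proof -
  have "real (\<Prod>i\<in>I. 1 + s i) = (\<Prod>i\<in>I. 2 powr log 2 (real (Suc (s i))))"
    unfolding of_nat_prod by (intro prod.cong) simp_all
  also have "\<dots> = 2 powr (\<Sum>i\<in>I. log 2 (real (Suc (s i))))" using assms(1) by (simp add: powr_sum)
  also have "(\<Sum>i\<in>I. log 2 (real (Suc (s i))))
      \<le> real C * log 2 (real (Suc q)) + (real n - real C * real q) * (log 2 (real (Suc (Suc q))) - log 2 (real (Suc q)))"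
    using sum_concave_le[where u = "\<lambda>x. log 2 (real (Suc x))" and I = I and s = s and q = q, OF key_log_concave] assms(2,3) by simp
  also have "\<dots> \<le> real C * (real_of_int (lg_up (Suc q)) / 1024)
      + (real n - real C * real q) * (real_of_int (lg_up (Suc (Suc q))) / 1024 - real_of_int (lg_dn (Suc q)) / 1024)"
  proof (intro add_mono mult_left_mono)
    show "log 2 (real (Suc q)) \<le> real_of_int (lg_up (Suc q)) / 1024"
      using log_le_lg_up[OF zero_less_Suc, of q] by simp
    have "real_of_int (lg_dn (Suc q)) / 1024 \<le> log 2 (real (Suc q))"
      using lg_dn_le_log[OF zero_less_Suc, of q] by simp
    then show "log 2 (real (Suc (Suc q))) - log 2 (real (Suc q))
        \<le> real_of_int (lg_up (Suc (Suc q))) / 1024 - real_of_int (lg_dn (Suc q)) / 1024"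
      using log_le_lg_up[OF zero_less_Suc, of "Suc q"] by simp
    have "real (C * q) \<le> real n" using assms(4) by (simp only: of_nat_le_iff)
    then show "0 \<le> real n - real C * real q" by simp
  qed simp
  also have "\<dots> = real_of_int (int C * lg_up (Suc q) + (int n - int (C * q)) * (lg_up (Suc (Suc q)) - lg_dn (Suc q))) / 1024"
    by (simp add: add_divide_distrib diff_divide_distrib algebra_simps)
  finally show ?thesis by simp
qed

section \<open>The union bound in terms of binary exponents\<close>

lemma power_div_fact_le_exp: "0 \<le> x \<Longrightarrow> x ^ m / fact m \<le> exp (x :: real)"
proof -
  assume x: "0 \<le> x"
  have "(\<Sum>i\<in>{m}. x ^ i /\<^sub>R fact i) \<le> (\<Sum>i. x ^ i /\<^sub>R fact i)"
    using x summable_exp_generic[of x] by (intro sum_le_suminf) simp_all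
  then show ?thesis by (simp add: exp_def divide_inverse mult.commute)
qed

text \<open>From \<open>ln 2 \<ge> 2 / 3\<close>; it keeps the exponent rational.\<close>

lemma exp_le_powr: "0 \<le> (u :: real) \<Longrightarrow> exp u \<le> 2 powr (3 * u / 2)"
proof -
  assume u: "0 \<le> u"
  have "u * (2 / 3 :: real) \<le> u * ln 2" using ln2_ge_two_thirds u by (rule mult_left_mono)
  then show ?thesis by (simp add: powr_def)
qed

text \<open>A block of \<open>t\<close> relations on one set \<open>e\<close> together with
  \<open>m\<close> others. The keys \<open>K\<close> are carried along so that both counts apply to
  the same event.\<close>

definition linked :: "nat \<Rightarrow> nat \<Rightarrow> (nat \<Rightarrow> nat \<Rightarrow> nat \<Rightarrow> nat) \<Rightarrow> (nat \<times> nat) set set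
    \<Rightarrow> ((nat \<times> nat) set \<Rightarrow> (nat \<times> nat) set set) \<Rightarrow> nat \<Rightarrow> nat \<Rightarrow> bool" where
  "linked c d w \<S> E t m \<longleftrightarrow> (\<exists>S\<in>\<S>. \<exists>K. K \<subseteq> partial_keys c S \<and> finite K \<and> card K \<le> 100 \<and>
     (\<exists>e\<in>E S. \<exists>J. J \<subseteq> {..<d} \<and> card J = t \<and>
     (\<exists>G. G \<subseteq> {..<d} \<times> (position_even c S \<inter> key_relations K) \<and> card G = m \<and> G \<inter> J \<times> {e} = {} \<and>
        triangular (G \<union> J \<times> {e}) \<and> zero_relations w (G \<union> J \<times> {e}))))"

lemma pow_div_fact_le:
  assumes "real N \<le> 2 powr x" "2 powr y \<le> (fact m :: real)"
  shows "real N ^ m / fact m \<le> 2 powr (real m * x - y)"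
proof -
  have "real N ^ m / fact m \<le> (2 powr x) ^ m / 2 powr y"
    using assms by (intro frac_le power_mono) simp_all
  also have "\<dots> = 2 powr (real m * x - y)" by (simp add: powr_power powr_diff)
  finally show ?thesis .
qed

lemma lg_up_mult: "real (a * b) \<le> 2 powr (real_of_int (lg_up a) / 1024) * real b"
  using lg_up[of a] by (simp add: mult_right_mono)

context random_tab
begin

lemma union_bound_powr:
  fixes z b l l' x :: real
  assumes "Z \<le> 2 powr z" "B \<le> 2 powr b" "L \<le> 2 powr l" "real (d choose t) \<le> 2 powr l'" "X \<le> 2 powr x"
    and "0 \<le> Z" "0 \<le> B" "0 \<le> L" "0 \<le> X" and r: "psi = 2 ^ r"
  shows "Z * (B * (L * (real (d choose t) * (X * (1 / real psi) ^ (m + t))))) \<le> 2 powr (z + b + l + l' + x - real r * real (m + t))"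
proof -
  have psi': "(1 / real psi) ^ (m + t) = 2 powr (- (real r * real (m + t)))"
    unfolding r by (simp add: powr_minus powr_realpow[symmetric] powr_powr power_one_over inverse_eq_divide powr_power)
  have "Z * (B * (L * (real (d choose t) * (X * (1 / real psi) ^ (m + t)))))
      \<le> 2 powr z * (2 powr b * (2 powr l * (2 powr l' * (2 powr x * 2 powr (- (real r * real (m + t)))))))"
    unfolding psi' using assms by (intro mult_mono) simp_all
  also have "\<dots> = 2 powr (z + b + l + l' + x - real r * real (m + t))"
    by (simp add: powr_add[symmetric] algebra_simps)
  finally show ?thesis .
qed

context
  fixes \<S> :: "(nat \<times> nat) set set" and E :: "(nat \<times> nat) set \<Rightarrow> (nat \<times> nat) set set" and z l :: int and r :: nat
  assumes thin: "\<And>S. S \<in> \<S> \<Longrightarrow> thin S" and Z: "real (card \<S>) \<le> 2 powr (real_of_int z / 1024)"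
    and E: "\<And>S. S \<in> \<S> \<Longrightarrow> finite (E S) \<and> real (card (E S)) \<le> 2 powr (real_of_int l / 1024) \<and> E S \<subseteq> Pow S"
    and r: "psi = 2 ^ r"
begin

lemma fin_family: "finite \<S>"
  by (rule finite_subset[of _ "Pow chars"]) (use thin finite_chars in \<open>auto simp: thin_def\<close>)

lemma prob_linked_even_gen:
  assumes V: "\<And>S. S \<in> \<S> \<Longrightarrow> card (position_even c S) \<le> N"
    and X: "real (d * N choose m) \<le> 2 powr x"
  shows "measure_pmf.prob p {w. linked c d w \<S> E t m}
    \<le> 2 powr (real_of_int (z + l + lg_up (d choose t)) / 1024 + x - real r * real (m + t))"
proof -
  let ?ev = "{w. \<exists>S\<in>\<S>. \<exists>V\<in>{position_even c S}. \<exists>e\<in>E S. \<exists>J\<in>{J. J \<subseteq> {..<d} \<and> card J = t}.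
      \<exists>G\<in>{G. G \<subseteq> {..<d} \<times> V \<and> card G = m}. G \<inter> J \<times> {e} = {} \<and>
        triangular (G \<union> J \<times> {e}) \<and> zero_relations w (G \<union> J \<times> {e})}"
  have "{w. linked c d w \<S> E t m} \<subseteq> ?ev"
    unfolding linked_def by blast
  then have "measure_pmf.prob p {w. linked c d w \<S> E t m} \<le> measure_pmf.prob p ?ev"
    by (rule measure_pmf.finite_measure_mono) simp
  also have "\<dots> \<le> 2 powr (real_of_int z / 1024)
      * (1 * (2 powr (real_of_int l / 1024) * (real (d choose t) * (real (d * N choose m) * (1 / real psi) ^ (m + t)))))"
  proof (rule prob_linked_relations[OF fin_family thin Z])
    fix S V assume S: "S \<in> \<S>" and "V \<in> {position_even c S}"
    moreover have "position_even c S \<subseteq> Pow S" by (auto simp: position_even_def)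
    moreover have "finite (Pow S)" using thin_finite[OF thin[OF S]] by simp
    ultimately show "V \<subseteq> Pow S \<and> finite V \<and> card V \<le> N"
      using V[OF S] by (auto intro: finite_subset)
  qed (use E in simp_all)
  also have "\<dots> \<le> 2 powr (real_of_int z / 1024 + 0 + real_of_int l / 1024
      + real_of_int (lg_up (d choose t)) / 1024 + x - real r * real (m + t))"
    using X lg_up[of "d choose t"] by (intro union_bound_powr[OF _ _ _ _ _ _ _ _ _ r]) simp_all
  finally show ?thesis by (simp add: add_divide_distrib)
qed

lemma prob_linked_even:
  assumes V: "\<And>S. S \<in> \<S> \<Longrightarrow> real (card (position_even c S)) \<le> 2 powr (real_of_int v / 1024)"
  shows "measure_pmf.prob p {w. linked c d w \<S> E t m}
    \<le> 2 powr (real_of_int (z + l + lg_up (d choose t) + int m * (lg_up d + v) - lg_fact m - 1024 * int r * int (m + t)) / 1024)"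
proof -
  define N where "N = nat \<lfloor>2 powr (real_of_int v / 1024)\<rfloor>"
  have "real N \<le> 2 powr (real_of_int v / 1024)" by (simp add: N_def)
  then have "2 powr (real_of_int (lg_up d) / 1024) * real N \<le> 2 powr (real_of_int (lg_up d) / 1024) * 2 powr (real_of_int v / 1024)"
    by (intro mult_left_mono) simp_all
  then have dN: "real (d * N) \<le> 2 powr (real_of_int (lg_up d + v) / 1024)"
    using lg_up_mult[of d N] by (simp add: powr_add[symmetric] add_divide_distrib)
  have V': "card (position_even c S) \<le> N" if "S \<in> \<S>" for S
    using V[OF that] by (simp add: N_def le_nat_floor)
  have "real (d * N choose m) \<le> real (d * N) ^ m / fact m" by (rule choose_le_pow_div_fact)
  also have "\<dots> \<le> 2 powr (real m * (real_of_int (lg_up d + v) / 1024) - real_of_int (lg_fact m) / 1024)"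
    by (rule pow_div_fact_le[OF dN lg_fact])
  finally have "measure_pmf.prob p {w. linked c d w \<S> E t m}
    \<le> 2 powr (real_of_int (z + l + lg_up (d choose t)) / 1024
       + (real m * (real_of_int (lg_up d + v) / 1024) - real_of_int (lg_fact m) / 1024) - real r * real (m + t))"
    using prob_linked_even_gen[OF V'] by blast
  also have "real_of_int (z + l + lg_up (d choose t)) / 1024
       + (real m * (real_of_int (lg_up d + v) / 1024) - real_of_int (lg_fact m) / 1024) - real r * real (m + t)
    = real_of_int (z + l + lg_up (d choose t) + int m * (lg_up d + v) - lg_fact m - 1024 * int r * int (m + t)) / 1024"
    by (simp add: add_divide_distrib diff_divide_distrib)
  finally show ?thesis .
qed

text \<open>\<open>K\<close> is enlarged to exactly 100 partial keys, or to all of them if there are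
  fewer. This leaves at most \<open>max 1 (N ^ 100 / fact 100)\<close> choices, where
  \<open>N\<close> bounds the number of partial keys, and \<open>4950 = 100 choose 2\<close>
  differences for each choice.\<close>

lemma prob_linked_keys_gen:
  assumes V: "\<And>S. S \<in> \<S> \<Longrightarrow> real (card (partial_keys c S)) \<le> 2 powr (real_of_int v / 1024)"
    and X: "real (4950 * d) ^ m / fact m \<le> 2 powr x"
  shows "measure_pmf.prob p {w. linked c d w \<S> E t m}
    \<le> 2 powr (real_of_int (z + l + lg_up (d choose t) + max 0 (100 * v - lg_fact 100)) / 1024 + x - real r * real (m + t))"
proof -
  define B where "B = 2 powr (real_of_int (max 0 (100 * v - lg_fact 100)) / 1024)"
  define \<K> where "\<K> S = (if card (partial_keys c S) < 100 then {partial_keys c S}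
      else {K. K \<subseteq> partial_keys c S \<and> card K = 100})" for S
  let ?ev = "{w. \<exists>S\<in>\<S>. \<exists>V\<in>key_relations ` \<K> S. \<exists>e\<in>E S. \<exists>J\<in>{J. J \<subseteq> {..<d} \<and> card J = t}.
      \<exists>G\<in>{G. G \<subseteq> {..<d} \<times> V \<and> card G = m}. G \<inter> J \<times> {e} = {} \<and>
        triangular (G \<union> J \<times> {e}) \<and> zero_relations w (G \<union> J \<times> {e})}"
  have finPK: "finite (partial_keys c S)" if "S \<in> \<S>" for S
    using thin_finite[OF thin[OF that]] by (simp add: partial_keys_def)
  have "{w. linked c d w \<S> E t m} \<subseteq> ?ev"
  proof (rule subsetI)
    fix w assume "w \<in> {w. linked c d w \<S> E t m}"
    then obtain S K e J G where *: "S \<in> \<S>" "K \<subseteq> partial_keys c S" "card K \<le> 100" "e \<in> E S" "J \<subseteq> {..<d}" "card J = t"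
      "G \<subseteq> {..<d} \<times> (position_even c S \<inter> key_relations K)" "card G = m" "G \<inter> J \<times> {e} = {}"
      "triangular (G \<union> J \<times> {e})" "zero_relations w (G \<union> J \<times> {e})"
      unfolding linked_def by blast
    have "\<exists>K'\<in>\<K> S. K \<subseteq> K'"
    proof (cases "card (partial_keys c S) < 100")
      case False
      then obtain K' where "K \<subseteq> K'" "K' \<subseteq> partial_keys c S" "card K' = 100"
        using exists_subset_between[OF *(3) _ *(2) finPK[OF *(1)]] by auto
      then show ?thesis using False by (auto simp: \<K>_def)
    qed (use *(2) in \<open>simp add: \<K>_def\<close>)
    then obtain K' where K': "K' \<in> \<K> S" "K \<subseteq> K'" by blast
    have "G \<subseteq> {..<d} \<times> key_relations K'" using *(7) key_relations_mono[OF K'(2)] by blast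
    then show "w \<in> ?ev" using * K'(1) by blast
  qed
  then have "measure_pmf.prob p {w. linked c d w \<S> E t m} \<le> measure_pmf.prob p ?ev"
    by (rule measure_pmf.finite_measure_mono) simp
  also have "\<dots> \<le> 2 powr (real_of_int z / 1024)
      * (B * (2 powr (real_of_int l / 1024) * (real (d choose t) * (real (d * 4950 choose m) * (1 / real psi) ^ (m + t)))))"
  proof (rule prob_linked_relations[OF fin_family thin Z])
    fix S assume S: "S \<in> \<S>"
    have "finite (\<K> S)" using finPK[OF S] by (simp add: \<K>_def)
    moreover have "real (card (\<K> S)) \<le> B"
    proof (cases "card (partial_keys c S) < 100")
      case True
      have "2 powr 0 \<le> B" unfolding B_def by (intro powr_mono) simp_all
      then show ?thesis using True by (simp add: \<K>_def)
    next
      case False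
      then have "real (card (\<K> S)) = real (card (partial_keys c S) choose 100)"
        using n_subsets[OF finPK[OF S], of 100] by (simp add: \<K>_def)
      also have "\<dots> \<le> real (card (partial_keys c S)) ^ 100 / fact 100" by (rule choose_le_pow_div_fact)
      also have "\<dots> \<le> 2 powr (real 100 * (real_of_int v / 1024) - real_of_int (lg_fact 100) / 1024)"
        by (rule pow_div_fact_le[OF V[OF S] lg_fact])
      also have "\<dots> \<le> B" unfolding B_def by (intro powr_mono) (simp_all add: max_def field_simps)
      finally show ?thesis .
    qed
    ultimately show "finite (key_relations ` \<K> S) \<and> real (card (key_relations ` \<K> S)) \<le> B"
      using card_image_le[of "\<K> S" key_relations] by (auto intro: order_trans)
    fix V assume "V \<in> key_relations ` \<K> S"
    then obtain K where K: "K \<in> \<K> S" "V = key_relations K" by blast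
    have sub: "K \<subseteq> partial_keys c S" "card K \<le> 100" using K(1) by (auto simp: \<K>_def split: if_splits)
    have finK: "finite K" using sub(1) finPK[OF S] by (rule finite_subset)
    have "V \<subseteq> Pow S"
    proof (rule subsetI)
      fix v assume "v \<in> V"
      then obtain x y where "v = char_diff x y" "x \<in> K" "y \<in> K" unfolding K(2) key_relations_def by blast
      moreover have "x \<subseteq> S" if "x \<in> K" for x using that sub(1) by (auto simp: partial_keys_def)
      ultimately show "v \<in> Pow S" unfolding char_diff_def by blast
    qed
    moreover have "card V \<le> 4950"
      using card_key_relations(2)[OF finK] choose_left_mono[OF sub(2), of 2] unfolding K(2)
      by (simp add: choose_two)
    ultimately show "V \<subseteq> Pow S \<and> finite V \<and> card V \<le> 4950"
      using card_key_relations(1)[OF finK] K(2) by simp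
  qed (use E in \<open>simp_all add: B_def\<close>)
  also have "\<dots> \<le> 2 powr (real_of_int z / 1024 + real_of_int (max 0 (100 * v - lg_fact 100)) / 1024 + real_of_int l / 1024
      + real_of_int (lg_up (d choose t)) / 1024 + x - real r * real (m + t))"
  proof (rule union_bound_powr[OF _ _ _ _ _ _ _ _ _ r])
    show "real (d * 4950 choose m) \<le> 2 powr x"
      using order_trans[OF choose_le_pow_div_fact X] by (simp add: mult.commute)
  qed (use lg_up[of "d choose t"] in \<open>simp_all add: B_def\<close>)
  finally show ?thesis by (simp add: add_divide_distrib add_ac)
qed

lemma prob_linked_keys:
  assumes V: "\<And>S. S \<in> \<S> \<Longrightarrow> real (card (partial_keys c S)) \<le> 2 powr (real_of_int v / 1024)"
  shows "measure_pmf.prob p {w. linked c d w \<S> E t m}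
    \<le> 2 powr (real_of_int (z + l + lg_up (d choose t) + max 0 (100 * v - lg_fact 100)
        + int m * lg_up (4950 * d) - lg_fact m - 1024 * int r * int (m + t)) / 1024)"
proof -
  have "real (4950 * d) ^ m / fact m
      \<le> 2 powr (real m * (real_of_int (lg_up (4950 * d)) / 1024) - real_of_int (lg_fact m) / 1024)"
    by (rule pow_div_fact_le[OF lg_up lg_fact])
  note prob_linked_keys_gen[OF V this]
  also have "real_of_int (z + l + lg_up (d choose t) + max 0 (100 * v - lg_fact 100)) / 1024
      + (real m * (real_of_int (lg_up (4950 * d)) / 1024) - real_of_int (lg_fact m) / 1024) - real r * real (m + t)
    = real_of_int (z + l + lg_up (d choose t) + max 0 (100 * v - lg_fact 100)
        + int m * lg_up (4950 * d) - lg_fact m - 1024 * int r * int (m + t)) / 1024"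
    by (simp add: add_divide_distrib diff_divide_distrib)
  finally show ?thesis .
qed

text \<open>Since \<open>x ^ m / m! \<le> exp x\<close>, the relation count is replaced by a geometric factor \<open>2 powr (- e * m)\<close>.\<close>

lemma prob_linked_keys_geometric:
  assumes V: "\<And>S. S \<in> \<S> \<Longrightarrow> real (card (partial_keys c S)) \<le> 2 powr (real_of_int v / 1024)"
  shows "measure_pmf.prob p {w. linked c d w \<S> E t m}
    \<le> 2 powr (real_of_int (z + l + lg_up (d choose t) + max 0 (100 * v - lg_fact 100)) / 1024
        + 3 * (real (4950 * d) * 2 ^ e / 2 ^ r) / 2 - real e * real m - real r * real t)"
proof -
  \<comment> \<open>Of the \<open>r\<close> bits gained by each relation, \<open>e\<close> are kept
    as decay and \<open>r - e\<close> pay for its choice; what remains of the count is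
    \<open>x ^ m / fact m\<close>.\<close>
  define x where "x = real (4950 * d) * 2 ^ e / 2 ^ r"
  have x: "real (4950 * d) = x * 2 powr (real r - real e)"
    by (simp add: x_def powr_diff powr_realpow)
  have "real (4950 * d) ^ m / fact m = (x ^ m / fact m) * 2 powr (real m * (real r - real e))"
    unfolding x by (simp add: power_mult_distrib powr_power)
  also have "\<dots> \<le> 2 powr (3 * x / 2) * 2 powr (real m * (real r - real e))"
    using power_div_fact_le_exp[of x m] exp_le_powr[of x] by (intro mult_right_mono) (simp_all add: x_def)
  also have "\<dots> = 2 powr (3 * x / 2 + real m * (real r - real e))" by (simp add: powr_add)
  finally have X: "real (4950 * d) ^ m / fact m \<le> 2 powr (3 * x / 2 + real m * (real r - real e))" .
  have "real_of_int (z + l + lg_up (d choose t) + max 0 (100 * v - lg_fact 100)) / 1024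
        + (3 * x / 2 + real m * (real r - real e)) - real r * real (m + t)
      = real_of_int (z + l + lg_up (d choose t) + max 0 (100 * v - lg_fact 100)) / 1024
        + 3 * x / 2 - real e * real m - real r * real t"
    by (simp add: algebra_simps)
  moreover have "measure_pmf.prob p {w. linked c d w \<S> E t m}
    \<le> 2 powr (real_of_int (z + l + lg_up (d choose t) + max 0 (100 * v - lg_fact 100)) / 1024
        + (3 * x / 2 + real m * (real r - real e)) - real r * real (m + t))"
    using V X by (rule prob_linked_keys_gen)
  ultimately show ?thesis unfolding x_def[symmetric] by metis
qed

end

end

section \<open>Exponents for sets of given size or type\<close>

text \<open>An upper bound for 1024 times the logarithm of \<open>(c * 2 ^ q) ^ s / fact s\<close>,
  which bounds the number of sets of \<open>s\<close> position characters.\<close>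

definition size_exp :: "nat \<Rightarrow> nat \<Rightarrow> nat \<Rightarrow> int" where
  "size_exp c q s = 1024 * int q * int s + int s * lg_up c - lg_fact s"

text \<open>The analogous exponent for \<open>a\<close> characters in one given position and
  \<open>b\<close> in the \<open>c - 1\<close> others.\<close>

definition type_exp :: "nat \<Rightarrow> nat \<Rightarrow> nat \<Rightarrow> nat \<Rightarrow> int" where
  "type_exp c q a b = 1024 * int q * int (a + b) + int b * lg_up (c - 1) - lg_fact a - lg_fact b"

definition even_exp :: "nat \<Rightarrow> nat \<Rightarrow> nat \<Rightarrow> int \<Rightarrow> nat \<Rightarrow> int \<Rightarrow> int" where
  "even_exp d r t z m v = z + lg_up (d choose t) + int m * (lg_up d + v) - lg_fact m - 1024 * int r * int (m + t)"

definition key_exp :: "nat \<Rightarrow> nat \<Rightarrow> nat \<Rightarrow> int \<Rightarrow> nat \<Rightarrow> int \<Rightarrow> int" where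
  "key_exp d r t z m v = z + lg_up (d choose t) + max 0 (100 * v - lg_fact 100)
     + int m * lg_up (4950 * d) - lg_fact m - 1024 * int r * int (m + t)"

definition size_bound :: "nat \<Rightarrow> nat \<Rightarrow> nat \<Rightarrow> nat \<Rightarrow> nat \<Rightarrow> int \<Rightarrow> nat \<Rightarrow> nat \<Rightarrow> int" where
  "size_bound c d q r t l m s =
     min (even_exp d r t (size_exp c q s + l) m (even_bound c s)) (key_exp d r t (size_exp c q s + l) m (key_bound c s))"

text \<open>The summand \<open>2 * lg_up a - 1024\<close> stands for \<open>a ^ 2 / 2\<close>, a
  bound on the pairs within the distinguished fiber.\<close>

definition type_bound :: "nat \<Rightarrow> nat \<Rightarrow> nat \<Rightarrow> nat \<Rightarrow> nat \<Rightarrow> nat \<Rightarrow> nat \<Rightarrow> nat \<Rightarrow> int" where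
  "type_bound c d q r t m a b = (let z = type_exp c q a b + 2 * lg_up a - 1024 in
     min (even_exp d r t z m (lg_up (even_poly a) + even_bound (c - 1) b))
         (key_exp d r t z m (lg_up (Suc a) + key_bound (c - 1) b)))"

definition pairs :: "(nat \<times> nat) set \<Rightarrow> (nat \<times> nat) set set" where
  "pairs S = {e. e \<subseteq> S \<and> card e = 2}"

definition fiber_pairs :: "nat \<Rightarrow> (nat \<times> nat) set \<Rightarrow> (nat \<times> nat) set set" where
  "fiber_pairs i S = {e. e \<subseteq> {i} \<times> fiber i S \<and> card e = 2}"

lemma card_pairs_le:
  assumes "finite S"
  shows "finite {e. e \<subseteq> S \<and> card e = 2}"
    "real (card {e. e \<subseteq> S \<and> card e = 2}) \<le> 2 powr (real_of_int (2 * lg_up (card S) - 1024) / 1024)"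
proof -
  show "finite {e. e \<subseteq> S \<and> card e = 2}" using assms by simp
  have "real (card {e. e \<subseteq> S \<and> card e = 2}) = real (card S choose 2)"
    using n_subsets[OF assms, of 2] by simp
  also have "\<dots> \<le> real (card S) ^ 2 / fact 2" by (rule choose_le_pow_div_fact)
  also have "\<dots> \<le> 2 powr (real 2 * (real_of_int (lg_up (card S)) / 1024) - 1)"
    by (rule pow_div_fact_le[OF lg_up]) simp
  finally show "real (card {e. e \<subseteq> S \<and> card e = 2}) \<le> 2 powr (real_of_int (2 * lg_up (card S) - 1024) / 1024)"
    by (simp add: diff_divide_distrib)
qed

context random_tab
begin

definition sets_of_size :: "nat \<Rightarrow> (nat \<times> nat) set set" where
  "sets_of_size s = {S. thin S \<and> card S = s}"

definition sets_of_type :: "nat \<Rightarrow> nat \<Rightarrow> nat \<Rightarrow> (nat \<times> nat) set set" where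
  "sets_of_type i a b = {S. thin S \<and> card (fiber i S) = a \<and> card S = a + b}"

lemma thin_sub: "thin S \<Longrightarrow> S \<subseteq> {..<c} \<times> UNIV"
  by (auto simp: thin_def chars_def)

lemma thin_fibers: "thin S \<Longrightarrow> (\<Sum>i<c. card (fiber i S)) = card S"
  by (rule card_fibers) (simp add: thin_def)

lemma card_thin_le: "thin S \<Longrightarrow> card S \<le> c * k"
  using sum_mono[of "{..<c}" "\<lambda>i. card (fiber i S)" "\<lambda>_. k"] thin_fibers[of S] by (simp add: thin_def)

lemma position_even_prod: "thin S \<Longrightarrow> real (card (position_even c S)) \<le> real (\<Prod>i<c. even_poly (card (fiber i S)))"
  using card_position_even[OF thin_finite thin_sub, of S] by (simp only: even_poly_choose of_nat_le_iff)

lemma partial_keys_prod: "thin S \<Longrightarrow> real (card (partial_keys c S)) \<le> real (\<Prod>i<c. 1 + card (fiber i S))"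
  using card_partial_keys[OF thin_finite thin_sub, of S] by (simp only: of_nat_le_iff)

context
  fixes q r :: nat
  assumes q: "phi = 2 ^ q" and r: "psi = 2 ^ r"
begin

lemma chars_choose_le:
  assumes y: "2 powr (real_of_int f / 1024) \<le> fact s"
  shows "real (l * phi choose s) \<le> 2 powr (real_of_int (1024 * int q * int s + int s * lg_up l - f) / 1024)"
proof -
  have "real (l * phi) \<le> 2 powr (real_of_int (lg_up l) / 1024) * real phi" by (rule lg_up_mult)
  also have "real phi = 2 powr real q" by (simp add: q powr_realpow)
  finally have "real (l * phi) \<le> 2 powr (real_of_int (lg_up l) / 1024 + real q)" by (simp add: powr_add)
  from pow_div_fact_le[OF this y]
  have "real (l * phi choose s)
    \<le> 2 powr (real s * (real_of_int (lg_up l) / 1024 + real q) - real_of_int f / 1024)"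
    using choose_le_pow_div_fact[of "l * phi" s] by (meson order_trans)
  then show ?thesis by (simp add: add_divide_distrib diff_divide_distrib algebra_simps)
qed

lemma card_sets_of_size_gen:
  assumes y: "2 powr (real_of_int f / 1024) \<le> fact s"
  shows "real (card (sets_of_size s)) \<le> 2 powr (real_of_int (1024 * int q * int s + int s * lg_up c - f) / 1024)"
proof -
  have "card (sets_of_size s) \<le> card {S. S \<subseteq> chars \<and> card S = s}"
    using finite_chars by (intro card_mono) (auto simp: sets_of_size_def thin_def)
  also have "\<dots> = c * phi choose s"
    using n_subsets[OF finite_chars, of s] by (simp add: chars_def card_cartesian_product)
  finally have "real (card (sets_of_size s)) \<le> real (c * phi choose s)" by simp
  then show ?thesis using chars_choose_le[OF y, of c] by (rule order_trans)
qed

lemma card_sets_of_size: "real (card (sets_of_size s)) \<le> 2 powr (real_of_int (size_exp c q s) / 1024)"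
  using card_sets_of_size_gen[OF lg_fact, of s] by (simp add: size_exp_def)

lemma card_sets_of_type:
  assumes i: "i < c"
  shows "real (card (sets_of_type i a b)) \<le> 2 powr (real_of_int (type_exp c q a b) / 1024)"
proof -
  define R where "R = {i} \<times> {..<phi}"
  have Rc: "R \<subseteq> chars" using i by (auto simp: R_def chars_def)
  have finR: "finite R" by (simp add: R_def)
  have cardR: "card R = phi" by (simp add: R_def)
  have cardC: "card (chars - R) = (c - 1) * phi"
    using card_Diff_subset[OF finR Rc] cardR by (simp add: chars_def card_cartesian_product diff_mult_distrib)
  let ?W = "{T. T \<subseteq> R \<and> card T = a} \<times> {T. T \<subseteq> chars - R \<and> card T = b}"
  have inj: "inj_on (\<lambda>S. (S \<inter> R, S - R)) (sets_of_type i a b)"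
    by (rule inj_onI) blast
  have sub: "(\<lambda>S. (S \<inter> R, S - R)) ` sets_of_type i a b \<subseteq> ?W"
  proof (rule image_subsetI)
    fix S assume "S \<in> sets_of_type i a b"
    then have S: "thin S" "card (fiber i S) = a" "card S = a + b" by (auto simp: sets_of_type_def)
    have Sc: "S \<subseteq> chars" using S(1) by (simp add: thin_def)
    have "S \<inter> R = Pair i ` fiber i S"
      using Sc unfolding R_def fiber_def chars_def by blast
    moreover have "inj_on (Pair i) (fiber i S)" by (simp add: inj_on_def)
    ultimately have cS: "card (S \<inter> R) = a" using S(2) by (simp add: card_image)
    have "card (S - R) = card S - card (S \<inter> R)"
      using card_Diff_subset_Int[of S R] finite_subset[OF _ finR, of "S \<inter> R"] by simp
    then have "card (S - R) = b" using cS S(3) by simp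
    moreover have "S \<inter> R \<subseteq> R" "S - R \<subseteq> chars - R" using Sc by auto
    ultimately show "(S \<inter> R, S - R) \<in> ?W" using cS by simp
  qed
  have finW: "finite ?W" using finR finite_chars by simp
  have "card (sets_of_type i a b) \<le> card ?W"
    using card_image[OF inj] card_mono[OF finW sub] by simp
  also have "\<dots> = (phi choose a) * ((c - 1) * phi choose b)"
    using n_subsets[OF finR, of a] n_subsets[of "chars - R" b] finite_chars cardR cardC
    by (simp add: card_cartesian_product)
  finally have "real (card (sets_of_type i a b)) \<le> real (phi choose a) * real ((c - 1) * phi choose b)"
    by (metis of_nat_le_iff of_nat_mult)
  also have "\<dots> \<le> 2 powr (real_of_int (1024 * int q * int a - lg_fact a) / 1024)
     * 2 powr (real_of_int (1024 * int q * int b + int b * lg_up (c - 1) - lg_fact b) / 1024)"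
  proof (intro mult_mono)
    have "real phi \<le> 2 powr real q" by (simp add: q powr_realpow)
    from pow_div_fact_le[OF this lg_fact, of a]
    have "real (phi choose a) \<le> 2 powr (real a * real q - real_of_int (lg_fact a) / 1024)"
      using choose_le_pow_div_fact[of phi a] by (meson order_trans)
    then show "real (phi choose a) \<le> 2 powr (real_of_int (1024 * int q * int a - lg_fact a) / 1024)"
      by (simp add: diff_divide_distrib mult.commute)
  qed (use chars_choose_le[OF lg_fact, of "c - 1" b] in simp_all)
  also have "\<dots> = 2 powr (real_of_int (type_exp c q a b) / 1024)"
    by (simp add: type_exp_def powr_add[symmetric] add_divide_distrib[symmetric] algebra_simps)
  finally show ?thesis .
qed

lemma prob_size:
  assumes E: "\<And>S. S \<in> sets_of_size s \<Longrightarrow> finite (E S) \<and> real (card (E S)) \<le> 2 powr (real_of_int l / 1024) \<and> E S \<subseteq> Pow S"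
  shows "measure_pmf.prob p {w. linked c d w (sets_of_size s) E t m}
    \<le> 2 powr (real_of_int (size_bound c d q r t l m s) / 1024)"
proof -
  have thin: "thin S" if "S \<in> sets_of_size s" for S using that by (simp add: sets_of_size_def)
  have sum: "(\<Sum>i<c. card (fiber i S)) = s" if "S \<in> sets_of_size s" for S
    using that thin_fibers by (simp add: sets_of_size_def)
  have v: "real (card (position_even c S)) \<le> 2 powr (real_of_int (even_bound c s) / 1024)" if "S \<in> sets_of_size s" for S
    using position_even_prod[OF thin[OF that]] prod_even_poly_le[OF _ _ c sum[OF that]] by simp
  have kb: "real (card (partial_keys c S)) \<le> 2 powr (real_of_int (key_bound c s) / 1024)" if "S \<in> sets_of_size s" for S
    using partial_keys_prod[OF thin[OF that]] prod_keys_le[OF _ _ c sum[OF that]] by simp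
  have "measure_pmf.prob p {w. linked c d w (sets_of_size s) E t m}
    \<le> 2 powr (real_of_int (even_exp d r t (size_exp c q s + l) m (even_bound c s)) / 1024)"
    using prob_linked_even[OF thin card_sets_of_size E r v] by (simp add: even_exp_def)
  moreover have "measure_pmf.prob p {w. linked c d w (sets_of_size s) E t m}
    \<le> 2 powr (real_of_int (key_exp d r t (size_exp c q s + l) m (key_bound c s)) / 1024)"
    using prob_linked_keys[OF thin card_sets_of_size E r kb] by (simp add: key_exp_def)
  ultimately show ?thesis by (simp add: size_bound_def min_def)
qed

lemma prob_type:
  assumes i: "i < c" and c2: "2 \<le> c"
  shows "measure_pmf.prob p {w. linked c d w (sets_of_type i a b) (fiber_pairs i) t m}
    \<le> 2 powr (real_of_int (type_bound c d q r t m a b) / 1024)"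
proof -
  let ?S = "sets_of_type i a b"
  have thin: "thin S" if "S \<in> ?S" for S using that by (simp add: sets_of_type_def)
  have a: "card (fiber i S) = a" if "S \<in> ?S" for S using that by (simp add: sets_of_type_def)
  let ?I = "{..<c} - {i}"
  have I: "finite ?I" "card ?I = c - 1" "0 < c - 1" using i c2 by simp_all
  have sum: "(\<Sum>l\<in>?I. card (fiber l S)) = b" if "S \<in> ?S" for S
    using thin_fibers[OF thin[OF that]] a[OF that] that i
      sum.remove[of "{..<c}" i "\<lambda>l. card (fiber l S)"] by (simp add: sets_of_type_def)
  have split: "real (\<Prod>l<c. f (card (fiber l S))) = real (f a) * real (\<Prod>l\<in>?I. f (card (fiber l S)))"
    if "S \<in> ?S" for S and f :: "nat \<Rightarrow> nat"
    using prod.remove[of "{..<c}" i "\<lambda>l. f (card (fiber l S))"] i a[OF that] by simp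
  have v: "real (card (position_even c S)) \<le> 2 powr (real_of_int (lg_up (even_poly a) + even_bound (c - 1) b) / 1024)"
    if S: "S \<in> ?S" for S
  proof -
    have "real (card (position_even c S)) \<le> real (even_poly a) * real (\<Prod>l\<in>?I. even_poly (card (fiber l S)))"
      using position_even_prod[OF thin[OF S]] split[OF S, of even_poly] by linarith
    also have "\<dots> \<le> 2 powr (real_of_int (lg_up (even_poly a)) / 1024) * 2 powr (real_of_int (even_bound (c - 1) b) / 1024)"
      by (intro mult_mono lg_up prod_even_poly_le[OF I sum[OF S]]) (simp_all add: prod_nonneg)
    finally show ?thesis by (simp add: powr_add[symmetric] add_divide_distrib)
  qed
  have kb: "real (card (partial_keys c S)) \<le> 2 powr (real_of_int (lg_up (Suc a) + key_bound (c - 1) b) / 1024)"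
    if S: "S \<in> ?S" for S
  proof -
    have "real (card (partial_keys c S)) \<le> real (Suc a) * real (\<Prod>l\<in>?I. 1 + card (fiber l S))"
      using partial_keys_prod[OF thin[OF S]] split[OF S, of "\<lambda>x. 1 + x"] by simp
    also have "\<dots> \<le> 2 powr (real_of_int (lg_up (Suc a)) / 1024) * 2 powr (real_of_int (key_bound (c - 1) b) / 1024)"
      by (intro mult_mono lg_up prod_keys_le[OF I sum[OF S]]) (simp_all add: prod_nonneg)
    finally show ?thesis by (simp add: powr_add[symmetric] add_divide_distrib)
  qed
  have E: "finite (fiber_pairs i S) \<and> real (card (fiber_pairs i S)) \<le> 2 powr (real_of_int (2 * lg_up a - 1024) / 1024)
      \<and> fiber_pairs i S \<subseteq> Pow S" if S: "S \<in> ?S" for S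
  proof -
    have fin: "finite ({i} \<times> fiber i S)" using finite_fiber[OF thin_finite[OF thin[OF S]]] by simp
    have "card ({i} \<times> fiber i S) = a" using a[OF S] by (simp add: card_cartesian_product)
    moreover have "{i} \<times> fiber i S \<subseteq> S" by (auto simp: fiber_def)
    then have "fiber_pairs i S \<subseteq> Pow S" unfolding fiber_pairs_def by blast
    ultimately show ?thesis using card_pairs_le[OF fin] by (simp add: fiber_pairs_def)
  qed
  have "measure_pmf.prob p {w. linked c d w ?S (fiber_pairs i) t m}
    \<le> 2 powr (real_of_int (even_exp d r t (type_exp c q a b + (2 * lg_up a - 1024)) m (lg_up (even_poly a) + even_bound (c - 1) b)) / 1024)"
    using prob_linked_even[OF thin card_sets_of_type[OF i] E r v] by (simp add: even_exp_def)
  moreover have "measure_pmf.prob p {w. linked c d w ?S (fiber_pairs i) t m}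
    \<le> 2 powr (real_of_int (key_exp d r t (type_exp c q a b + (2 * lg_up a - 1024)) m (lg_up (Suc a) + key_bound (c - 1) b)) / 1024)"
    using prob_linked_keys[OF thin card_sets_of_type[OF i] E r kb] by (simp add: key_exp_def)
  ultimately show ?thesis by (simp add: type_bound_def Let_def min_def add_diff_eq)
qed

text \<open>The relations of one pair in \<open>Suc M\<close> outputs share their pivot, but each
  output occurs only once, so they form a triangular system.\<close>

lemma prob_pair_collisions:
  "measure_pmf.prob p {w. \<exists>i<c. \<exists>a b. a \<noteq> b \<and> a < phi \<and> b < phi \<and> M < card {j. j < d \<and> xor_sum w j {(i, a), (i, b)} = 0}}
    \<le> real (c * (phi choose 2) * (d choose Suc M)) * (1 / real psi) ^ Suc M" if k2: "2 \<le> k"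
proof -
  define Es where "Es = (\<Union>i<c. {e. e \<subseteq> {i} \<times> {..<phi} \<and> card e = 2})"
  define \<G> where "\<G> = (\<lambda>(e, J). J \<times> {e}) ` (Es \<times> {J. J \<subseteq> {..<d} \<and> card J = Suc M})"
  have finE: "finite Es" by (simp add: Es_def)
  have "card Es \<le> (\<Sum>i<c. card {e. e \<subseteq> {i} \<times> {..<phi} \<and> card e = 2})"
    unfolding Es_def by (rule card_UN_le) simp
  also have "\<dots> = c * (phi choose 2)"
    using n_subsets[of "{i :: nat} \<times> {..<phi}" 2 for i] by (simp add: card_cartesian_product)
  finally have cardE: "card Es \<le> c * (phi choose 2)" .
  have finJ: "finite {J. J \<subseteq> {..<d} \<and> card J = Suc M}" by simp
  have "card \<G> \<le> card Es * card {J. J \<subseteq> {..<d} \<and> card J = Suc M}"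
    unfolding \<G>_def card_cartesian_product[symmetric] using finE finJ by (intro card_image_le) simp
  also have "\<dots> \<le> c * (phi choose 2) * (d choose Suc M)"
    using cardE n_subsets[of "{..<d}" "Suc M"] by simp
  finally have cardG: "real (card \<G>) \<le> real (c * (phi choose 2) * (d choose Suc M))" by (simp only: of_nat_le_iff)
  have "{w. \<exists>i<c. \<exists>a b. a \<noteq> b \<and> a < phi \<and> b < phi \<and> M < card {j. j < d \<and> xor_sum w j {(i, a), (i, b)} = 0}}
    \<subseteq> {w. \<exists>G\<in>\<G>. triangular G \<and> zero_relations w G}"
  proof (rule subsetI)
    fix w assume "w \<in> {w. \<exists>i<c. \<exists>a b. a \<noteq> b \<and> a < phi \<and> b < phi \<and> M < card {j. j < d \<and> xor_sum w j {(i, a), (i, b)} = 0}}"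
    then obtain i a b where *: "i < c" "a \<noteq> b" "a < phi" "b < phi"
      "M < card {j. j < d \<and> xor_sum w j {(i, a), (i, b)} = 0}" by blast
    from *(5) obtain J where J: "J \<subseteq> {j. j < d \<and> xor_sum w j {(i, a), (i, b)} = 0}" "card J = Suc M"
      by (meson Suc_leI obtain_subset_with_card_n)
    let ?e = "{(i, a), (i, b)}"
    have "?e \<in> Es" using * by (auto simp: Es_def)
    moreover have "J \<subseteq> {..<d}" using J(1) by auto
    ultimately have "J \<times> {?e} \<in> \<G>" using J(2) unfolding \<G>_def by (intro image_eqI[of _ _ "(?e, J)"]) auto
    moreover have "zero_relations w (J \<times> {?e})" using J(1) by (auto simp: zero_relations_def)
    moreover have "triangular (J \<times> {?e})"
      unfolding triangular_def
      by (rule exI[of _ "\<lambda>\<beta>. if \<beta> = (i, a) then 1 else 0"], rule exI[of _ "\<lambda>_ _. (i, a)"])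
        (auto simp: inj_on_def)
    ultimately show "w \<in> {w. \<exists>G\<in>\<G>. triangular G \<and> zero_relations w G}" by blast
  qed
  then have "measure_pmf.prob p {w. \<exists>i<c. \<exists>a b. a \<noteq> b \<and> a < phi \<and> b < phi \<and> M < card {j. j < d \<and> xor_sum w j {(i, a), (i, b)} = 0}}
    \<le> measure_pmf.prob p {w. \<exists>G\<in>\<G>. triangular G \<and> zero_relations w G}"
    by (rule measure_pmf.finite_measure_mono) simp
  also have "\<dots> \<le> real (card \<G>) * (1 / real psi) ^ Suc M"
  proof (rule prob_exists_relations)
    show "finite \<G>" unfolding \<G>_def using finE finJ by simp
    fix G assume "G \<in> \<G>"
    then obtain e J where G: "G = J \<times> {e}" "e \<in> Es" "J \<subseteq> {..<d}" "card J = Suc M" by (auto simp: \<G>_def)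
    then obtain i where e: "i < c" "e \<subseteq> {i} \<times> {..<phi}" "card e = 2" by (auto simp: Es_def)
    have fe: "finite e" using e(3) by (metis card.infinite zero_neq_numeral)
    have "card (fiber l e) \<le> k" for l
    proof -
      have "fiber l e \<subseteq> snd ` e" by (force simp: fiber_def)
      then have "card (fiber l e) \<le> card (snd ` e)" using fe by (intro card_mono) simp_all
      also have "\<dots> \<le> 2" using card_image_le[OF fe, of snd] e(3) by simp
      finally show ?thesis using k2 by simp
    qed
    moreover have "e \<subseteq> chars" using e(1,2) by (auto simp: chars_def)
    ultimately have "thin e" by (simp add: thin_def)
    moreover have "\<Union> (snd ` G) \<subseteq> e" unfolding G(1) by auto
    ultimately have "thin (\<Union> (snd ` G))" by (rule thin_mono)
    moreover have "finite J" using G(3) by (rule finite_subset) simp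
    moreover have "fst ` G \<subseteq> {..<d}" using G(1,3) by auto
    ultimately show "finite G \<and> fst ` G \<subseteq> {..<d} \<and> thin (\<Union> (snd ` G)) \<and> card G = Suc M"
      using G(1,4) by (simp add: card_cartesian_product)
  qed
  also have "\<dots> \<le> real (c * (phi choose 2) * (d choose Suc M)) * (1 / real psi) ^ Suc M"
    using cardG by (rule mult_right_mono) simp
  finally show ?thesis .
qed

end

end

section \<open>Reduction of non-uniqueness to events of given size or type\<close>

definition ceil_div :: "nat \<Rightarrow> nat \<Rightarrow> nat" where "ceil_div x y = (x + (y - 1)) div y"

lemma ceil_div_le: "x \<le> y * g \<Longrightarrow> 0 < y \<Longrightarrow> ceil_div x y \<le> g"
proof -
  assume "x \<le> y * g" "0 < y"
  then have "x + (y - 1) < Suc g * y" by (simp add: mult.commute)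
  then have "(x + (y - 1)) div y < Suc g" by (rule less_mult_imp_div_less)
  then show ?thesis by (simp only: ceil_div_def less_Suc_eq_le)
qed

lemma le_ceil_div: "0 < y \<Longrightarrow> x \<le> y * ceil_div x y"
proof -
  assume y: "0 < y"
  have "x + (y - 1) = y * ceil_div x y + (x + (y - 1)) mod y" unfolding ceil_div_def by simp
  moreover have "(x + (y - 1)) mod y \<le> y - 1" using mod_less_divisor[OF y, of "x + (y - 1)"] by linarith
  ultimately show ?thesis by linarith
qed

text \<open>The special case excludes equality. If three characters occupy all three positions, they
  carry no relation at all, so the strict inequality holds; this gains one relation when
  \<open>d * s\<close> is divisible by \<open>2 * c\<close>, as for \<open>c = 3\<close> and
  \<open>d = 24\<close>.\<close>

definition rank_single :: "nat \<Rightarrow> nat \<Rightarrow> nat \<Rightarrow> nat" where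
  "rank_single c d s = (if c = 3 \<and> s = 3 then d * s div (2 * c) + 1 else ceil_div (d * s) (2 * c))"

text \<open>The final subtraction removes the \<open>t\<close> relations of the pair, which are
  enumerated separately.\<close>

definition rank_type :: "nat \<Rightarrow> nat \<Rightarrow> nat \<Rightarrow> nat \<Rightarrow> nat \<Rightarrow> nat" where
  "rank_type c d t a b = ceil_div ((c - 1) * t * a + (d - t) * b) (2 * (c - 1)) - t"

text \<open>The worst case over all types of size \<open>s\<close>: only the pair lies in its
  position, \<open>a = 2\<close>, and its price is used up by its own \<open>t\<close>
  relations.\<close>

definition rank_size :: "nat \<Rightarrow> nat \<Rightarrow> nat \<Rightarrow> nat \<Rightarrow> nat" where
  "rank_size c d t s = ceil_div ((d - t) * (s - 2)) (2 * (c - 1))"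

lemma linked_mono:
  assumes "linked c d w \<S> E t m" "m' \<le> m" "\<S> \<subseteq> \<S>'" "\<And>S. S \<in> \<S> \<Longrightarrow> E S \<subseteq> E' S"
  shows "linked c d w \<S>' E' t m'"
proof -
  obtain S K e J G where *: "S \<in> \<S>" "K \<subseteq> partial_keys c S" "finite K" "card K \<le> 100" "e \<in> E S" "J \<subseteq> {..<d}" "card J = t"
    "G \<subseteq> {..<d} \<times> (position_even c S \<inter> key_relations K)" "card G = m" "G \<inter> J \<times> {e} = {}"
    "triangular (G \<union> J \<times> {e})" "zero_relations w (G \<union> J \<times> {e})"
    using assms(1) unfolding linked_def by blast
  obtain G' where G': "G' \<subseteq> G" "card G' = m'"
    using obtain_subset_with_card_n[of m' G] *(9) assms(2) by metis
  have sub: "G' \<union> J \<times> {e} \<subseteq> G \<union> J \<times> {e}" using G'(1) by (rule Un_mono) simp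
  have "G' \<inter> J \<times> {e} = {}" using G'(1) *(10) by blast
  moreover have "G' \<subseteq> {..<d} \<times> (position_even c S \<inter> key_relations K)" using G'(1) *(8) by (rule order_trans)
  moreover have "S \<in> \<S>'" "e \<in> E' S" using assms(3,4) *(1,5) by auto
  ultimately show ?thesis
    unfolding linked_def
    using *(2,3,4,6,7) G'(2) triangular_subset[OF *(11) sub] zero_relations_subset[OF *(12) sub] by metis
qed

text \<open>Since \<open>d - t \<le> (c - 1) * t\<close>, a character in the raised position demands
  at least as many relations as one elsewhere, so \<open>a = 2\<close> demands the fewest.\<close>

lemma rank_type_ge_size:
  assumes c: "2 \<le> c" and t: "d \<le> c * t" "t \<le> d" and a: "2 \<le> a"
  shows "rank_size c d t (a + b) \<le> rank_type c d t a b"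
proof -
  let ?y = "2 * (c - 1)"
  have dt: "d - t \<le> (c - 1) * t" using t by (simp add: diff_mult_distrib)
  obtain a' where a': "a = a' + 2" using a by (metis add.commute le_Suc_ex)
  have "(d - t) * (a + b - 2) + ?y * t \<le> (c - 1) * t * a + (d - t) * b"
  proof -
    have "u * (a + b - 2) + 2 * v \<le> v * a + u * b" if "u \<le> v" for u v :: nat
      using mult_right_mono[OF that, of a'] by (simp add: a' algebra_simps)
    from this[OF dt] show ?thesis by (simp only: mult.assoc)
  qed
  also have "\<dots> \<le> ?y * ceil_div ((c - 1) * t * a + (d - t) * b) ?y" using c by (intro le_ceil_div) simp
  finally have le: "(d - t) * (a + b - 2) + ?y * t \<le> ?y * ceil_div ((c - 1) * t * a + (d - t) * b) ?y" .
  then have "?y * t \<le> ?y * ceil_div ((c - 1) * t * a + (d - t) * b) ?y" by linarith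
  then have "t \<le> ceil_div ((c - 1) * t * a + (d - t) * b) ?y" using c by simp
  then have "(d - t) * (a + b - 2) \<le> ?y * (ceil_div ((c - 1) * t * a + (d - t) * b) ?y - t)"
    using le unfolding diff_mult_distrib2[of ?y] by linarith
  then show ?thesis unfolding rank_size_def rank_type_def using c by (intro ceil_div_le) simp_all
qed

lemma simple_tab_less:
  assumes "\<And>i. i < c \<Longrightarrow> w i (x i) j < 2 ^ r"
  shows "simple_tab w c x j < 2 ^ r"
proof -
  have "foldr (\<lambda>i acc. xor (w i (x i) j) acc) xs 0 < 2 ^ r" if "set xs \<subseteq> {..<c}" for xs
    using that
  proof (induction xs)
    case (Cons i xs)
    then have "w i (x i) j < 2 ^ r" "foldr (\<lambda>i acc. xor (w i (x i) j) acc) xs 0 < 2 ^ r"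
      using assms by auto
    then show ?case using nat_xor_less by simp
  qed simp
  from this[of "[0..<c]"] show ?thesis by (simp add: simple_tab_def subset_iff)
qed

text \<open>With a single character per position no fiber has two elements, and a nonempty subset
  has a fiber of one element.\<close>

lemma position_even_transversal:
  assumes "finite S" "card (fst ` S) = card S" "fst ` S = {..<c}"
  shows "position_even c S = {}"
proof (rule ccontr)
  assume "position_even c S \<noteq> {}"
  then obtain v where v: "v \<subseteq> S" "v \<noteq> {}" "\<forall>i<c. card (fiber i v) \<in> {0, 2}" by (auto simp: position_even_def)
  have inj: "inj_on fst S" using assms(1,2) by (simp add: eq_card_imp_inj_on)
  obtain i a where ia: "(i, a) \<in> v" using v(2) by force
  then have i: "i < c" using v(1) assms(3) by (metis fst_conv image_eqI lessThan_iff subsetD)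
  have "fiber i v = {a}"
  proof
    show "{a} \<subseteq> fiber i v" using ia by (simp add: fiber_def)
    show "fiber i v \<subseteq> {a}"
    proof
      fix b assume "b \<in> fiber i v"
      then have "(i, b) \<in> S" "(i, a) \<in> S" using v(1) ia by (auto simp: fiber_def)
      then show "b \<in> {a}" using inj_onD[OF inj, of "(i, b)" "(i, a)"] by simp
    qed
  qed
  then show False using v(3) i by (metis One_nat_def card.empty card_insert_disjoint empty_iff finite.emptyI insert_iff numeral_2_eq_2 n_not_Suc_n zero_neq_one)
qed

context random_tab
begin

definition pair_collision :: "nat \<Rightarrow> (nat \<Rightarrow> nat \<Rightarrow> nat \<Rightarrow> nat) \<Rightarrow> bool" where
  "pair_collision M w \<longleftrightarrow> (\<exists>i<c. \<exists>a b. a \<noteq> b \<and> a < phi \<and> b < phi \<and> M < card {j. j < d \<and> xor_sum w j {(i, a), (i, b)} = 0})"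

definition single_event :: "nat \<Rightarrow> (nat \<Rightarrow> nat \<Rightarrow> nat \<Rightarrow> nat) \<Rightarrow> bool" where
  "single_event s w \<longleftrightarrow> linked c d w (sets_of_size s) (\<lambda>_. {{}}) 0 (rank_single c d s)"

definition type_event :: "nat \<Rightarrow> nat \<Rightarrow> nat \<Rightarrow> nat \<Rightarrow> (nat \<Rightarrow> nat \<Rightarrow> nat \<Rightarrow> nat) \<Rightarrow> bool" where
  "type_event t i a b w \<longleftrightarrow> linked c d w (sets_of_type i a b) (fiber_pairs i) t (rank_type c d t a b)"

definition size_event :: "nat \<Rightarrow> nat \<Rightarrow> (nat \<Rightarrow> nat \<Rightarrow> nat \<Rightarrow> nat) \<Rightarrow> bool" where
  "size_event t s w \<longleftrightarrow> linked c d w (sets_of_size s) pairs t (rank_size c d t s)"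

lemma type_event_imp_size_event:
  assumes "type_event t i a b w" "2 \<le> c" "d \<le> c * t" "t \<le> d" "2 \<le> a"
  shows "size_event t (a + b) w"
  unfolding size_event_def
proof (rule linked_mono[OF assms(1)[unfolded type_event_def] rank_type_ge_size[OF assms(2-5)]])
  show "sets_of_type i a b \<subseteq> sets_of_size (a + b)" by (auto simp: sets_of_type_def sets_of_size_def)
  fix S show "fiber_pairs i S \<subseteq> pairs S" by (auto simp: fiber_pairs_def pairs_def fiber_def)
qed

text \<open>The deterministic part: outside the null event and the pair collisions, a bad table lies
  in one of finitely many events, indexed by a size or by a type together with \<open>t\<close> and
  a position.\<close>

lemma not_unique_events:
  assumes k100: "k = 100" and r: "psi = 2 ^ r" and c2: "2 \<le> c" and d0: "0 < d"
    and bad: "\<not> k_unique phi psi c d 100 (simple_tab w c)"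
    and range: "\<not> (\<exists>(i, a)\<in>chars. \<exists>j<d. psi \<le> w i a j)"
    and coll: "\<not> pair_collision M w"
  shows "(\<exists>s\<in>{3..c * 100}. single_event s w)
    \<or> (\<exists>t\<in>{t. d < c * t \<and> t \<le> M \<and> t \<le> d}. \<exists>i<c. \<exists>a b. 2 \<le> a \<and> 3 \<le> a + b \<and> a + b \<le> c * 100 \<and> type_event t i a b w)"
proof -
  obtain X where X: "X \<subseteq> keys phi c" "X \<noteq> {}" "card X \<le> 100"
    and nou: "\<And>j a. j < d \<Longrightarrow> a < psi \<Longrightarrow> card {x\<in>X. simple_tab w c x j = a} \<noteq> 1"
    using bad unfolding k_unique_def by blast
  have finX: "finite X"
    using X(1) by (rule finite_subset) (auto simp: keys_def intro!: finite_PiE)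
  have partner: "\<exists>y\<in>X. y \<noteq> x \<and> simple_tab w c y j = simple_tab w c x j" if j: "j < d" and x: "x \<in> X" for j x
  proof (rule ccontr)
    assume "\<not> ?thesis"
    then have "{y\<in>X. simple_tab w c y j = simple_tab w c x j} = {x}" using x by blast
    moreover have "simple_tab w c x j < psi" unfolding r
    proof (rule simple_tab_less)
      fix i assume i: "i < c"
      have "x i < phi" using subsetD[OF X(1) x] i by (auto simp: keys_def PiE_iff)
      then have "(i, x i) \<in> chars" using i by (simp add: chars_def)
      then have "\<not> psi \<le> w i (x i) j" using range j by blast
      then show "w i (x i) j < 2 ^ r" by (simp add: r)
    qed
    ultimately show False using nou[OF j, of "simple_tab w c x j"] by simp
  qed
  interpret nu: non_unique c d 100 X w phi
    by unfold_locales (use c2 d0 X finX partner in auto)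
  obtain ys where ys: "distinct ys" "set ys = nu.A"
    "\<And>t. Suc t < length ys \<Longrightarrow> nu.deg (ys ! Suc t) \<le> nu.deg (ys ! t)"
    using sorted_enumeration[OF nu.finA, of nu.deg] by blast
  interpret en: enumerated c d 100 X w phi ys
    by unfold_locales (use ys in auto)
  have Achars: "nu.A \<subseteq> chars" using nu.A_sub by (simp add: chars_def)
  have "card (fiber i nu.A) \<le> k" if "i < c" for i using nu.fiber_A[OF that] k100 by simp
  then have thinA: "thin nu.A" using Achars by (simp add: thin_def)
  have sys: "thin S" "3 \<le> card S" "card S \<le> c * 100" "finite S" if "en.single_system S K G" for S K G
  proof -
    have SA: "S \<subseteq> nu.A" and "3 \<le> card S" using that by (simp_all add: en.single_system_def)
    then show "3 \<le> card S" by simp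
    show t: "thin S" using thin_mono[OF thinA SA] .
    show "card S \<le> c * 100" using card_thin_le[OF t] k100 by metis
    show "finite S" using t by (rule thin_finite)
  qed
  have pairs: "card {j. j < d \<and> xor_sum w j {(i, a), (i, b)} = 0} \<le> M"
    if "i < c" "a \<noteq> b" "(i, a) \<in> nu.A" "(i, b) \<in> nu.A" for i a b
  proof (rule ccontr)
    assume "\<not> card {j. j < d \<and> xor_sum w j {(i, a), (i, b)} = 0} \<le> M"
    moreover have "a < phi" "b < phi" using that(3,4) Achars by (auto simp: chars_def)
    ultimately have "pair_collision M w" unfolding pair_collision_def using that(1,2) by (meson not_le)
    then show False using coll by simp
  qed
  have "(\<exists>S K G. en.single_system S K G \<and> triangular G \<and> zero_relations w G
        \<and> d * card S \<le> 2 * c * card G \<and> (fst ` S = {..<c} \<or> d * card S < 2 * c * card G))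
    \<or> (\<exists>t S K G i a b J. en.single_system S K G \<and> d < c * t \<and> t \<le> M
        \<and> i < c \<and> a \<noteq> b \<and> (i, a) \<in> S \<and> (i, b) \<in> S \<and> J \<subseteq> {..<d} \<and> card J = t
        \<and> G \<inter> J \<times> {{(i, a), (i, b)}} = {}
        \<and> triangular (G \<union> J \<times> {{(i, a), (i, b)}}) \<and> zero_relations w (G \<union> J \<times> {{(i, a), (i, b)}})
        \<and> (c - 1) * t * card (fiber i S) + (d - t) * (card S - card (fiber i S)) \<le> 2 * (c - 1) * (card G + t))"
    using pairs by (rule en.extract_relations)
  then show ?thesis
  proof (rule disjE; elim exE conjE)
    fix S K G
    assume ss: "en.single_system S K G" and G: "triangular G" "zero_relations w G"
      and le: "d * card S \<le> 2 * c * card G" and strict: "fst ` S = {..<c} \<or> d * card S < 2 * c * card G"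
    have m: "rank_single c d (card S) \<le> card G"
    proof (cases "c = 3 \<and> card S = 3")
      case True
      have "d * card S < 2 * c * card G"
      proof (rule ccontr)
        assume "\<not> ?thesis"
        then have "fst ` S = {..<c}" using strict by blast
        then have "position_even c S = {}"
          using position_even_transversal[OF sys(4)[OF ss]] True by simp
        then have "G = {}" using ss by (auto simp: en.single_system_def)
        then show False using le True d0 by simp
      qed
      then have "d * card S div (2 * c) < card G" by (intro less_mult_imp_div_less) (simp add: mult.commute)
      then show ?thesis using True by (simp add: rank_single_def)
    next
      case False
      then show ?thesis unfolding rank_single_def using ceil_div_le[OF le] c2 by auto
    qed
    have "linked c d w (sets_of_size (card S)) (\<lambda>_. {{}}) 0 (card G)"
      unfolding linked_def
      using ss G sys(1)[OF ss]
      by (intro bexI[of _ S] exI[of _ K] bexI[of _ "{}"] exI[of _ "{}"] exI[of _ G] conjI)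
        (simp_all add: en.single_system_def sets_of_size_def)
    then have "single_event (card S) w"
      unfolding single_event_def by (rule linked_mono[OF _ m]) simp_all
    then show ?thesis using sys(2,3)[OF ss] by auto
  next
    fix t S K G i a b J
    assume ss: "en.single_system S K G" and t: "d < c * t" "t \<le> M" and i: "i < c" and ab: "a \<noteq> b"
      and inS: "(i, a) \<in> S" "(i, b) \<in> S" and J: "J \<subseteq> {..<d}" "card J = t"
      and G: "G \<inter> J \<times> {{(i, a), (i, b)}} = {}" "triangular (G \<union> J \<times> {{(i, a), (i, b)}})"
        "zero_relations w (G \<union> J \<times> {{(i, a), (i, b)}})"
      and le: "(c - 1) * t * card (fiber i S) + (d - t) * (card S - card (fiber i S)) \<le> 2 * (c - 1) * (card G + t)"
    define x where "x = card (fiber i S)"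
    define y where "y = card S - x"
    have finf: "finite (fiber i S)" using sys(4)[OF ss] by (rule finite_fiber)
    have "card {a, b} \<le> x" unfolding x_def using inS by (intro card_mono[OF finf]) (auto simp: fiber_def)
    then have x2: "2 \<le> x" using ab by simp
    have "{i} \<times> fiber i S \<subseteq> S" by (auto simp: fiber_def)
    from card_mono[OF sys(4)[OF ss] this] have "x \<le> card S" by (simp add: x_def card_cartesian_product)
    then have xy: "card S = x + y" by (simp add: y_def)
    have td: "t \<le> d" using J card_mono[of "{..<d}" J] by simp
    have "ceil_div ((c - 1) * t * x + (d - t) * y) (2 * (c - 1)) \<le> card G + t"
      using le c2 by (intro ceil_div_le) (simp_all add: x_def y_def)
    then have m: "rank_type c d t x y \<le> card G" by (simp add: rank_type_def)
    have "{(i, a), (i, b)} \<in> fiber_pairs i S" using inS ab by (auto simp: fiber_pairs_def fiber_def)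
    moreover have "S \<in> sets_of_type i x y" using sys(1)[OF ss] xy by (simp add: sets_of_type_def x_def)
    ultimately have "linked c d w (sets_of_type i x y) (fiber_pairs i) t (card G)"
      unfolding linked_def
      using ss G J
      by (intro bexI[of _ S] exI[of _ K] bexI[of _ "{(i, a), (i, b)}"] exI[of _ J] exI[of _ G] conjI)
        (simp_all add: en.single_system_def)
    then have "type_event t i x y w"
      unfolding type_event_def by (rule linked_mono[OF _ m]) simp_all
    then show ?thesis using sys(2,3)[OF ss] xy x2 t td i by auto
  qed
qed

end

section \<open>Evaluated logarithms\<close>

text \<open>Precomputed arguments for the numerical checks, so that the squarings need not be
  repeated there.\<close>

lemma lg_up_table: "map lg_up [
    1, 2, 3, 4, 5, 6, 7, 8, 9, 10, 11, 12, 13, 14, 15, 16, 17, 18, 19, 20, 21, 22, 23, 24, 25, 26, 27, 28,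
    29, 30, 31, 32, 33, 34, 35, 36, 37, 38, 39, 40, 41, 42, 43, 44, 45, 46, 47, 48, 49, 50, 51, 52, 53, 54,
    55, 56, 57, 58, 59, 60, 61, 62, 63, 64, 65, 66, 67, 79, 92, 106, 121, 137, 154, 172, 191, 211, 232, 254,
    277, 301, 326, 352, 379, 407, 436, 466, 497, 529, 562, 596, 631, 667, 704, 742, 781, 821, 862, 904, 947,
    991, 1001, 1036, 1082, 1129, 1177, 1226, 1276, 1327, 1379, 1432, 1486, 1541, 1597, 1654, 1712, 1771,
    1831, 1892, 1954, 2002, 2017, 2081, 2146, 69300, 99000, 118800, 167960, 1307504, 1961256, 5245786,
    53194089192720, 70907466006720] = [
    1, 1025, 1624, 2049, 2378, 2648, 2875, 3073, 3247, 3402, 3543, 3672, 3790, 3899, 4001, 4097, 4186, 4271,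
    4350, 4426, 4498, 4567, 4633, 4696, 4756, 4814, 4870, 4923, 4975, 5025, 5074, 5121, 5166, 5210, 5253,
    5295, 5335, 5374, 5413, 5450, 5487, 5522, 5557, 5591, 5624, 5657, 5689, 5720, 5750, 5780, 5809, 5838,
    5866, 5894, 5921, 5947, 5973, 5999, 6024, 6049, 6074, 6098, 6121, 6145, 6168, 6190, 6212, 6456, 6681,
    6890, 7085, 7269, 7442, 7605, 7760, 7907, 8047, 8181, 8309, 8432, 8550, 8663, 8772, 8878, 8979, 9078,
    9173, 9265, 9354, 9441, 9525, 9607, 9687, 9765, 9840, 9914, 9986, 10056, 10125, 10192, 10207, 10258,
    10322, 10385, 10446, 10507, 10566, 10624, 10680, 10736, 10791, 10844, 10897, 10949, 11000, 11050, 11099,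
    11148, 11195, 11231, 11242, 11288, 11334, 16467, 16994, 17263, 17775, 20807, 21406, 22859, 46691, 47116]"
  by (simp add: lg_up_def Let_def funpow10 sq_numeral)

lemmas lg_up_values [simp] = lg_up_table[unfolded list.map list.inject, simplified]

lemma lg_dn_table: "map lg_dn [
    1, 2, 3, 4, 5, 6, 7, 8, 9, 10, 11, 12, 13, 14, 15, 16, 17, 18, 19, 20, 21, 22, 23, 24, 25, 26, 27, 28,
    29, 30, 31, 32, 33, 34, 35, 36, 37, 38, 39, 40, 41, 42, 43, 44, 45, 46, 47, 48, 49, 50, 51, 52, 53, 54,
    55, 56, 57, 58, 59, 60, 61, 62, 63, 64, 65, 66, 67, 68, 69, 70, 71, 72, 73, 74, 75, 76, 77, 78, 79, 80,
    81, 82, 83, 84, 85, 86, 87, 88, 89, 90, 91, 92, 93, 94, 95, 96, 97, 98, 99, 100, 101, 102, 103, 104, 105,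
    106, 107, 108, 109, 110, 111, 112, 113, 114, 115, 116, 117, 118, 119, 120, 121, 122, 123, 124, 125, 126,
    127, 128, 129, 130, 131, 132, 133, 134, 135, 136, 137, 138, 139, 140, 141, 142, 143, 144, 145, 146, 147,
    148, 149, 150, 151, 152, 153, 154, 155, 156, 157, 158, 159, 160, 161, 162, 163, 164, 165, 166, 167, 168,
    169, 170, 171, 172, 173, 174, 175, 176, 177, 178, 179, 180, 181, 182, 183, 184, 185, 186, 187, 188, 189,
    190, 191, 192, 193, 194, 195, 196, 197, 198, 199, 200] = [
    0, 1024, 1622, 2048, 2377, 2646, 2874, 3072, 3245, 3401, 3542, 3670, 3789, 3898, 4000, 4096, 4185, 4269,
    4349, 4425, 4497, 4566, 4632, 4694, 4755, 4813, 4868, 4922, 4974, 5024, 5073, 5120, 5165, 5209, 5252,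
    5293, 5334, 5373, 5412, 5449, 5486, 5521, 5556, 5590, 5623, 5656, 5687, 5718, 5749, 5779, 5808, 5837,
    5865, 5892, 5920, 5946, 5972, 5998, 6023, 6048, 6073, 6097, 6120, 6144, 6166, 6189, 6211, 6233, 6255,
    6276, 6297, 6317, 6338, 6358, 6378, 6397, 6417, 6436, 6455, 6473, 6491, 6510, 6528, 6545, 6563, 6580,
    6597, 6614, 6631, 6647, 6663, 6680, 6696, 6711, 6727, 6742, 6758, 6773, 6788, 6803, 6817, 6832, 6846,
    6861, 6875, 6889, 6903, 6916, 6930, 6944, 6957, 6970, 6983, 6996, 7009, 7022, 7035, 7047, 7060, 7072,
    7084, 7097, 7109, 7121, 7132, 7144, 7156, 7168, 7179, 7190, 7202, 7213, 7224, 7235, 7246, 7257, 7268,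
    7279, 7289, 7300, 7310, 7321, 7331, 7341, 7352, 7362, 7372, 7382, 7392, 7402, 7412, 7421, 7431, 7441,
    7450, 7460, 7469, 7479, 7488, 7497, 7506, 7515, 7525, 7534, 7543, 7552, 7560, 7569, 7578, 7587, 7595,
    7604, 7613, 7621, 7630, 7638, 7646, 7655, 7663, 7671, 7679, 7687, 7696, 7704, 7712, 7720, 7727, 7735,
    7743, 7751, 7759, 7766, 7774, 7782, 7789, 7797, 7804, 7812, 7819, 7827]"
  by (simp add: lg_dn_def Let_def funpow10 sq_numeral)

lemmas lg_dn_values = lg_dn_table[unfolded list.map list.inject, simplified]

lemma lg_fact_Suc: "lg_fact (Suc n) = lg_fact n + lg_dn (Suc n)"
  by (simp add: lg_fact_def)

lemma lg_fact_numeral: "lg_fact (numeral n) = lg_fact (pred_numeral n) + lg_dn (numeral n)"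
  unfolding numeral_eq_Suc by (rule lg_fact_Suc)

lemma lg_fact_0: "lg_fact 0 = 0" "lg_fact (Suc 0) = lg_dn (Suc 0)"
  by (simp_all add: lg_fact_def)

lemma lg_fact_table: "map lg_fact [
    1, 2, 3, 4, 5, 6, 7, 8, 9, 10, 11, 12, 13, 14, 15, 16, 17, 18, 19, 20, 21, 22, 23, 24, 25, 26, 27, 28,
    29, 30, 31, 32, 33, 34, 35, 36, 37, 38, 39, 40, 41, 42, 43, 44, 45, 46, 47, 48, 49, 50, 51, 52, 53, 54,
    55, 56, 57, 58, 59, 60, 61, 62, 63, 64, 65, 66, 67, 68, 69, 70, 71, 72, 73, 74, 75, 76, 77, 78, 79, 80,
    81, 82, 83, 84, 85, 86, 87, 88, 89, 90, 91, 92, 93, 94, 95, 96, 97, 98, 99, 100, 101, 102, 103, 104, 105,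
    106, 107, 108, 109, 110, 111, 112, 113, 114, 115, 116, 117, 118, 119, 120, 121, 122, 123, 124, 125, 126,
    127, 128, 129, 130, 131, 132, 133, 134, 135, 136, 137, 138, 139, 140, 141, 142, 143, 144, 145, 146, 147,
    148, 149, 150, 151, 152, 153, 154, 155, 156, 157, 158, 159, 160, 161, 162, 163, 164, 165, 166, 167, 168,
    169, 170, 171, 172, 173, 174, 175, 176, 177, 178, 179, 180, 181, 182, 183, 184, 185, 186, 187, 188, 189,
    190, 191, 192, 193, 194, 195, 196, 197, 198, 199, 200] = [
    0, 1024, 2646, 4694, 7071, 9717, 12591, 15663, 18908, 22309, 25851, 29521, 33310, 37208, 41208, 45304,
    49489, 53758, 58107, 62532, 67029, 71595, 76227, 80921, 85676, 90489, 95357, 100279, 105253, 110277,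
    115350, 120470, 125635, 130844, 136096, 141389, 146723, 152096, 157508, 162957, 168443, 173964, 179520,
    185110, 190733, 196389, 202076, 207794, 213543, 219322, 225130, 230967, 236832, 242724, 248644, 254590,
    260562, 266560, 272583, 278631, 284704, 290801, 296921, 303065, 309231, 315420, 321631, 327864, 334119,
    340395, 346692, 353009, 359347, 365705, 372083, 378480, 384897, 391333, 397788, 404261, 410752, 417262,
    423790, 430335, 436898, 443478, 450075, 456689, 463320, 469967, 476630, 483310, 490006, 496717, 503444,
    510186, 516944, 523717, 530505, 537308, 544125, 550957, 557803, 564664, 571539, 578428, 585331, 592247,
    599177, 606121, 613078, 620048, 627031, 634027, 641036, 648058, 655093, 662140, 669200, 676272, 683356,
    690453, 697562, 704683, 711815, 718959, 726115, 733283, 740462, 747652, 754854, 762067, 769291, 776526,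
    783772, 791029, 798297, 805576, 812865, 820165, 827475, 834796, 842127, 849468, 856820, 864182, 871554,
    878936, 886328, 893730, 901142, 908563, 915994, 923435, 930885, 938345, 945814, 953293, 960781, 968278,
    975784, 983299, 990824, 998358, 1005901, 1013453, 1021013, 1028582, 1036160, 1043747, 1051342, 1058946,
    1066559, 1074180, 1081810, 1089448, 1097094, 1104749, 1112412, 1120083, 1127762, 1135449, 1143145,
    1150849, 1158561, 1166281, 1174008, 1181743, 1189486, 1197237, 1204996, 1212762, 1220536, 1228318,
    1236107, 1243904, 1251708, 1259520, 1267339, 1275166]"
  by (simp add: lg_fact_numeral lg_fact_0 lg_dn_values)

lemmas lg_fact_values = lg_fact_table[unfolded list.map list.inject, simplified] lg_fact_0

section \<open>Checkable conditions and the probabilities they bound\<close>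

text \<open>A bounded quantifier that the simplifier unrolls when the number of instances is a
  numeral.\<close>

primrec all_from :: "nat \<Rightarrow> nat \<Rightarrow> (nat \<Rightarrow> bool) \<Rightarrow> bool" where
  "all_from 0 n Q \<longleftrightarrow> True"
| "all_from (Suc k) n Q \<longleftrightarrow> Q n \<and> all_from k (Suc n) Q"

lemma all_from_numeral: "all_from (numeral k) n Q \<longleftrightarrow> Q n \<and> all_from (pred_numeral k) (Suc n) Q"
  unfolding numeral_eq_Suc by simp

lemma all_fromD: "all_from k n Q \<Longrightarrow> n \<le> x \<Longrightarrow> x < n + k \<Longrightarrow> Q x"
proof (induction k arbitrary: n)
  case (Suc k)
  then show ?case by (cases "x = n") auto
qed simp

primrec all_pairs :: "nat \<Rightarrow> nat \<Rightarrow> nat \<Rightarrow> (nat \<Rightarrow> nat \<Rightarrow> bool) \<Rightarrow> bool" where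
  "all_pairs 0 a s Q \<longleftrightarrow> True"
| "all_pairs (Suc k) a s Q \<longleftrightarrow> Q a (s - a) \<and> all_pairs k (Suc a) s Q"

lemma all_pairs_numeral: "all_pairs (numeral k) a s Q \<longleftrightarrow> Q a (s - a) \<and> all_pairs (pred_numeral k) (Suc a) s Q"
  unfolding numeral_eq_Suc by simp

text \<open>\<open>all_pairs\<close> keeps \<open>Q\<close> free of abstractions, so that the simplifier unfolds it at numerals only.\<close>

lemma all_pairs_iff: "all_pairs k a s Q \<longleftrightarrow> all_from k a (\<lambda>a. Q a (s - a))"
  by (induction k arbitrary: a) simp_all

definition single_ok :: "nat \<Rightarrow> nat \<Rightarrow> nat \<Rightarrow> nat \<Rightarrow> int \<Rightarrow> nat \<Rightarrow> bool" where
  "single_ok c d q r \<theta> s \<longleftrightarrow> size_bound c d q r 0 0 (rank_single c d s) s \<le> \<theta>"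

definition size_ok :: "nat \<Rightarrow> nat \<Rightarrow> nat \<Rightarrow> nat \<Rightarrow> nat \<Rightarrow> int \<Rightarrow> nat \<Rightarrow> bool" where
  "size_ok c d q r t \<theta> s \<longleftrightarrow> size_bound c d q r t (2 * lg_up s - 1024) (rank_size c d t s) s \<le> \<theta>"

definition type_ok :: "nat \<Rightarrow> nat \<Rightarrow> nat \<Rightarrow> nat \<Rightarrow> nat \<Rightarrow> int \<Rightarrow> nat \<Rightarrow> nat \<Rightarrow> bool" where
  "type_ok c d q r t \<theta> a b \<longleftrightarrow> type_bound c d q r t (rank_type c d t a b) a b \<le> \<theta>"

definition type_row_ok :: "nat \<Rightarrow> nat \<Rightarrow> nat \<Rightarrow> nat \<Rightarrow> nat \<Rightarrow> int \<Rightarrow> nat \<Rightarrow> bool" where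
  "type_row_ok c d q r t \<theta> s \<longleftrightarrow> all_pairs (s - 1) 2 s (type_ok c d q r t \<theta>)"

text \<open>One inequality for all sizes \<open>s \<ge> n\<close>; the last line is the exponent at
  \<open>s = n\<close>. The condition on \<open>y\<close> says that a further character costs at
  most \<open>y\<close>: \<open>1024 * q + lg_up c - lg_dn n\<close> for choosing it and
  \<open>100 * \<delta>\<close> for the growth of the choice of 100 partial keys along the tangent
  at \<open>g\<close>. The relations forced by a further character gain \<open>y\<close> in return,
  counted from \<open>off\<close> on. \<open>u\<close> bounds the exponential that replaces the
  relation count, and \<open>0 \<le> 100 * v - lg_fact 100\<close> makes the \<open>max\<close>
  disappear.\<close>

definition tail_ok :: "nat \<Rightarrow> nat \<Rightarrow> nat \<Rightarrow> nat \<Rightarrow> nat \<Rightarrow> int \<Rightarrow> nat \<Rightarrow> nat \<Rightarrow> nat \<Rightarrow> int \<Rightarrow> int \<Rightarrow> nat \<Rightarrow> int \<Rightarrow> bool" where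
  "tail_ok c d q r t l e g off y u n \<theta> \<longleftrightarrow> c * g \<le> n \<and> 0 < n \<and> 3072 * int (4950 * d) * 2 ^ e \<le> 2 * u * 2 ^ r \<and>
    (let \<delta> = lg_up (Suc (Suc g)) - lg_dn (Suc g);
         v = int c * lg_up (Suc g) + (int n - int (c * g)) * \<delta> in
     0 \<le> \<delta> \<and> 0 \<le> 100 * v - lg_fact 100 \<and> 1024 * int q + lg_up c - lg_dn n + 100 * \<delta> \<le> y \<and>
     1024 * int q * int n + int n * lg_up c - lg_fact n + l + lg_up (d choose t) + (100 * v - lg_fact 100) + u
       - y * (int n - int off) - 1024 * int r * int t \<le> \<theta>)"

context random_tab
begin

lemma prob_Bex_le:
  assumes "finite X" "\<And>x. x \<in> X \<Longrightarrow> measure_pmf.prob p {w. Q x w} \<le> \<epsilon>"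
  shows "measure_pmf.prob p {w. \<exists>x\<in>X. Q x w} \<le> real (card X) * \<epsilon>"
proof -
  have "{w. \<exists>x\<in>X. Q x w} = (\<Union>x\<in>X. {w. Q x w})" by blast
  then have "measure_pmf.prob p {w. \<exists>x\<in>X. Q x w} \<le> (\<Sum>x\<in>X. measure_pmf.prob p {w. Q x w})"
    using measure_pmf.finite_measure_subadditive_finite[OF assms(1), of "\<lambda>x. {w. Q x w}" p] by simp
  also have "\<dots> \<le> real (card X) * \<epsilon>" using assms(2) by (rule sum_bounded_above)
  finally show ?thesis .
qed

lemma prob_le_add:
  assumes "\<And>w. Q w \<Longrightarrow> Q1 w \<or> Q2 w" "measure_pmf.prob p {w. Q1 w} \<le> \<alpha>" "measure_pmf.prob p {w. Q2 w} \<le> \<beta>"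
  shows "measure_pmf.prob p {w. Q w} \<le> \<alpha> + \<beta>"
proof -
  have "measure_pmf.prob p {w. Q w} \<le> measure_pmf.prob p ({w. Q1 w} \<union> {w. Q2 w})"
    by (rule measure_pmf.finite_measure_mono) (use assms(1) in auto)
  also have "\<dots> \<le> measure_pmf.prob p {w. Q1 w} + measure_pmf.prob p {w. Q2 w}"
    by (rule measure_Un_le) simp_all
  finally show ?thesis using assms(2,3) by linarith
qed

lemma prob_Bex_Un:
  assumes "X \<subseteq> A \<union> B" "measure_pmf.prob p {w. \<exists>x\<in>A. Q x w} \<le> \<alpha>" "measure_pmf.prob p {w. \<exists>x\<in>B. Q x w} \<le> \<beta>"
  shows "measure_pmf.prob p {w. \<exists>x\<in>X. Q x w} \<le> \<alpha> + \<beta>"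
  using assms by (intro prob_le_add[OF _ assms(2,3)]) blast

lemma prob_Bex_powr:
  assumes "finite X" "card X \<le> N" "\<And>x. x \<in> X \<Longrightarrow> measure_pmf.prob p {w. Q x w} \<le> real K * 2 powr (real_of_int \<theta> / 1024)"
    and \<theta>: "\<theta> \<le> - (1024 * int n)"
  shows "measure_pmf.prob p {w. \<exists>x\<in>X. Q x w} \<le> real (N * K) * (1 / 2) ^ n"
proof -
  have "measure_pmf.prob p {w. \<exists>x\<in>X. Q x w} \<le> real (card X) * (real K * 2 powr (real_of_int \<theta> / 1024))"
    using assms(1,3) by (rule prob_Bex_le)
  also have "\<dots> \<le> real N * (real K * 2 powr (- real n))"
  proof (intro mult_mono)
    have "real_of_int \<theta> \<le> real_of_int (- (1024 * int n))" using \<theta> by (simp only: of_int_le_iff)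
    then show "2 powr (real_of_int \<theta> / 1024) \<le> (2 powr (- real n) :: real)" by (intro powr_mono) simp_all
  qed (use assms(2) in simp_all)
  also have "\<dots> = real (N * K) * (1 / 2) ^ n" by (simp add: powr_minus powr_realpow power_one_over inverse_eq_divide)
  finally show ?thesis .
qed

definition split_event :: "nat \<Rightarrow> nat \<Rightarrow> (nat \<Rightarrow> nat \<Rightarrow> nat \<Rightarrow> nat) \<Rightarrow> bool" where
  "split_event t s w \<longleftrightarrow> (\<exists>z\<in>{..<c} \<times> {2..s}. type_event t (fst z) (snd z) (s - snd z) w)"

lemma split_event_imp_size_event:
  assumes "split_event t s w" "2 \<le> c" "d \<le> c * t" "t \<le> d"
  shows "size_event t s w"
proof -
  obtain z where "snd z \<in> {2..s}" "type_event t (fst z) (snd z) (s - snd z) w"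
    using assms(1) by (auto simp: split_event_def)
  then show ?thesis using type_event_imp_size_event[of t "fst z" "snd z" "s - snd z" w] assms(2-4) by simp
qed

lemma prob_mono: "(\<And>w. Q w \<Longrightarrow> Q' w) \<Longrightarrow> measure_pmf.prob p {w. Q' w} \<le> \<epsilon> \<Longrightarrow> measure_pmf.prob p {w. Q w} \<le> \<epsilon>"
  using measure_pmf.finite_measure_mono[of "{w. Q w}" "{w. Q' w}" p] by fastforce

text \<open>\<open>M\<close> divides the colliding pairs: more than \<open>M\<close> collisions are
  charged to \<open>pair_collision\<close>, and more than \<open>d / c\<close> but at most
  \<open>M\<close> to \<open>split_event\<close>.\<close>

lemma prob_not_unique_le:
  assumes k100: "k = 100" and r: "psi = 2 ^ r" and c2: "2 \<le> c" and d0: "0 < d"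
    and P: "measure_pmf.prob p {w. pair_collision M w} \<le> \<epsilon>\<^sub>1"
    and A: "measure_pmf.prob p {w. \<exists>s\<in>{3..c * 100}. single_event s w} \<le> \<epsilon>\<^sub>2"
    and B: "measure_pmf.prob p {w. \<exists>t\<in>{t. d < c * t \<and> t \<le> M \<and> t \<le> d}. \<exists>s\<in>{3..c * 100}. split_event t s w} \<le> \<epsilon>\<^sub>3"
  shows "measure_pmf.prob p {w. \<not> k_unique phi psi c d 100 (simple_tab w c)} \<le> \<epsilon>\<^sub>1 + \<epsilon>\<^sub>2 + \<epsilon>\<^sub>3"
proof -
  let ?out = "\<lambda>w. \<exists>(i, a)\<in>chars. \<exists>j<d. psi \<le> w i a j"
  have 1: "(?out w \<or> pair_collision M w) \<or> (\<exists>s\<in>{3..c * 100}. single_event s w)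
      \<or> (\<exists>t\<in>{t. d < c * t \<and> t \<le> M \<and> t \<le> d}. \<exists>s\<in>{3..c * 100}. split_event t s w)"
    if "\<not> k_unique phi psi c d 100 (simple_tab w c)" for w
  proof (cases "?out w \<or> pair_collision M w")
    case False
    then have no: "\<not> ?out w" "\<not> pair_collision M w" by (rule_tac [1-2] notI, simp_all only: simp_thms)
    from not_unique_events[OF k100 r c2 d0 that no] show ?thesis
    proof (rule disjE)
      assume "\<exists>t\<in>{t. d < c * t \<and> t \<le> M \<and> t \<le> d}. \<exists>i<c. \<exists>a b. 2 \<le> a \<and> 3 \<le> a + b \<and> a + b \<le> c * 100 \<and> type_event t i a b w"
      then obtain t i a b where *: "t \<in> {t. d < c * t \<and> t \<le> M \<and> t \<le> d}" "i < c" "2 \<le> a" "3 \<le> a + b" "a + b \<le> c * 100"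
        "type_event t i a b w" by (elim bexE exE conjE)
      have "split_event t (a + b) w" unfolding split_event_def
        by (rule bexI[of _ "(i, a)"]) (use * in simp_all)
      moreover have "a + b \<in> {3..c * 100}" using *(4,5) by simp
      ultimately have "\<exists>s\<in>{3..c * 100}. split_event t s w" by (rule bexI)
      then show ?thesis using *(1) by (intro disjI2) (rule bexI)
    qed (intro disjI2 disjI1)
  qed (rule disjI1)
  have "measure_pmf.prob p {w. ?out w \<or> pair_collision M w} \<le> 0 + \<epsilon>\<^sub>1"
    by (rule prob_le_add[OF _ eq_refl[OF prob_range] P])
  from prob_le_add[OF 1 this prob_le_add[OF _ A B]] show ?thesis by (simp add: add.assoc)
qed

context
  fixes q r :: nat
  assumes q: "phi = 2 ^ q" and r: "psi = 2 ^ r"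
begin

lemma prob_single:
  assumes "single_ok c d q r \<theta> s"
  shows "measure_pmf.prob p {w. single_event s w} \<le> 2 powr (real_of_int \<theta> / 1024)"
proof -
  have "measure_pmf.prob p {w. single_event s w} \<le> 2 powr (real_of_int (size_bound c d q r 0 0 (rank_single c d s) s) / 1024)"
    unfolding single_event_def by (rule prob_size[OF q r]) simp
  also have "\<dots> \<le> 2 powr (real_of_int \<theta> / 1024)" using assms by (simp add: single_ok_def divide_right_mono)
  finally show ?thesis .
qed

lemma pairs_bound:
  assumes "S \<in> sets_of_size s"
  shows "finite (pairs S) \<and> real (card (pairs S)) \<le> 2 powr (real_of_int (2 * lg_up s - 1024) / 1024) \<and> pairs S \<subseteq> Pow S"
proof -
  have "finite S" "card S = s" using assms thin_finite by (simp_all add: sets_of_size_def)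
  moreover have "pairs S \<subseteq> Pow S" unfolding pairs_def by blast
  ultimately show ?thesis using card_pairs_le[of S] by (simp add: pairs_def)
qed

lemma prob_split_size:
  assumes "size_ok c d q r t \<theta> s" "2 \<le> c" "d \<le> c * t" "t \<le> d"
  shows "measure_pmf.prob p {w. split_event t s w} \<le> 2 powr (real_of_int \<theta> / 1024)"
proof (rule prob_mono)
  show "size_event t s w" if "split_event t s w" for w using split_event_imp_size_event[OF that assms(2-4)] .
  have "measure_pmf.prob p {w. size_event t s w}
    \<le> 2 powr (real_of_int (size_bound c d q r t (2 * lg_up s - 1024) (rank_size c d t s) s) / 1024)"
    unfolding size_event_def by (rule prob_size[OF q r pairs_bound])
  also have "\<dots> \<le> 2 powr (real_of_int \<theta> / 1024)" using assms(1) by (simp add: size_ok_def divide_right_mono)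
  finally show "measure_pmf.prob p {w. size_event t s w} \<le> 2 powr (real_of_int \<theta> / 1024)" .
qed

lemma prob_split_type:
  assumes "type_row_ok c d q r t \<theta> s" "2 \<le> c"
  shows "measure_pmf.prob p {w. split_event t s w} \<le> real (c * (s - 1)) * 2 powr (real_of_int \<theta> / 1024)"
proof -
  have "measure_pmf.prob p {w. split_event t s w} \<le> real (card ({..<c} \<times> {2..s})) * 2 powr (real_of_int \<theta> / 1024)"
    unfolding split_event_def
  proof (rule prob_Bex_le)
    fix z assume "z \<in> {..<c} \<times> {2..s}"
    then have i: "fst z < c" and a: "2 \<le> snd z" "snd z < 2 + (s - 1)" by auto
    have "measure_pmf.prob p {w. type_event t (fst z) (snd z) (s - snd z) w}
      \<le> 2 powr (real_of_int (type_bound c d q r t (rank_type c d t (snd z) (s - snd z)) (snd z) (s - snd z)) / 1024)"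
      unfolding type_event_def by (rule prob_type[OF q r i assms(2)])
    also have "\<dots> \<le> 2 powr (real_of_int \<theta> / 1024)"
      using all_fromD[OF assms(1)[unfolded type_row_ok_def all_pairs_iff] a] by (simp add: type_ok_def divide_right_mono)
    finally show "measure_pmf.prob p {w. type_event t (fst z) (snd z) (s - snd z) w} \<le> 2 powr (real_of_int \<theta> / 1024)" .
  qed simp
  then show ?thesis by (simp add: card_cartesian_product)
qed

text \<open>For size three the exact binomial coefficient with three even subsets is used. The
  generic exponent would already exceed the target \<open>9 / 10 ^ 36\<close> in the third parameter
  set.\<close>

lemma prob_single_3:
  assumes "size_exp c q 3 + lg_up (d choose 0) + lg_up (d * 3 choose rank_single c d 3)
    - 1024 * int r * int (rank_single c d 3) \<le> \<theta>"
  shows "measure_pmf.prob p {w. single_event 3 w} \<le> 2 powr (real_of_int \<theta> / 1024)"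
proof -
  let ?m = "rank_single c d 3"
  have thin: "thin S" if "S \<in> sets_of_size 3" for S using that by (simp add: sets_of_size_def)
  have V: "card (position_even c S) \<le> 3" if "S \<in> sets_of_size 3" for S
    using card_position_even_3[OF thin_finite[OF thin[OF that]] thin_sub[OF thin[OF that]]] that
    by (simp add: sets_of_size_def)
  have "measure_pmf.prob p {w. single_event 3 w} \<le> 2 powr (real_of_int (size_exp c q 3 + 0 + lg_up (d choose 0)) / 1024
      + real_of_int (lg_up (d * 3 choose ?m)) / 1024 - real r * real (?m + 0))"
    unfolding single_event_def
    by (rule prob_linked_even_gen[OF thin card_sets_of_size[OF q r] _ r V lg_up]) simp_all
  also have "\<dots> = 2 powr (real_of_int (size_exp c q 3 + lg_up (d choose 0) + lg_up (d * 3 choose ?m) - 1024 * int r * int ?m) / 1024)"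
    by (simp add: add_divide_distrib diff_divide_distrib)
  also have "\<dots> \<le> 2 powr (real_of_int \<theta> / 1024)" using assms by (simp only: of_int_le_iff powr_le_cancel_iff divide_right_mono)
  finally show ?thesis .
qed

lemma prob_tail:
  assumes ok: "tail_ok c d q r t l e g off y u n \<theta>" and s: "n \<le> s"
    and E: "\<And>S. S \<in> sets_of_size s \<Longrightarrow> finite (E S) \<and> real (card (E S)) \<le> 2 powr (real_of_int l / 1024) \<and> E S \<subseteq> Pow S"
    and m: "y * (int s - int off) \<le> 1024 * int (e * m)"
  shows "measure_pmf.prob p {w. linked c d w (sets_of_size s) E t m} \<le> 2 powr (real_of_int \<theta> / 1024)"
proof -
  define \<delta> where "\<delta> = lg_up (Suc (Suc g)) - lg_dn (Suc g)"
  define v where "v = int c * lg_up (Suc g) + (int n - int (c * g)) * \<delta>"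
  define h where "h = s - n"
  have sh: "s = n + h" using s by (simp add: h_def)
  have g: "c * g \<le> n" and n: "0 < n" and u: "3072 * int (4950 * d) * 2 ^ e \<le> 2 * u * 2 ^ r"
    and \<delta>0: "0 \<le> \<delta>" and v0: "0 \<le> 100 * v - lg_fact 100" and y: "1024 * int q + lg_up c - lg_dn n + 100 * \<delta> \<le> y"
    and \<theta>: "1024 * int q * int n + int n * lg_up c - lg_fact n + l + lg_up (d choose t) + (100 * v - lg_fact 100) + u
       - y * (int n - int off) - 1024 * int r * int t \<le> \<theta>"
    using ok unfolding tail_ok_def Let_def \<delta>_def[symmetric] v_def[symmetric] by simp_all
  define z where "z = 1024 * int q * int s + int s * lg_up c - (lg_fact n + int h * lg_dn n)"
  have thin: "thin S" if "S \<in> sets_of_size s" for S using that by (simp add: sets_of_size_def)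
  have sum: "(\<Sum>i<c. card (fiber i S)) = s" if "S \<in> sets_of_size s" for S
    using that thin_fibers by (simp add: sets_of_size_def)
  \<comment> \<open>Each factor of \<open>fact s\<close> beyond \<open>n\<close> is replaced by
    \<open>n\<close>, so that the exponent becomes linear in \<open>h\<close>.\<close>
  have fact: "2 powr (real_of_int (lg_fact n + int h * lg_dn n) / 1024) \<le> fact s"
    unfolding sh
  proof (induction h)
    case (Suc h)
    have "2 powr (real_of_int (lg_fact n + int (Suc h) * lg_dn n) / 1024)
        = 2 powr (real_of_int (lg_dn n) / 1024) * 2 powr (real_of_int (lg_fact n + int h * lg_dn n) / 1024)"
      by (simp add: powr_add[symmetric] algebra_simps add_divide_distrib)
    also have "\<dots> \<le> real (Suc (n + h)) * fact (n + h)"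
      using Suc lg_dn[OF n] by (intro mult_mono) (simp_all add: order_trans)
    finally show ?case by simp
  qed (simp add: lg_fact)
  have Z: "real (card (sets_of_size s)) \<le> 2 powr (real_of_int z / 1024)"
    using card_sets_of_size_gen[OF q r fact] by (simp add: z_def)
  have V: "real (card (partial_keys c S)) \<le> 2 powr (real_of_int (v + int h * \<delta>) / 1024)" if "S \<in> sets_of_size s" for S
  proof -
    have "int c * lg_up (Suc g) + (int s - int (c * g)) * \<delta> = v + int h * \<delta>"
      by (simp add: v_def sh algebra_simps)
    moreover have "real (card (partial_keys c S))
        \<le> 2 powr (real_of_int (int c * lg_up (Suc g) + (int s - int (c * g)) * \<delta>) / 1024)"
      unfolding \<delta>_def
      by (rule order_trans[OF partial_keys_prod[OF thin[OF that]] prod_keys_tangent[OF _ _ sum[OF that]]])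
        (use g s in simp_all)
    ultimately show ?thesis by simp
  qed
  have max: "max 0 (100 * (v + int h * \<delta>) - lg_fact 100) = 100 * v - lg_fact 100 + 100 * (int h * \<delta>)"
  proof -
    have "0 \<le> int h * \<delta>" using \<delta>0 by simp
    then show ?thesis unfolding distrib_left using v0 by linarith
  qed
  have u': "1024 * (3 * (real (4950 * d) * 2 ^ e / 2 ^ r) / 2) \<le> real_of_int u"
  proof -
    have "real_of_int (3072 * int (4950 * d) * 2 ^ e) \<le> real_of_int (2 * u * 2 ^ r)" using u by (simp only: of_int_le_iff)
    then show ?thesis by (simp add: field_simps)
  qed
  \<comment> \<open>Going from size \<open>n\<close> to \<open>n + h\<close> changes the exponent by
    at most \<open>h\<close> times the slack in the condition on \<open>y\<close>, which is
    nonpositive.\<close>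
  have "z + l + lg_up (d choose t) + (100 * v - lg_fact 100 + 100 * (int h * \<delta>)) + u - 1024 * int (e * m) - 1024 * int r * int t
    \<le> \<theta> + int h * (1024 * int q + lg_up c - lg_dn n + 100 * \<delta> - y)"
    using m \<theta> by (simp add: z_def sh algebra_simps)
  also have "\<dots> \<le> \<theta>" using y by (simp add: mult_nonneg_nonpos)
  finally have exp: "z + l + lg_up (d choose t) + (100 * v - lg_fact 100 + 100 * (int h * \<delta>)) + u - 1024 * int (e * m) - 1024 * int r * int t \<le> \<theta>" .
  have exp': "real_of_int (z + l + lg_up (d choose t) + (100 * v - lg_fact 100 + 100 * (int h * \<delta>)))
      + real_of_int u - 1024 * (real e * real m) - 1024 * (real r * real t) \<le> real_of_int \<theta>"
  proof -
    have "real_of_int (z + l + lg_up (d choose t) + (100 * v - lg_fact 100 + 100 * (int h * \<delta>)) + u - 1024 * int (e * m) - 1024 * int r * int t) \<le> real_of_int \<theta>"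
      using exp by (simp only: of_int_le_iff)
    then show ?thesis by (simp add: mult.assoc)
  qed
  have "measure_pmf.prob p {w. linked c d w (sets_of_size s) E t m}
    \<le> 2 powr (real_of_int (z + l + lg_up (d choose t) + max 0 (100 * (v + int h * \<delta>) - lg_fact 100)) / 1024
        + 3 * (real (4950 * d) * 2 ^ e / 2 ^ r) / 2 - real e * real m - real r * real t)"
    by (rule prob_linked_keys_geometric[OF thin Z E r V])
  also have "\<dots> \<le> 2 powr (real_of_int \<theta> / 1024)"
    unfolding max
  proof (intro powr_mono)
    have "i / 1024 + f - em - rt \<le> x / 1024" if "i + u - 1024 * em - 1024 * rt \<le> x" "1024 * f \<le> u"
      for i f em rt x u :: real using that by simp
    from this[OF exp' u'] show "real_of_int (z + l + lg_up (d choose t) + (100 * v - lg_fact 100 + 100 * (int h * \<delta>))) / 1024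
        + 3 * (real (4950 * d) * 2 ^ e / 2 ^ r) / 2 - real e * real m - real r * real t \<le> real_of_int \<theta> / 1024" .
  qed simp
  finally show ?thesis .
qed

lemma prob_single_tail:
  assumes "tail_ok c d q r 0 0 e g 0 y u n \<theta>" "n \<le> s" "3 < n" "y * int (2 * c) \<le> int (1024 * e * d)"
  shows "measure_pmf.prob p {w. single_event s w} \<le> 2 powr (real_of_int \<theta> / 1024)"
  unfolding single_event_def
proof (rule prob_tail[OF assms(1,2)])
  have "d * s \<le> 2 * c * rank_single c d s"
    using le_ceil_div[of "2 * c" "d * s"] c assms(2,3) by (simp add: rank_single_def)
  then have "int (1024 * e) * int (d * s) \<le> int (1024 * e) * int (2 * c * rank_single c d s)"
    by (intro mult_left_mono) (simp_all only: of_nat_le_iff of_nat_0_le_iff)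
  moreover have "int (2 * c) * (y * int s) \<le> int (1024 * e * d) * int s"
    using mult_right_mono[OF assms(4), of "int s"] by (simp add: algebra_simps)
  ultimately have "int (2 * c) * (y * int s) \<le> int (2 * c) * (1024 * int (e * rank_single c d s))"
    by (simp add: algebra_simps)
  then show "y * (int s - int 0) \<le> 1024 * int (e * rank_single c d s)" using c by simp
qed simp

text \<open>\<open>17408 = 17 * 1024\<close> is the exponent of \<open>2 ^ 17\<close>, which exceeds
  the \<open>512 choose 2\<close> pairs of a set of 512 characters. One bound on the number of pairs
  thus serves all sizes up to 512.\<close>

lemma prob_split_tail:
  assumes ok: "tail_ok c d q r t 17408 e g 2 y u n \<theta>" and s: "n \<le> s" "2 < n" "s \<le> 512"
    and y: "y * int (2 * (c - 1)) \<le> int (1024 * e * (d - t))" and c2: "2 \<le> c" "d \<le> c * t" "t \<le> d"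
  shows "measure_pmf.prob p {w. split_event t s w} \<le> 2 powr (real_of_int \<theta> / 1024)"
proof (rule prob_mono)
  show "size_event t s w" if "split_event t s w" for w using split_event_imp_size_event[OF that c2] .
  show "measure_pmf.prob p {w. size_event t s w} \<le> 2 powr (real_of_int \<theta> / 1024)"
    unfolding size_event_def
  proof (rule prob_tail[OF ok s(1)])
    fix S assume S: "S \<in> sets_of_size s"
    then have fin: "finite S" "card S = s" using thin_finite by (simp_all add: sets_of_size_def)
    have "card (pairs S) = s choose 2" using n_subsets[OF fin(1), of 2] fin(2) by (simp add: pairs_def)
    also have "\<dots> \<le> 512 * 511 div 2" unfolding choose_two using s(3) by (intro div_le_mono mult_mono) simp_all
    finally have "real (card (pairs S)) \<le> 131072" by simp
    also have "\<dots> = 2 powr 17" by (simp add: powr_numeral)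
    finally show "finite (pairs S) \<and> real (card (pairs S)) \<le> 2 powr (real_of_int 17408 / 1024) \<and> pairs S \<subseteq> Pow S"
      using pairs_bound[OF S] by simp
  next
    let ?m = "rank_size c d t s"
    have "(d - t) * (s - 2) \<le> 2 * (c - 1) * ?m"
      using le_ceil_div[of "2 * (c - 1)" "(d - t) * (s - 2)"] c2 by (simp add: rank_size_def)
    then have "int (1024 * e) * int ((d - t) * (s - 2)) \<le> int (1024 * e) * int (2 * (c - 1) * ?m)"
      by (intro mult_left_mono) (simp_all only: of_nat_le_iff of_nat_0_le_iff)
    moreover have "int (2 * (c - 1)) * (y * int (s - 2)) \<le> int (1024 * e * (d - t)) * int (s - 2)"
    proof -
      have "int (2 * (c - 1)) * (y * int (s - 2)) = (y * int (2 * (c - 1))) * int (s - 2)"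
        by (simp only: mult.commute mult.left_commute mult.assoc)
      also have "\<dots> \<le> int (1024 * e * (d - t)) * int (s - 2)" by (rule mult_right_mono[OF y]) simp
      finally show ?thesis .
    qed
    moreover have "int (1024 * e) * int ((d - t) * (s - 2)) = int (1024 * e * (d - t)) * int (s - 2)" by simp
    moreover have "int (1024 * e) * int (2 * (c - 1) * ?m) = int (2 * (c - 1)) * (1024 * int (e * ?m))" by simp
    ultimately have "int (2 * (c - 1)) * (y * int (s - 2)) \<le> int (2 * (c - 1)) * (1024 * int (e * ?m))"
      by linarith
    moreover have "0 < int (2 * (c - 1))" using c2(1) by simp
    ultimately have "y * int (s - 2) \<le> 1024 * int (e * ?m)" by (simp only: mult_le_cancel_left_pos)
    moreover have "int (s - 2) = int s - int 2" using s by simp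
    ultimately show "y * (int s - int 2) \<le> 1024 * int (e * ?m)" by simp
  qed
qed

lemma prob_single_3_powr:
  assumes "size_exp c q 3 + lg_up (d choose 0) + lg_up (d * 3 choose rank_single c d 3)
    - 1024 * int r * int (rank_single c d 3) \<le> \<theta>" "\<theta> \<le> - (1024 * int n)"
  shows "measure_pmf.prob p {w. \<exists>s\<in>{3}. single_event s w} \<le> real (1 * 1) * (1 / 2) ^ n"
  by (rule prob_Bex_powr[OF _ _ _ assms(2)]) (use prob_single_3[OF assms(1)] in simp_all)

lemma prob_singles:
  assumes "all_from N a (single_ok c d q r \<theta>)" "\<theta> \<le> - (1024 * int n)"
  shows "measure_pmf.prob p {w. \<exists>s\<in>{a..<a + N}. single_event s w} \<le> real (N * 1) * (1 / 2) ^ n"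
  by (rule prob_Bex_powr[OF _ _ _ assms(2)]) (use prob_single[OF all_fromD[OF assms(1)]] in simp_all)

lemma prob_singles_tail:
  assumes "tail_ok c d q r 0 0 e g 0 y u s\<^sub>1 \<theta>" "3 < s\<^sub>1" "y * int (2 * c) \<le> int (1024 * e * d)" "\<theta> \<le> - (1024 * int n)"
  shows "measure_pmf.prob p {w. \<exists>s\<in>{s\<^sub>1..c * 100}. single_event s w} \<le> real (c * 100 * 1) * (1 / 2) ^ n"
  by (rule prob_Bex_powr[OF _ _ _ assms(4)]) (use prob_single_tail[OF assms(1) _ assms(2,3)] assms(2) in simp_all)

lemma prob_splits_size:
  assumes "all_from N a (size_ok c d q r t \<theta>)" "\<theta> \<le> - (1024 * int n)" "2 \<le> c" "d \<le> c * t" "t \<le> d"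
  shows "measure_pmf.prob p {w. \<exists>s\<in>{a..<a + N}. split_event t s w} \<le> real (N * 1) * (1 / 2) ^ n"
  by (rule prob_Bex_powr[OF _ _ _ assms(2)]) (use prob_split_size[OF all_fromD[OF assms(1)] assms(3-5)] in simp_all)

text \<open>A row of size \<open>s\<close> has a factor \<open>c * (s - 1)\<close> for the position
  and the fiber size; the factor of the last row is used for all rows.\<close>

lemma prob_splits_type:
  assumes "all_from N a (type_row_ok c d q r t \<theta>)" "\<theta> \<le> - (1024 * int n)" "2 \<le> c"
  shows "measure_pmf.prob p {w. \<exists>s\<in>{a..<a + N}. split_event t s w} \<le> real (N * (c * (a + N - 2))) * (1 / 2) ^ n"
proof (rule prob_Bex_powr[OF _ _ _ assms(2)])
  fix s assume s: "s \<in> {a..<a + N}"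
  have "measure_pmf.prob p {w. split_event t s w} \<le> real (c * (s - 1)) * 2 powr (real_of_int \<theta> / 1024)"
    by (rule prob_split_type[OF all_fromD[OF assms(1)] assms(3)]) (use s in simp_all)
  also have "\<dots> \<le> real (c * (a + N - 2)) * 2 powr (real_of_int \<theta> / 1024)"
    using s by (intro mult_right_mono) (simp_all only: of_nat_le_iff atLeastLessThan_iff powr_ge_zero, intro mult_left_mono, linarith, simp)
  finally show "measure_pmf.prob p {w. split_event t s w} \<le> real (c * (a + N - 2)) * 2 powr (real_of_int \<theta> / 1024)" .
qed simp_all

lemma prob_splits_tail:
  assumes ok: "tail_ok c d q r t 17408 e g 2 y u s\<^sub>1 \<theta>" and s\<^sub>1: "2 < s\<^sub>1" "c \<le> 5"
    and y: "y * int (2 * (c - 1)) \<le> int (1024 * e * (d - t))" and \<theta>: "\<theta> \<le> - (1024 * int n)"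
    and c2: "2 \<le> c" "d \<le> c * t" "t \<le> d"
  shows "measure_pmf.prob p {w. \<exists>s\<in>{s\<^sub>1..c * 100}. split_event t s w} \<le> real (c * 100 * 1) * (1 / 2) ^ n"
proof (rule prob_Bex_powr[OF _ _ _ \<theta>])
  fix s assume s: "s \<in> {s\<^sub>1..c * 100}"
  show "measure_pmf.prob p {w. split_event t s w} \<le> real 1 * 2 powr (real_of_int \<theta> / 1024)"
    using prob_split_tail[OF ok _ s\<^sub>1(1) _ y c2, of s] s s\<^sub>1(2) by simp
qed (use s\<^sub>1 in simp_all)

lemma prob_pair_collision:
  assumes "2 \<le> k" "c * (phi choose 2) * (d choose Suc M) = N"
  shows "measure_pmf.prob p {w. pair_collision M w} \<le> real N * (1 / 2) ^ (r * Suc M)"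
  using prob_pair_collisions[OF q r assms(1), of M]
  unfolding assms(2) pair_collision_def r by (simp add: power_mult power_add power_one_over)

end

end

section \<open>Numerical verification\<close>

text \<open>The conditional form spares the evaluation of the second bound whenever the first one
  suffices.\<close>

lemma min_le_if: "min x y \<le> z \<longleftrightarrow> (if x \<le> z then True else y \<le> z)" for x y z :: int
  by auto

text \<open>Evaluates large binomial coefficients through factorials instead of Pascal's
  recursion.\<close>

lemma choose_eqI: "k \<le> n \<Longrightarrow> fact k * fact (n - k) * m = (fact n :: nat) \<Longrightarrow> n choose k = m" for k n m :: nat
proof -
  assume "k \<le> n" "fact k * fact (n - k) * m = (fact n :: nat)"
  then have "fact k * fact (n - k) * (n choose k) = (fact k * fact (n - k) * m :: nat)"
    using binomial_fact_lemma[of k n] by simp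
  then show "n choose k = m" by simp
qed

lemma choose_values:
  "(20 :: nat) choose 11 = 167960" "(24 :: nat) choose 9 = 1307504" "(24 :: nat) choose 10 = 1961256"
  "(20 :: nat) choose 12 = 125970" "(24 :: nat) choose 11 = 2496144" "(14 :: nat) choose 6 = 3003"
  "(14 :: nat) choose 4 = 1001" "(14 :: nat) choose 5 = 2002"
  "(60 :: nat) choose 15 = 53194089192720" "(72 :: nat) choose 13 = 70907466006720" "(42 :: nat) choose 6 = 5245786"
  by (rule choose_eqI; simp add: fact_numeral)+

lemmas bound_defs = min_le_if size_bound_def type_bound_def Let_def even_exp_def key_exp_def size_exp_def type_exp_def
  even_bound_def key_bound_def even_up_def even_poly_def rank_single_def rank_type_def rank_size_def ceil_div_def

lemmas numeric_values = numeral_2_eq_2[symmetric] lg_up_values lg_fact_values choose_values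

text \<open>Sizes with a weak exponent get a row of their own. In the second parameter set the count
  by even subsets is the better one at 29 and the count by keys at 30; in the third set they change
  places between 46 and 47. Size 4 of the third set forces only seven relations.\<close>

lemma single_checks:
  "all_from 37 4 (single_ok 2 20 16 16 (-153600))"
  "all_from 26 4 (single_ok 3 24 22 22 (-183296))" "all_from 1 30 (single_ok 3 24 22 22 (-166912))"
  "all_from 6 31 (single_ok 3 24 22 22 (-183296))"
  "all_from 1 4 (single_ok 4 14 16 32 (-124928))" "all_from 41 5 (single_ok 4 14 16 32 (-138240))"
  "all_from 1 46 (single_ok 4 14 16 32 (-126976))" "all_from 6 47 (single_ok 4 14 16 32 (-138240))"
  by (simp_all add: all_from_numeral single_ok_def bound_defs numeric_values)

text \<open>The sizes missing between these ranges are checked by type, where the rank may use the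
  actual fiber size instead of the worst case \<open>a = 2\<close>.\<close>

lemma size_checks:
  "all_from 38 3 (size_ok 2 20 16 16 11 (-154624))"
  "all_from 36 3 (size_ok 3 24 22 22 9 (-176128))"
  "all_from 28 3 (size_ok 3 24 22 22 10 (-176128))" "all_from 4 37 (size_ok 3 24 22 22 10 (-176128))"
  "all_from 44 4 (size_ok 4 14 16 32 4 (-137216))" "all_from 6 51 (size_ok 4 14 16 32 4 (-137216))"
  "all_from 41 3 (size_ok 4 14 16 32 5 (-137216))" "all_from 2 65 (size_ok 4 14 16 32 5 (-137216))"
  by (simp_all add: all_from_numeral size_ok_def bound_defs numeric_values)

lemma type_checks_2:
  "all_from 6 31 (type_row_ok 3 24 22 22 10 (-203776))"
  by (simp_all add: all_from_numeral all_pairs_numeral type_row_ok_def type_ok_def bound_defs numeric_values)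

lemma type_checks_3:
  "all_from 1 3 (type_row_ok 4 14 16 32 4 (-124928))"
  "all_from 3 48 (type_row_ok 4 14 16 32 4 (-158720))"
  by (simp_all add: all_from_numeral all_pairs_numeral type_row_ok_def type_ok_def bound_defs numeric_values)

lemma type_checks_3_a:
  "all_from 6 44 (type_row_ok 4 14 16 32 5 (-134144))"
  by (simp_all add: all_from_numeral all_pairs_numeral type_row_ok_def type_ok_def bound_defs numeric_values)

lemma type_checks_3_b:
  "all_from 5 50 (type_row_ok 4 14 16 32 5 (-134144))"
  by (simp_all add: all_from_numeral all_pairs_numeral type_row_ok_def type_ok_def bound_defs numeric_values)

lemma type_checks_3_c:
  "all_from 5 55 (type_row_ok 4 14 16 32 5 (-134144))"
  by (simp_all add: all_from_numeral all_pairs_numeral type_row_ok_def type_ok_def bound_defs numeric_values)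

lemma type_checks_3_d:
  "all_from 5 60 (type_row_ok 4 14 16 32 5 (-134144))"
  by (simp_all add: all_from_numeral all_pairs_numeral type_row_ok_def type_ok_def bound_defs numeric_values)

lemma size_3_checks:
  "size_exp 2 16 3 + lg_up (20 choose 0) + lg_up (20 * 3 choose rank_single 2 20 3)
    - 1024 * int 16 * int (rank_single 2 20 3) \<le> - 148480"
  "size_exp 3 22 3 + lg_up (24 choose 0) + lg_up (24 * 3 choose rank_single 3 24 3)
    - 1024 * int 22 * int (rank_single 3 24 3) \<le> - 175104"
  "size_exp 4 16 3 + lg_up (14 choose 0) + lg_up (14 * 3 choose rank_single 4 14 3)
    - 1024 * int 32 * int (rank_single 4 14 3) \<le> - 120832"
  by (simp_all add: bound_defs numeric_values)

text \<open>\<open>y\<close> is exactly the gain per character,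
  \<open>1024 * e * d / (2 * c)\<close> or \<open>1024 * e * (d - t) / (2 * (c - 1))\<close>;
  \<open>u\<close> is \<open>1536 * 4950 * d * 2 ^ e / 2 ^ r\<close>; and \<open>g\<close> is
  \<open>n div c\<close> for the starting size \<open>n\<close>. The decay \<open>e\<close> per
  relation is chosen freely.\<close>

lemma tail_checks:
  "tail_ok 2 20 16 16 0 0 7 20 0 35840 297000 41 (-257024)"
  "tail_ok 2 20 16 16 11 17408 6 20 2 27648 148500 41 (-159744)"
  "tail_ok 3 24 22 22 0 0 12 12 0 49152 178200 37 (-282624)"
  "tail_ok 3 24 22 22 9 17408 12 13 2 46080 178200 39 (-274432)"
  "tail_ok 3 24 22 22 10 17408 12 13 2 43008 178200 41 (-209920)"
  "tail_ok 4 14 16 32 0 0 22 13 0 39424 103950 53 (-211968)"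
  "tail_ok 4 14 16 32 4 17408 21 14 2 35840 51975 57 (-159744)"
  "tail_ok 4 14 16 32 5 17408 22 16 2 33792 103950 67 (-150528)"
  by (simp_all add: tail_ok_def Let_def numeric_values lg_dn_values)

section \<open>The three parameter sets\<close>

lemma not_unique_16_16:
  assumes "random_simple_tabulation p (2^16) (2^16) 2 20 100"
  shows "prob_not_unique p (2^16) (2^16) 2 20 100 \<le> 15 / 10^43"
proof -
  interpret random_tab p "2^16" "2^16" 2 20 100
    by unfold_locales (rule assms, simp_all)
  \<comment> \<open>Twelve collisions of a pair are rare enough by themselves, and
    \<open>20 < 2 * t\<close> with \<open>t \<le> 11\<close> leaves only \<open>t = 11\<close>. The
    factor is \<open>2 * (2 ^ 16 choose 2) * (20 choose 12)\<close>.\<close>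
  have P: "measure_pmf.prob p {w. pair_collision 11 w} \<le> real 541028774707200 * (1 / 2) ^ (16 * Suc 11)"
    by (rule prob_pair_collision[OF refl refl]) (simp_all add: choose_two choose_values)
  have A0: "measure_pmf.prob p {w. \<exists>s\<in>{3}. single_event s w} \<le> real (1 * 1) * (1 / 2) ^ 145"
    by (rule prob_single_3_powr[OF refl refl size_3_checks(1)]) simp_all
  have A1: "measure_pmf.prob p {w. \<exists>s\<in>{4..<4 + 37}. single_event s w} \<le> real (37 * 1) * (1 / 2) ^ 150"
    by (rule prob_singles[OF refl refl single_checks(1)]) simp_all
  have A2: "measure_pmf.prob p {w. \<exists>s\<in>{41..2 * 100}. single_event s w} \<le> real (2 * 100 * 1) * (1 / 2) ^ 251"
    by (rule prob_singles_tail[OF refl refl tail_checks(1)]) simp_all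
  have A: "measure_pmf.prob p {w. \<exists>s\<in>{3..2 * 100}. single_event s w}
      \<le> real (1 * 1) * (1 / 2) ^ 145 + (real (37 * 1) * (1 / 2) ^ 150 + (real (2 * 100 * 1) * (1 / 2) ^ 251))"
    by (rule prob_Bex_Un[OF _ A0 prob_Bex_Un[OF subset_refl A1 A2]]) auto
  have B11_0: "measure_pmf.prob p {w. \<exists>s\<in>{3..<3 + 38}. split_event 11 s w} \<le> real (38 * 1) * (1 / 2) ^ 151"
    by (rule prob_splits_size[OF refl refl size_checks(1)]) simp_all
  have B11_1: "measure_pmf.prob p {w. \<exists>s\<in>{41..2 * 100}. split_event 11 s w} \<le> real (2 * 100 * 1) * (1 / 2) ^ 156"
    by (rule prob_splits_tail[OF refl refl tail_checks(2)]) simp_all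
  have B11_: "measure_pmf.prob p {w. \<exists>s\<in>{3..2 * 100}. split_event 11 s w}
      \<le> real (38 * 1) * (1 / 2) ^ 151 + (real (2 * 100 * 1) * (1 / 2) ^ 156)"
    by (rule prob_Bex_Un[OF _ B11_0 B11_1]) auto
  have B: "measure_pmf.prob p {w. \<exists>t\<in>{t. 20 < 2 * t \<and> t \<le> 11 \<and> t \<le> 20}. \<exists>s\<in>{3..2 * 100}. split_event t s w}
      \<le> real (38 * 1) * (1 / 2) ^ 151 + (real (2 * 100 * 1) * (1 / 2) ^ 156)"
  proof (rule prob_mono[OF _ B11_])
    fix w assume "\<exists>t\<in>{t. 20 < 2 * t \<and> t \<le> 11 \<and> t \<le> 20}. \<exists>s\<in>{3..2 * 100}. split_event t s w"
    then obtain t where t: "t \<in> {t. 20 < 2 * t \<and> t \<le> 11 \<and> t \<le> 20}" and s: "\<exists>s\<in>{3..2 * 100}. split_event t s w"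
      by (rule bexE)
    from t have "t = 11" by auto
    with s show "\<exists>s\<in>{3..2 * 100}. split_event 11 s w" by simp
  qed
  have "prob_not_unique p (2^16) (2^16) 2 20 100
      \<le> real 541028774707200 * (1 / 2) ^ (16 * Suc 11) + (real (1 * 1) * (1 / 2) ^ 145 + (real (37 * 1) * (1 / 2) ^ 150 + (real (2 * 100 * 1) * (1 / 2) ^ 251))) + (real (38 * 1) * (1 / 2) ^ 151 + (real (2 * 100 * 1) * (1 / 2) ^ 156))"
    unfolding prob_not_unique_def by (rule prob_not_unique_le[OF refl refl _ _ P A B]) simp_all
  also have "\<dots> \<le> 15 / 10^43" by (simp add: power_divide)
  finally show ?thesis .
qed

lemma not_unique_22_22:
  assumes "random_simple_tabulation p (2^22) (2^22) 3 24 100"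
  shows "prob_not_unique p (2^22) (2^22) 3 24 100 \<le> 14 / 10^50"
proof -
  interpret random_tab p "2^22" "2^22" 3 24 100
    by unfold_locales (rule assms, simp_all)
  \<comment> \<open>With the threshold 10, the condition \<open>24 < 3 * t\<close> leaves
    \<open>t = 9\<close> and \<open>t = 10\<close>.\<close>
  have P: "measure_pmf.prob p {w. pair_collision 10 w} \<le> real 65868928758098952192 * (1 / 2) ^ (22 * Suc 10)"
    by (rule prob_pair_collision[OF refl refl]) (simp_all add: choose_two choose_values)
  have A0: "measure_pmf.prob p {w. \<exists>s\<in>{3}. single_event s w} \<le> real (1 * 1) * (1 / 2) ^ 171"
    by (rule prob_single_3_powr[OF refl refl size_3_checks(2)]) simp_all
  have A1: "measure_pmf.prob p {w. \<exists>s\<in>{4..<4 + 26}. single_event s w} \<le> real (26 * 1) * (1 / 2) ^ 179"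
    by (rule prob_singles[OF refl refl single_checks(2)]) simp_all
  \<comment> \<open>This is the largest term of the final sum.\<close>
  have A2: "measure_pmf.prob p {w. \<exists>s\<in>{30..<30 + 1}. single_event s w} \<le> real (1 * 1) * (1 / 2) ^ 163"
    by (rule prob_singles[OF refl refl single_checks(3)]) simp_all
  have A3: "measure_pmf.prob p {w. \<exists>s\<in>{31..<31 + 6}. single_event s w} \<le> real (6 * 1) * (1 / 2) ^ 179"
    by (rule prob_singles[OF refl refl single_checks(4)]) simp_all
  have A4: "measure_pmf.prob p {w. \<exists>s\<in>{37..3 * 100}. single_event s w} \<le> real (3 * 100 * 1) * (1 / 2) ^ 276"
    by (rule prob_singles_tail[OF refl refl tail_checks(3)]) simp_all
  have A: "measure_pmf.prob p {w. \<exists>s\<in>{3..3 * 100}. single_event s w}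
      \<le> real (1 * 1) * (1 / 2) ^ 171 + (real (26 * 1) * (1 / 2) ^ 179 + (real (1 * 1) * (1 / 2) ^ 163 + (real (6 * 1) * (1 / 2) ^ 179 + (real (3 * 100 * 1) * (1 / 2) ^ 276))))"
    by (rule prob_Bex_Un[OF _ A0 prob_Bex_Un[OF subset_refl A1 prob_Bex_Un[OF subset_refl A2 prob_Bex_Un[OF subset_refl A3 A4]]]]) auto
  have B9_0: "measure_pmf.prob p {w. \<exists>s\<in>{3..<3 + 36}. split_event 9 s w} \<le> real (36 * 1) * (1 / 2) ^ 172"
    by (rule prob_splits_size[OF refl refl size_checks(2)]) simp_all
  have B9_1: "measure_pmf.prob p {w. \<exists>s\<in>{39..3 * 100}. split_event 9 s w} \<le> real (3 * 100 * 1) * (1 / 2) ^ 268"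
    by (rule prob_splits_tail[OF refl refl tail_checks(4)]) simp_all
  have B9_: "measure_pmf.prob p {w. \<exists>s\<in>{3..3 * 100}. split_event 9 s w}
      \<le> real (36 * 1) * (1 / 2) ^ 172 + (real (3 * 100 * 1) * (1 / 2) ^ 268)"
    by (rule prob_Bex_Un[OF _ B9_0 B9_1]) auto
  have B10_0: "measure_pmf.prob p {w. \<exists>s\<in>{3..<3 + 28}. split_event 10 s w} \<le> real (28 * 1) * (1 / 2) ^ 172"
    by (rule prob_splits_size[OF refl refl size_checks(3)]) simp_all
  have B10_1: "measure_pmf.prob p {w. \<exists>s\<in>{31..<31 + 6}. split_event 10 s w} \<le> real (6 * (3 * (31 + 6 - 2))) * (1 / 2) ^ 199"
    by (rule prob_splits_type[OF refl refl type_checks_2]) simp_all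
  have B10_2: "measure_pmf.prob p {w. \<exists>s\<in>{37..<37 + 4}. split_event 10 s w} \<le> real (4 * 1) * (1 / 2) ^ 172"
    by (rule prob_splits_size[OF refl refl size_checks(4)]) simp_all
  have B10_3: "measure_pmf.prob p {w. \<exists>s\<in>{41..3 * 100}. split_event 10 s w} \<le> real (3 * 100 * 1) * (1 / 2) ^ 205"
    by (rule prob_splits_tail[OF refl refl tail_checks(5)]) simp_all
  have B10_: "measure_pmf.prob p {w. \<exists>s\<in>{3..3 * 100}. split_event 10 s w}
      \<le> real (28 * 1) * (1 / 2) ^ 172 + (real (6 * (3 * (31 + 6 - 2))) * (1 / 2) ^ 199 + (real (4 * 1) * (1 / 2) ^ 172 + (real (3 * 100 * 1) * (1 / 2) ^ 205)))"
    by (rule prob_Bex_Un[OF _ B10_0 prob_Bex_Un[OF subset_refl B10_1 prob_Bex_Un[OF subset_refl B10_2 B10_3]]]) auto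
  have B: "measure_pmf.prob p {w. \<exists>t\<in>{t. 24 < 3 * t \<and> t \<le> 10 \<and> t \<le> 24}. \<exists>s\<in>{3..3 * 100}. split_event t s w}
      \<le> real (36 * 1) * (1 / 2) ^ 172 + (real (3 * 100 * 1) * (1 / 2) ^ 268) + (real (28 * 1) * (1 / 2) ^ 172 + (real (6 * (3 * (31 + 6 - 2))) * (1 / 2) ^ 199 + (real (4 * 1) * (1 / 2) ^ 172 + (real (3 * 100 * 1) * (1 / 2) ^ 205))))"
  proof (rule prob_le_add[OF _ B9_ B10_])
    fix w assume "\<exists>t\<in>{t. 24 < 3 * t \<and> t \<le> 10 \<and> t \<le> 24}. \<exists>s\<in>{3..3 * 100}. split_event t s w"
    then obtain t where t: "t \<in> {t. 24 < 3 * t \<and> t \<le> 10 \<and> t \<le> 24}" and s: "\<exists>s\<in>{3..3 * 100}. split_event t s w"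
      by (rule bexE)
    from t have "t = 9 \<or> t = 10" by auto
    with s show "(\<exists>s\<in>{3..3 * 100}. split_event 9 s w) \<or> (\<exists>s\<in>{3..3 * 100}. split_event 10 s w)"
      by (elim disjE) simp_all
  qed
  have "prob_not_unique p (2^22) (2^22) 3 24 100
      \<le> real 65868928758098952192 * (1 / 2) ^ (22 * Suc 10) + (real (1 * 1) * (1 / 2) ^ 171 + (real (26 * 1) * (1 / 2) ^ 179 + (real (1 * 1) * (1 / 2) ^ 163 + (real (6 * 1) * (1 / 2) ^ 179 + (real (3 * 100 * 1) * (1 / 2) ^ 276))))) + (real (36 * 1) * (1 / 2) ^ 172 + (real (3 * 100 * 1) * (1 / 2) ^ 268) + (real (28 * 1) * (1 / 2) ^ 172 + (real (6 * (3 * (31 + 6 - 2))) * (1 / 2) ^ 199 + (real (4 * 1) * (1 / 2) ^ 172 + (real (3 * 100 * 1) * (1 / 2) ^ 205)))))"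
    unfolding prob_not_unique_def by (rule prob_not_unique_le[OF refl refl _ _ P A B]) simp_all
  also have "\<dots> \<le> 14 / 10^50" by (simp add: power_divide)
  finally show ?thesis .
qed

lemma not_unique_16_32:
  assumes "random_simple_tabulation p (2^16) (2^32) 4 14 100"
  shows "prob_not_unique p (2^16) (2^32) 4 14 100 \<le> 9 / 10^36"
proof -
  interpret random_tab p "2^16" "2^32" 4 14 100
    by unfold_locales (rule assms, simp_all)
  \<comment> \<open>With the threshold 5, the condition \<open>14 < 4 * t\<close> leaves
    \<open>t = 4\<close> and \<open>t = 5\<close>.\<close>
  have P: "measure_pmf.prob p {w. pair_collision 5 w} \<le> real 25795179970560 * (1 / 2) ^ (32 * Suc 5)"
    by (rule prob_pair_collision[OF refl refl]) (simp_all add: choose_two choose_values)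
  \<comment> \<open>The largest single term of this parameter set comes from three position
    characters.\<close>
  have A0: "measure_pmf.prob p {w. \<exists>s\<in>{3}. single_event s w} \<le> real (1 * 1) * (1 / 2) ^ 118"
    by (rule prob_single_3_powr[OF refl refl size_3_checks(3)]) simp_all
  have A1: "measure_pmf.prob p {w. \<exists>s\<in>{4..<4 + 1}. single_event s w} \<le> real (1 * 1) * (1 / 2) ^ 122"
    by (rule prob_singles[OF refl refl single_checks(5)]) simp_all
  have A2: "measure_pmf.prob p {w. \<exists>s\<in>{5..<5 + 41}. single_event s w} \<le> real (41 * 1) * (1 / 2) ^ 135"
    by (rule prob_singles[OF refl refl single_checks(6)]) simp_all
  have A3: "measure_pmf.prob p {w. \<exists>s\<in>{46..<46 + 1}. single_event s w} \<le> real (1 * 1) * (1 / 2) ^ 124"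
    by (rule prob_singles[OF refl refl single_checks(7)]) simp_all
  have A4: "measure_pmf.prob p {w. \<exists>s\<in>{47..<47 + 6}. single_event s w} \<le> real (6 * 1) * (1 / 2) ^ 135"
    by (rule prob_singles[OF refl refl single_checks(8)]) simp_all
  have A5: "measure_pmf.prob p {w. \<exists>s\<in>{53..4 * 100}. single_event s w} \<le> real (4 * 100 * 1) * (1 / 2) ^ 207"
    by (rule prob_singles_tail[OF refl refl tail_checks(6)]) simp_all
  have A: "measure_pmf.prob p {w. \<exists>s\<in>{3..4 * 100}. single_event s w}
      \<le> real (1 * 1) * (1 / 2) ^ 118 + (real (1 * 1) * (1 / 2) ^ 122 + (real (41 * 1) * (1 / 2) ^ 135 + (real (1 * 1) * (1 / 2) ^ 124 + (real (6 * 1) * (1 / 2) ^ 135 + (real (4 * 100 * 1) * (1 / 2) ^ 207)))))"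
    by (rule prob_Bex_Un[OF _ A0 prob_Bex_Un[OF subset_refl A1 prob_Bex_Un[OF subset_refl A2 prob_Bex_Un[OF subset_refl A3 prob_Bex_Un[OF subset_refl A4 A5]]]]]) auto
  have B4_0: "measure_pmf.prob p {w. \<exists>s\<in>{3..<3 + 1}. split_event 4 s w} \<le> real (1 * (4 * (3 + 1 - 2))) * (1 / 2) ^ 122"
    by (rule prob_splits_type[OF refl refl type_checks_3(1)]) simp_all
  have B4_1: "measure_pmf.prob p {w. \<exists>s\<in>{4..<4 + 44}. split_event 4 s w} \<le> real (44 * 1) * (1 / 2) ^ 134"
    by (rule prob_splits_size[OF refl refl size_checks(5)]) simp_all
  have B4_2: "measure_pmf.prob p {w. \<exists>s\<in>{48..<48 + 3}. split_event 4 s w} \<le> real (3 * (4 * (48 + 3 - 2))) * (1 / 2) ^ 155"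
    by (rule prob_splits_type[OF refl refl type_checks_3(2)]) simp_all
  have B4_3: "measure_pmf.prob p {w. \<exists>s\<in>{51..<51 + 6}. split_event 4 s w} \<le> real (6 * 1) * (1 / 2) ^ 134"
    by (rule prob_splits_size[OF refl refl size_checks(6)]) simp_all
  have B4_4: "measure_pmf.prob p {w. \<exists>s\<in>{57..4 * 100}. split_event 4 s w} \<le> real (4 * 100 * 1) * (1 / 2) ^ 156"
    by (rule prob_splits_tail[OF refl refl tail_checks(7)]) simp_all
  have B4_: "measure_pmf.prob p {w. \<exists>s\<in>{3..4 * 100}. split_event 4 s w}
      \<le> real (1 * (4 * (3 + 1 - 2))) * (1 / 2) ^ 122 + (real (44 * 1) * (1 / 2) ^ 134 + (real (3 * (4 * (48 + 3 - 2))) * (1 / 2) ^ 155 + (real (6 * 1) * (1 / 2) ^ 134 + (real (4 * 100 * 1) * (1 / 2) ^ 156))))"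
    by (rule prob_Bex_Un[OF _ B4_0 prob_Bex_Un[OF subset_refl B4_1 prob_Bex_Un[OF subset_refl B4_2 prob_Bex_Un[OF subset_refl B4_3 B4_4]]]]) auto
  have B5_0: "measure_pmf.prob p {w. \<exists>s\<in>{3..<3 + 41}. split_event 5 s w} \<le> real (41 * 1) * (1 / 2) ^ 134"
    by (rule prob_splits_size[OF refl refl size_checks(7)]) simp_all
  have B5_1: "measure_pmf.prob p {w. \<exists>s\<in>{44..<44 + 6}. split_event 5 s w} \<le> real (6 * (4 * (44 + 6 - 2))) * (1 / 2) ^ 131"
    by (rule prob_splits_type[OF refl refl type_checks_3_a]) simp_all
  have B5_2: "measure_pmf.prob p {w. \<exists>s\<in>{50..<50 + 5}. split_event 5 s w} \<le> real (5 * (4 * (50 + 5 - 2))) * (1 / 2) ^ 131"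
    by (rule prob_splits_type[OF refl refl type_checks_3_b]) simp_all
  have B5_3: "measure_pmf.prob p {w. \<exists>s\<in>{55..<55 + 5}. split_event 5 s w} \<le> real (5 * (4 * (55 + 5 - 2))) * (1 / 2) ^ 131"
    by (rule prob_splits_type[OF refl refl type_checks_3_c]) simp_all
  have B5_4: "measure_pmf.prob p {w. \<exists>s\<in>{60..<60 + 5}. split_event 5 s w} \<le> real (5 * (4 * (60 + 5 - 2))) * (1 / 2) ^ 131"
    by (rule prob_splits_type[OF refl refl type_checks_3_d]) simp_all
  have B5_5: "measure_pmf.prob p {w. \<exists>s\<in>{65..<65 + 2}. split_event 5 s w} \<le> real (2 * 1) * (1 / 2) ^ 134"
    by (rule prob_splits_size[OF refl refl size_checks(8)]) simp_all
  have B5_6: "measure_pmf.prob p {w. \<exists>s\<in>{67..4 * 100}. split_event 5 s w} \<le> real (4 * 100 * 1) * (1 / 2) ^ 147"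
    by (rule prob_splits_tail[OF refl refl tail_checks(8)]) simp_all
  have B5_: "measure_pmf.prob p {w. \<exists>s\<in>{3..4 * 100}. split_event 5 s w}
      \<le> real (41 * 1) * (1 / 2) ^ 134 + (real (6 * (4 * (44 + 6 - 2))) * (1 / 2) ^ 131 + (real (5 * (4 * (50 + 5 - 2))) * (1 / 2) ^ 131 + (real (5 * (4 * (55 + 5 - 2))) * (1 / 2) ^ 131 + (real (5 * (4 * (60 + 5 - 2))) * (1 / 2) ^ 131 + (real (2 * 1) * (1 / 2) ^ 134 + (real (4 * 100 * 1) * (1 / 2) ^ 147))))))"
    by (rule prob_Bex_Un[OF _ B5_0 prob_Bex_Un[OF subset_refl B5_1 prob_Bex_Un[OF subset_refl B5_2 prob_Bex_Un[OF subset_refl B5_3 prob_Bex_Un[OF subset_refl B5_4 prob_Bex_Un[OF subset_refl B5_5 B5_6]]]]]]) auto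
  have B: "measure_pmf.prob p {w. \<exists>t\<in>{t. 14 < 4 * t \<and> t \<le> 5 \<and> t \<le> 14}. \<exists>s\<in>{3..4 * 100}. split_event t s w}
      \<le> real (1 * (4 * (3 + 1 - 2))) * (1 / 2) ^ 122 + (real (44 * 1) * (1 / 2) ^ 134 + (real (3 * (4 * (48 + 3 - 2))) * (1 / 2) ^ 155 + (real (6 * 1) * (1 / 2) ^ 134 + (real (4 * 100 * 1) * (1 / 2) ^ 156)))) + (real (41 * 1) * (1 / 2) ^ 134 + (real (6 * (4 * (44 + 6 - 2))) * (1 / 2) ^ 131 + (real (5 * (4 * (50 + 5 - 2))) * (1 / 2) ^ 131 + (real (5 * (4 * (55 + 5 - 2))) * (1 / 2) ^ 131 + (real (5 * (4 * (60 + 5 - 2))) * (1 / 2) ^ 131 + (real (2 * 1) * (1 / 2) ^ 134 + (real (4 * 100 * 1) * (1 / 2) ^ 147)))))))"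
  proof (rule prob_le_add[OF _ B4_ B5_])
    fix w assume "\<exists>t\<in>{t. 14 < 4 * t \<and> t \<le> 5 \<and> t \<le> 14}. \<exists>s\<in>{3..4 * 100}. split_event t s w"
    then obtain t where t: "t \<in> {t. 14 < 4 * t \<and> t \<le> 5 \<and> t \<le> 14}" and s: "\<exists>s\<in>{3..4 * 100}. split_event t s w"
      by (rule bexE)
    from t have "t = 4 \<or> t = 5" by auto
    with s show "(\<exists>s\<in>{3..4 * 100}. split_event 4 s w) \<or> (\<exists>s\<in>{3..4 * 100}. split_event 5 s w)"
      by (elim disjE) simp_all
  qed
  have "prob_not_unique p (2^16) (2^32) 4 14 100
      \<le> real 25795179970560 * (1 / 2) ^ (32 * Suc 5) + (real (1 * 1) * (1 / 2) ^ 118 + (real (1 * 1) * (1 / 2) ^ 122 + (real (41 * 1) * (1 / 2) ^ 135 + (real (1 * 1) * (1 / 2) ^ 124 + (real (6 * 1) * (1 / 2) ^ 135 + (real (4 * 100 * 1) * (1 / 2) ^ 207)))))) + (real (1 * (4 * (3 + 1 - 2))) * (1 / 2) ^ 122 + (real (44 * 1) * (1 / 2) ^ 134 + (real (3 * (4 * (48 + 3 - 2))) * (1 / 2) ^ 155 + (real (6 * 1) * (1 / 2) ^ 134 + (real (4 * 100 * 1) * (1 / 2) ^ 156)))) + (real (41 * 1) * (1 / 2) ^ 134 + (real (6 * (4 * (44 + 6 - 2))) * (1 / 2) ^ 131 + (real (5 * (4 * (50 + 5 - 2))) * (1 / 2) ^ 131 + (real (5 * (4 * (55 + 5 - 2)))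 * (1 / 2) ^ 131 + (real (5 * (4 * (60 + 5 - 2))) * (1 / 2) ^ 131 + (real (2 * 1) * (1 / 2) ^ 134 + (real (4 * 100 * 1) * (1 / 2) ^ 147))))))))"
    unfolding prob_not_unique_def by (rule prob_not_unique_le[OF refl refl _ _ P A B]) simp_all
  also have "\<dots> \<le> 9 / 10^36" by (simp add: power_divide)
  finally show ?thesis .
qed

theorem theorem4:
  shows "(\<forall>p. random_simple_tabulation p (2^16) (2^16) 2 20 100 \<longrightarrow>
            prob_not_unique p (2^16) (2^16) 2 20 100 \<le> 15 / 10^43)
       \<and> (\<forall>p. random_simple_tabulation p (2^22) (2^22) 3 24 100 \<longrightarrow>
            prob_not_unique p (2^22) (2^22) 3 24 100 \<le> 14 / 10^50)
       \<and> (\<forall>p. random_simple_tabulation p (2^16) (2^32) 4 14 100 \<longrightarrow>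
            prob_not_unique p (2^16) (2^32) 4 14 100 \<le> 9 / 10^36)"
  using not_unique_16_16 not_unique_22_22 not_unique_16_32 by (intro conjI allI impI)

end
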